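(* Let $n\ge1$ and $1\le d\le n$. The homogeneous coordinate ring $\mathbb{C}[\mathrm{Gr}_{d,n}]$ of the Grassmann variety, with respect to the Plücker embedding and the map $\psi:I(d,n)\to\mathbb{C}[\mathrm{Gr}_{d,n}]_1$, $\mathbf{I}\mapsto p_{\mathbf{I}}$, is governed by the finite bounded distributive lattice $I(d,n)$.
   Context: $I(d,n)=\{[i_1,\dots,i_d]\mid1\le i_1<\dots<i_d\le n\}$ with componentwise minimum as meet and componentwise maximum as join; its order is componentwise comparison. $\mathrm{Gr}_{d,n}$ is the variety of $d$-dimensional subspaces of $\mathbb{C}^n$, Plücker embedded in $\mathbb{P}(\Lambda^d\mathbb{C}^n)$, and the Plücker coordinate $p_{\mathbf{I}}\in(\Lambda^d\mathbb{C}^n)^*$ is the element dual to $e_{i_1}\wedge\dots\wedge e_{i_d}$. Definition of governed. Let $R=\bigoplus_{i\ge0}R_i$ be the homogeneous coordinate ring of an embedded projective variety, $\mathcal{L}$ a finite bounded distributive lattice and $\psi:\mathcal{L}\to R_1$, $\ell\mapsto x_\ell$, an injective map. An element $m\in\mathcal{L}$ is join-irreducible if $m=\ell\vee\ell'$ implies $m=\ell$ or $m=\ell'$ (so the minimal element is join-irreducible), and $\mathrm{maxSpec}(\ell)$ is the set of maximal elements of the set $\mathrm{Spec}(\ell)$ of join-irreducible elements $\le\ell$. $R$ is governed by $\mathcal{L}$ if the set of standard monomials $\{x_{k_1}\cdots x_{k_r}\mid k_1\ge\dots\ge k_r\in\mathcal{L},\ r\in\mathbb{Z}_{\ge0}\}$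 forms a vector space basis of $R$, and whenever $\ell_1,\ell_2\in\mathcal{L}$ are not comparable and $x_{\ell_1}x_{\ell_2}=\sum_{k_1\ge k_2}a_{k_1,k_2}x_{k_1}x_{k_2}$ is the unique expression as a linear combination of standard monomials, then (a) $a_{\ell_1\vee\ell_2,\ell_1\wedge\ell_2}=1$; (b) if $a_{k_1,k_2}\ne0$ for some $(k_1,k_2)\ne(\ell_1\vee\ell_2,\ell_1\wedge\ell_2)$, then for every pair $(m_1,m_2)$ with $m_1\in\mathrm{maxSpec}(\ell_1\vee\ell_2)$, $m_2\in\mathrm{maxSpec}(\ell_1\wedge\ell_2)$ and $m_1\ge m_2$, one of the following holds: (i) there exists $h\in\mathrm{maxSpec}(k_1)$ with $h>m_1$; (ii) (i) does not hold, and there exist $h\ne h'\in\mathrm{maxSpec}(k_1)$ with $h=m_1$ and $h'>m_2$; (iii) neither (i) nor (ii) holds, and there exist $h\in\mathrm{maxSpec}(k_1)$, $h'\in\mathrm{maxSpec}(k_2)$ with $h=m_1$ and $h'\ge m_2$. *)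

theory Defs
  imports
    Complex_Main
    "HOL-Library.Poly_Mapping"
    "HOL-Library.Function_Algebras"
    "HOL-Combinatorics.Permutations"
    "HOL-Algebra.QuotRing"
    "HOL-Algebra.Module"
begin

section \<open>Coordinate spaces\<close>

text \<open>
  For a set \<open>V\<close> of indices, the coordinate space \<open>\<complex>\<close>-to-the-\<open>V\<close> is modelled by the functions to
  \<open>complex\<close> that vanish outside \<open>V\<close>.  Linear algebra (\<open>cfun.subspace\<close>, \<open>cfun.span\<close>, \<open>cfun.dim\<close>)
  is that of the library locale \<open>vector_space\<close>.
\<close>

definition cscale :: "complex \<Rightarrow> ('v \<Rightarrow> complex) \<Rightarrow> 'v \<Rightarrow> complex" where
  "cscale c x = (\<lambda>v. c * x v)"

interpretation cfun: vector_space "cscale :: complex \<Rightarrow> ('v \<Rightarrow> complex) \<Rightarrow> 'v \<Rightarrow> complex"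
  by unfold_locales (auto simp: cscale_def algebra_simps)

definition coord_space :: "'v set \<Rightarrow> ('v \<Rightarrow> complex) set" where
  "coord_space V = {x. \<forall>v. v \<notin> V \<longrightarrow> x v = 0}"


section \<open>Polynomial rings and homogeneous coordinate rings\<close>

text \<open>A monomial is a finitely supported exponent function, a polynomial a finitely supported
  function from monomials to coefficients; the product is convolution.\<close>

type_synonym 'v mpoly = "('v \<Rightarrow>\<^sub>0 nat) \<Rightarrow>\<^sub>0 complex"

definition mp_const :: "complex \<Rightarrow> 'v mpoly" where
  "mp_const c = Poly_Mapping.single 0 c"

definition mp_var :: "'v \<Rightarrow> 'v mpoly" where
  "mp_var v = Poly_Mapping.single (Poly_Mapping.single v 1) 1"

definition mp_eval :: "('v \<Rightarrow> complex) \<Rightarrow> 'v mpoly \<Rightarrow> complex" where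
  "mp_eval x f = (\<Sum>m\<in>Poly_Mapping.keys f. Poly_Mapping.lookup f m *
     (\<Prod>v\<in>Poly_Mapping.keys m. x v ^ Poly_Mapping.lookup m v))"

definition mp_homogeneous :: "nat \<Rightarrow> 'v mpoly \<Rightarrow> bool" where
  "mp_homogeneous k f \<longleftrightarrow> (\<forall>m\<in>Poly_Mapping.keys f.
     (\<Sum>v\<in>Poly_Mapping.keys m. Poly_Mapping.lookup m v) = k)"

definition poly_ring :: "'v set \<Rightarrow> 'v mpoly ring" where
  "poly_ring V = \<lparr>carrier = {f. \<forall>m\<in>Poly_Mapping.keys f. Poly_Mapping.keys m \<subseteq> V},
     mult = (*), one = 1, zero = 0, add = (+)\<rparr>"

lemma cring_poly_ring: "cring (poly_ring V)"
proof -
  have mult: "f * g \<in> carrier (poly_ring V)"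
    if "f \<in> carrier (poly_ring V)" "g \<in> carrier (poly_ring V)" for f g :: "'a mpoly"
  proof -
    have "Poly_Mapping.keys m \<subseteq> V" if m: "m \<in> Poly_Mapping.keys (f * g)" for m
    proof -
      obtain a b where ab: "m = a + b" "a \<in> Poly_Mapping.keys f" "b \<in> Poly_Mapping.keys g"
        using keys_mult[of f g] m by blast
      then have "Poly_Mapping.keys a \<subseteq> V" "Poly_Mapping.keys b \<subseteq> V"
        using \<open>f \<in> _\<close> \<open>g \<in> _\<close> by (auto simp: poly_ring_def)
      then show ?thesis using Poly_Mapping.keys_add[of a b] ab(1) by blast
    qed
    then show ?thesis by (simp add: poly_ring_def)
  qed
  have add: "f + g \<in> carrier (poly_ring V)"
    if "f \<in> carrier (poly_ring V)" "g \<in> carrier (poly_ring V)" for f g :: "'a mpoly"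
    using that Poly_Mapping.keys_add[of f g] unfolding poly_ring_def by auto
  have sel: "x \<otimes>\<^bsub>poly_ring V\<^esub> y = x * y" "x \<oplus>\<^bsub>poly_ring V\<^esub> y = x + y"
    "\<one>\<^bsub>poly_ring V\<^esub> = 1" "\<zero>\<^bsub>poly_ring V\<^esub> = 0" for x y :: "'a mpoly"
    by (simp_all add: poly_ring_def)
  have unit: "0 \<in> carrier (poly_ring V)" "1 \<in> carrier (poly_ring V)"
    by (simp_all add: poly_ring_def)
  have neg: "- f \<in> carrier (poly_ring V)" if "f \<in> carrier (poly_ring V)" for f :: "'a mpoly"
    using that unfolding poly_ring_def by auto
  show ?thesis
  proof (rule cringI)
    show "abelian_group (poly_ring V)"
    proof (rule abelian_groupI)
      fix f assume "f \<in> carrier (poly_ring V)"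
      then show "\<exists>g\<in>carrier (poly_ring V). g \<oplus>\<^bsub>poly_ring V\<^esub> f = \<zero>\<^bsub>poly_ring V\<^esub>"
        using neg by (intro bexI[of _ "- f"]) (auto simp: sel)
    qed (simp_all add: sel add unit add.assoc add.commute)
    show "comm_monoid (poly_ring V)"
      by (rule comm_monoidI) (simp_all add: sel mult unit mult.assoc mult.commute)
  qed (simp add: sel distrib_right)
qed

text \<open>
  A subset \<open>X\<close> of the projective space of \<open>coord_space V\<close> is given as a set of lines through
  the origin.  Its homogeneous ideal is generated by the homogeneous polynomials vanishing on
  every line in \<open>X\<close>.
\<close>

definition vanishing_ideal :: "'v set \<Rightarrow> ('v \<Rightarrow> complex) set set \<Rightarrow> 'v mpoly set" where
  "vanishing_ideal V X = genideal (poly_ring V)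
     {f \<in> carrier (poly_ring V). (\<exists>k. mp_homogeneous k f) \<and> (\<forall>l\<in>X. \<forall>x\<in>l. mp_eval x f = 0)}"

definition hom_class :: "'v set \<Rightarrow> ('v \<Rightarrow> complex) set set \<Rightarrow> 'v mpoly \<Rightarrow> 'v mpoly set" where
  "hom_class V X f = vanishing_ideal V X +>\<^bsub>poly_ring V\<^esub> f"

text \<open>The quotient ring, made into a \<open>\<complex>\<close>-algebra: a scalar acts as the class of the constant.\<close>

definition hom_coord_ring ::
  "'v set \<Rightarrow> ('v \<Rightarrow> complex) set set \<Rightarrow> (complex, 'v mpoly set) module" where
  "hom_coord_ring V X = (let Q = poly_ring V Quot vanishing_ideal V X in
     \<lparr>carrier = carrier Q, mult = mult Q, one = one Q, zero = zero Q, add = add Q,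
      smult = (\<lambda>c F. hom_class V X (mp_const c) \<otimes>\<^bsub>Q\<^esub> F)\<rparr>)"

definition hom_coord_grade ::
  "'v set \<Rightarrow> ('v \<Rightarrow> complex) set set \<Rightarrow> nat \<Rightarrow> 'v mpoly set set" where
  "hom_coord_grade V X i =
     hom_class V X ` {f \<in> carrier (poly_ring V). mp_homogeneous i f}"


section \<open>Rings governed by a lattice\<close>

text \<open>
  A finite bounded distributive lattice is a finite nonempty subset, closed under \<open>inf\<close> and
  \<open>sup\<close>, of a type of class \<open>distrib_lattice\<close>; boundedness is automatic.  Join-irreducibility is
  relative to \<open>L\<close>, and the minimum of \<open>L\<close> is join-irreducible.
\<close>

definition finite_dist_lattice :: "'l::distrib_lattice set \<Rightarrow> bool" where
  "finite_dist_lattice L \<longleftrightarrow> finite L \<and> L \<noteq> {} \<and> (\<forall>a\<in>L. \<forall>b\<in>L. inf a b \<in> L \<and> sup a b \<in> L)"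

definition join_irreducible :: "'l::distrib_lattice set \<Rightarrow> 'l \<Rightarrow> bool" where
  "join_irreducible L m \<longleftrightarrow> m \<in> L \<and> (\<forall>a\<in>L. \<forall>b\<in>L. m = sup a b \<longrightarrow> m = a \<or> m = b)"

definition Spec :: "'l::distrib_lattice set \<Rightarrow> 'l \<Rightarrow> 'l set" where
  "Spec L l = {m. join_irreducible L m \<and> m \<le> l}"

definition maxSpec :: "'l::distrib_lattice set \<Rightarrow> 'l \<Rightarrow> 'l set" where
  "maxSpec L l = {m \<in> Spec L l. \<not> (\<exists>m'\<in>Spec L l. m < m')}"

definition multichains :: "'l::distrib_lattice set \<Rightarrow> 'l list set" where
  "multichains L = {ks. set ks \<subseteq> L \<and> sorted_wrt (\<ge>) ks}"

definition monomial_of :: "('a, 'r, 'm) module_scheme \<Rightarrow> ('l \<Rightarrow> 'r) \<Rightarrow> 'l list \<Rightarrow> 'r" where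
  "monomial_of R \<psi> ks = foldr (\<lambda>k r. \<psi> k \<otimes>\<^bsub>R\<^esub> r) ks \<one>\<^bsub>R\<^esub>"

text \<open>Bases are indexed families, so that standard monomials of distinct multichains are
  distinct elements and coefficients with respect to them are well defined.\<close>

definition basis_family ::
  "(complex, 'r, 'm) module_scheme \<Rightarrow> 'j set \<Rightarrow> ('j \<Rightarrow> 'r) \<Rightarrow> bool" where
  "basis_family R J b \<longleftrightarrow> b ` J \<subseteq> carrier R \<and>
     (\<forall>f\<in>carrier R. \<exists>!a. finite {j. a j \<noteq> 0} \<and> {j. a j \<noteq> 0} \<subseteq> J \<and>
        f = (\<Oplus>\<^bsub>R\<^esub>j\<in>{j. a j \<noteq> 0}. a j \<odot>\<^bsub>R\<^esub> b j))"

definition straightening_cond ::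
  "'l::distrib_lattice set \<Rightarrow> 'l \<Rightarrow> 'l \<Rightarrow> 'l \<Rightarrow> 'l \<Rightarrow> bool" where
  "straightening_cond L k1 k2 m1 m2 \<longleftrightarrow>
    (let i = (\<exists>h\<in>maxSpec L k1. h > m1);
         ii = (\<not> i \<and> (\<exists>h\<in>maxSpec L k1. \<exists>h'\<in>maxSpec L k1. h \<noteq> h' \<and> h = m1 \<and> h' > m2));
         iii = (\<not> i \<and> \<not> ii \<and> (\<exists>h\<in>maxSpec L k1. \<exists>h'\<in>maxSpec L k2. h = m1 \<and> h' \<ge> m2))
     in i \<or> ii \<or> iii)"

text \<open>
  Here \<open>G i\<close> is the homogeneous component of \<open>R\<close> of degree \<open>i\<close>.  The expression of the product
  of two incomparable generators in standard monomials of degree two is unique by the basis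
  property; its existence is asserted explicitly.
\<close>

definition governed ::
  "(complex, 'r, 'm) module_scheme \<Rightarrow> (nat \<Rightarrow> 'r set) \<Rightarrow> 'l::distrib_lattice set \<Rightarrow>
   ('l \<Rightarrow> 'r) \<Rightarrow> bool" where
  "governed R G L \<psi> \<longleftrightarrow>
     finite_dist_lattice L \<and> inj_on \<psi> L \<and> \<psi> ` L \<subseteq> G 1 \<and>
     basis_family R (multichains L) (monomial_of R \<psi>) \<and>
     (\<forall>l1\<in>L. \<forall>l2\<in>L. \<not> l1 \<le> l2 \<and> \<not> l2 \<le> l1 \<longrightarrow>
        (\<exists>a. \<psi> l1 \<otimes>\<^bsub>R\<^esub> \<psi> l2 =
               (\<Oplus>\<^bsub>R\<^esub>k\<in>{(k1, k2). k1 \<in> L \<and> k2 \<in> L \<and> k1 \<ge> k2}.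
                  a k \<odot>\<^bsub>R\<^esub> monomial_of R \<psi> [fst k, snd k]) \<and>
             a (sup l1 l2, inf l1 l2) = 1 \<and>
             (\<forall>k1\<in>L. \<forall>k2\<in>L. k1 \<ge> k2 \<and> a (k1, k2) \<noteq> 0 \<and>
                (k1, k2) \<noteq> (sup l1 l2, inf l1 l2) \<longrightarrow>
                (\<forall>m1\<in>maxSpec L (sup l1 l2). \<forall>m2\<in>maxSpec L (inf l1 l2).
                   m1 \<ge> m2 \<longrightarrow> straightening_cond L k1 k2 m1 m2))))"


section \<open>The Grassmann variety in its Pluecker embedding\<close>

text \<open>
  The tuple with entries \<open>i 1 < \<dots> < i d\<close> is encoded as a function on \<open>nat\<close> that is \<open>0\<close> outside
  \<open>{1..d}\<close>.  The pointwise order, \<open>inf\<close> and \<open>sup\<close> of functions are then componentwise comparison,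
  minimum and maximum.
\<close>

definition index_tuples :: "nat \<Rightarrow> nat \<Rightarrow> (nat \<Rightarrow> nat) set" where
  "index_tuples d n = {i. strict_mono_on {1..d} i \<and> i ` {1..d} \<subseteq> {1..n} \<and>
     (\<forall>k. k \<notin> {1..d} \<longrightarrow> i k = 0)}"

text \<open>
  The \<open>d\<close>-th exterior power of \<open>coord_space {1..n}\<close> is \<open>coord_space (index_tuples d n)\<close>, through
  the basis of the wedge products of standard basis vectors; the coordinate at \<open>i\<close> of the wedge
  product of vectors \<open>w 1, \<dots>, w d\<close> is the minor on the columns \<open>i 1, \<dots>, i d\<close>, given here by the
  Leibniz formula.
\<close>

definition wedge :: "nat \<Rightarrow> nat \<Rightarrow> (nat \<Rightarrow> nat \<Rightarrow> complex) \<Rightarrow> (nat \<Rightarrow> nat) \<Rightarrow> complex" where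
  "wedge d n w i = (if i \<in> index_tuples d n
     then \<Sum>p | p permutes {1..d}. of_int (sign p) * (\<Prod>k=1..d. w k (i (p k))) else 0)"

lemma wedge_standard_basis:
  assumes i: "i \<in> index_tuples d n"
  shows "wedge d n (\<lambda>k v. if v = i k then 1 else 0) = (\<lambda>j. if j = i then 1 else 0)"
proof
  fix j
  let ?w = "\<lambda>k v. if v = i k then 1 else (0::complex)"
  show "wedge d n ?w j = (if j = i then 1 else 0)"
  proof (cases "j \<in> index_tuples d n")
    case False
    then show ?thesis using i by (auto simp: wedge_def)
  next
    case j: True
    have id: "p = id \<and> j = i"
      if p: "p permutes {1..d}" and eq: "\<forall>k\<in>{1..d}. j (p k) = i k" for p
    proof -
      have sm: "strict_mono_on {1..d} i" "strict_mono_on {1..d} j"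
        using i j by (auto simp: index_tuples_def)
      have pin: "p k \<in> {1..d}" if "k \<in> {1..d}" for k
        using permutes_in_image[OF p] that by auto
      have mono: "p k < p l" if "k \<in> {1..d}" "l \<in> {1..d}" "k < l" for k l
      proof (rule ccontr)
        assume "\<not> p k < p l"
        then have "p l \<le> p k" by simp
        then have "j (p l) \<le> j (p k)"
          using sm(2) pin that strict_mono_on_leD by blast
        moreover have "i k < i l" using strict_mono_onD[OF sm(1) that] .
        ultimately show False using eq that by auto
      qed
      have ge: "k \<le> p k" if "k \<in> {1..d}" for k
        using that
      proof (induction k)
        case (Suc k)
        show ?case
        proof (cases "k = 0")
          case True
          then show ?thesis using pin[OF Suc.prems] by simp
        next
          case False
          then have "k \<le> p k" "p k < p (Suc k)" using Suc mono by auto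
          then show ?thesis by simp
        qed
      qed simp
      have le: "p k \<le> k" if "k \<in> {1..d}" for k
      proof -
        have "p (d - m) \<le> d - m" if "d - m \<in> {1..d}" for m
          using that
        proof (induction m)
          case 0
          then show ?case using pin by auto
        next
          case (Suc m)
          then have "p (d - m) \<le> d - m" "p (d - Suc m) < p (d - m)" using mono by auto
          then show ?case by simp
        qed
        from this[of "d - k"] that show ?thesis by simp
      qed
      have "p k = k" for k
        using ge[of k] le[of k] permutes_not_in[OF p, of k] by (cases "k \<in> {1..d}") auto
      then have "p = id" by auto
      moreover have "j k = i k" for k
        using eq \<open>p = id\<close> i j by (cases "k \<in> {1..d}") (auto simp: index_tuples_def)
      ultimately show ?thesis by auto
    qed
    have prod: "(\<Prod>k=1..d. ?w k (j (p k))) = (if p = id \<and> j = i then 1 else 0)"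
      if p: "p permutes {1..d}" for p
    proof (cases "\<forall>k\<in>{1..d}. j (p k) = i k")
      case True
      then show ?thesis using id[OF p] by simp
    next
      case False
      then show ?thesis by (auto intro!: prod_zero)
    qed
    have "wedge d n ?w j =
        (\<Sum>p | p permutes {1..d}. if p = id then (if j = i then 1 else 0) else 0)"
      unfolding wedge_def if_P[OF j]
    proof (rule sum.cong)
      fix p assume "p \<in> {p. p permutes {1..d}}"
      then have "(\<Prod>k=1..d. ?w k (j (p k))) = (if p = id \<and> j = i then 1 else 0)"
        by (intro prod) simp
      then show "of_int (sign p) * (\<Prod>k=1..d. ?w k (j (p k))) =
          (if p = id then (if j = i then 1 else 0) else 0)"
        by (simp only:) simp
    qed simp
    then show ?thesis by (simp add: finite_permutations permutes_id)
  qed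
qed

text \<open>The Pluecker embedding sends the span of a basis \<open>w 1, \<dots>, w d\<close> to the line of
  \<open>w 1 \<and> \<dots> \<and> w d\<close>, that is, it sends \<open>W\<close> to the \<open>d\<close>-th exterior power of \<open>W\<close>.\<close>

definition pluecker_embedding ::
  "nat \<Rightarrow> nat \<Rightarrow> (nat \<Rightarrow> complex) set \<Rightarrow> ((nat \<Rightarrow> nat) \<Rightarrow> complex) set" where
  "pluecker_embedding d n W = cfun.span {wedge d n w | w. \<forall>k\<in>{1..d}. w k \<in> W}"

definition grassmannian :: "nat \<Rightarrow> nat \<Rightarrow> ((nat \<Rightarrow> nat) \<Rightarrow> complex) set set" where
  "grassmannian d n = pluecker_embedding d n `
     {W. cfun.subspace W \<and> W \<subseteq> coord_space {1..n} \<and> cfun.dim W = d}"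

definition grassmann_ring :: "nat \<Rightarrow> nat \<Rightarrow> (complex, (nat \<Rightarrow> nat) mpoly set) module" where
  "grassmann_ring d n = hom_coord_ring (index_tuples d n) (grassmannian d n)"

definition grassmann_grade :: "nat \<Rightarrow> nat \<Rightarrow> nat \<Rightarrow> (nat \<Rightarrow> nat) mpoly set set" where
  "grassmann_grade d n = hom_coord_grade (index_tuples d n) (grassmannian d n)"

text \<open>The class of the variable with index \<open>i\<close>, whose value at a vector of the exterior power is
  its coordinate at \<open>i\<close>.\<close>

definition pluecker_coord :: "nat \<Rightarrow> nat \<Rightarrow> (nat \<Rightarrow> nat) \<Rightarrow> (nat \<Rightarrow> nat) mpoly set" where
  "pluecker_coord d n i = hom_class (index_tuples d n) (grassmannian d n) (mp_var i)"

end

theory Submission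
  imports Defs "HOL-Library.Multiset" "HOL-Computational_Algebra.Polynomial"
begin

text \<open>
  Polynomials on the cone are compared through their values at the vectors of all \<open>d\<close>-by-\<open>d\<close> minors
  of matrices \<open>w\<close>: the cone consists exactly of these vectors.  A product of two minors whose
  column tuples violate \<open>b \<le> a\<close> at position \<open>q\<close> is rewritten by antisymmetrizing over the \<open>d + 1\<close>
  columns \<open>a 1, \<dots>, a q, b q, \<dots>, b d\<close>; every other term has a strictly larger first tuple and the
  same multiset of columns, so standard monomials span.  They are independent because, at a
  suitable one-parameter family of matrices, their leading exponents are distinct; comparing
  leading exponents also shows that the pair of join and meet has coefficient one.

  For the condition on the remaining pairs \<open>(k1, k2)\<close> only two facts are needed: \<open>k1\<close> dominates the
  join \<open>J\<close>, and the columns are those of \<open>J\<close> and the meet \<open>M\<close>.  If \<open>m2\<close>, with jump at \<open>p2\<close>,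
  is not below \<open>k2\<close>, then counting entries below \<open>M p2\<close> yields a position \<open>q < p2\<close> with
  \<open>J q < M p2 \<le> k1 q\<close>, and a join-irreducible of \<open>k1\<close> above the corner at \<open>q\<close> gives alternative (i)
  or (ii).
\<close>

section \<open>The lattice of index tuples\<close>

text \<open>The exchange relations never have to be shown to generate the ideal. For
  \<open>1 <= d <= n\<close> a homogeneous polynomial lies in it exactly when it vanishes at all
  wedge products, so every relation is verified as an identity between functions of the matrix
  \<open>w\<close>. The obstacle is the asymmetry of straightening: an exchange controls only the
  first factor, so expanding the pair \<open>l1, l2\<close> bounds \<open>k1\<close> below by
  \<open>l1\<close>, not by the join. Dominance of the join comes from expanding in both orders and
  using independence. A lower bound on \<open>k1\<close> still says nothing about \<open>k2\<close>;
  that is why the multiset of columns is carried along. Only the support of an expansion is tracked,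
  since the one coefficient that matters is read off from leading exponents. One may therefore sum
  over all permutations of the \<open>d + 1\<close> columns instead of coset representatives, and
  divide by the number of repeated terms, which is harmless over the complex numbers. For
  independence, a single variable with exponents that are powers of \<open>B\<close> replaces a
  monomial order on the matrix entries.\<close>

lemma index_tuples_range:
  assumes "a \<in> index_tuples d n" "k \<in> {1..d}"
  shows "1 \<le> a k \<and> a k \<le> n"
proof -
  have "a k \<in> {1..n}" using assms unfolding index_tuples_def by blast
  then show ?thesis by simp
qed

lemma index_tuples_outside: "a \<in> index_tuples d n \<Longrightarrow> k \<notin> {1..d} \<Longrightarrow> a k = 0"
  by (auto simp: index_tuples_def)

lemma index_tuples_less:
  "a \<in> index_tuples d n \<Longrightarrow> j \<in> {1..d} \<Longrightarrow> k \<in> {1..d} \<Longrightarrow> j < k \<Longrightarrow> a j < a k"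
  by (auto simp: index_tuples_def strict_mono_on_def)

lemma index_tuplesI:
  assumes "\<And>j k. 1 \<le> j \<Longrightarrow> j < k \<Longrightarrow> k \<le> d \<Longrightarrow> a j < a k"
    and "\<And>k. 1 \<le> k \<Longrightarrow> k \<le> d \<Longrightarrow> 1 \<le> a k \<and> a k \<le> n" and "\<And>k. k \<notin> {1..d} \<Longrightarrow> a k = 0"
  shows "a \<in> index_tuples d n"
  using assms by (auto simp: index_tuples_def strict_mono_on_def)

lemma index_tuples_gap:
  assumes a: "a \<in> index_tuples d n" and "1 \<le> j" "j \<le> k" "k \<le> d"
  shows "a j + (k - j) \<le> a k"
  using assms(3,4)
proof (induction k rule: dec_induct)
  case (step k)
  have "a k < a (Suc k)" using index_tuples_less[OF a] step assms(2) by auto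
  then show ?case using step by auto
qed simp

lemma index_tuples_ge: 
  assumes a: "a \<in> index_tuples d n" and "1 \<le> k" "k \<le> d"
  shows "k \<le> a k"
  using index_tuples_gap[OF a, of 1 k] index_tuples_range[OF a, of 1] assms by auto

lemma index_tuples_le_iff:
  assumes "a \<in> index_tuples d n"
  shows "a \<le> b \<longleftrightarrow> (\<forall>k\<in>{1..d}. a k \<le> b k)"
  using index_tuples_outside[OF assms] by (fastforce simp: le_fun_def)

lemma index_tuples_eqI:
  "a \<in> index_tuples d n \<Longrightarrow> b \<in> index_tuples d n \<Longrightarrow> (\<And>k. k \<in> {1..d} \<Longrightarrow> a k = b k) \<Longrightarrow> a = b"
  by (rule ext) (metis index_tuples_outside)

lemma finite_index_tuples: "finite (index_tuples d n)"
proof (rule finite_subset)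
  show "index_tuples d n \<subseteq> {f. \<forall>x. (x \<in> {1..d} \<longrightarrow> f x \<in> {0..n}) \<and> (x \<notin> {1..d} \<longrightarrow> f x = 0)}"
    using index_tuples_range index_tuples_outside by fastforce
  show "finite {f::nat\<Rightarrow>nat. \<forall>x. (x \<in> {1..d} \<longrightarrow> f x \<in> {0..n}) \<and> (x \<notin> {1..d} \<longrightarrow> f x = 0)}"
    by (rule finite_set_of_finite_funs) auto
qed

lemma inf_in_index_tuples:
  assumes a: "a \<in> index_tuples d n" and b: "b \<in> index_tuples d n"
  shows "inf a b \<in> index_tuples d n"
proof (rule index_tuplesI)
  fix j k assume "1 \<le> j" "j < k" "k \<le> d"
  then have "a j < a k" "b j < b k"
    using index_tuples_less[OF a, of j k] index_tuples_less[OF b, of j k] by auto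
  then show "inf a b j < inf a b k" by (auto simp: inf_nat_def)
qed (use index_tuples_range[OF a] index_tuples_range[OF b] index_tuples_outside[OF a]
      index_tuples_outside[OF b] in \<open>auto simp: inf_nat_def min_le_iff_disj\<close>)

lemma sup_in_index_tuples:
  assumes a: "a \<in> index_tuples d n" and b: "b \<in> index_tuples d n"
  shows "sup a b \<in> index_tuples d n"
proof (rule index_tuplesI)
  fix j k assume "1 \<le> j" "j < k" "k \<le> d"
  then have "a j < a k" "b j < b k"
    using index_tuples_less[OF a, of j k] index_tuples_less[OF b, of j k] by auto
  then show "sup a b j < sup a b k" by (auto simp: sup_nat_def)
qed (use index_tuples_range[OF a] index_tuples_range[OF b] index_tuples_outside[OF a]
      index_tuples_outside[OF b] in \<open>auto simp: sup_nat_def le_max_iff_disj\<close>)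

lemma finite_dist_lattice_index_tuples:
  assumes "d \<le> n"
  shows "finite_dist_lattice (index_tuples d n)"
proof -
  \<comment> \<open>The least tuple \<open>1, ..., d\<close> shows that the lattice is nonempty; it
    fits into \<open>{1..n}\<close> because \<open>d <= n\<close>.\<close>
  have "(\<lambda>k. if k \<in> {1..d} then k else 0) \<in> index_tuples d n"
    using assms by (intro index_tuplesI) auto
  then show ?thesis
    using finite_index_tuples inf_in_index_tuples sup_in_index_tuples
    unfolding finite_dist_lattice_def by blast
qed

section \<open>Join-irreducible index tuples\<close>

text \<open>The smallest index tuple whose entry in position \<open>p\<close> is at least \<open>v\<close>.  These are exactly
  the join-irreducible tuples.\<close>

definition corner_tuple :: "nat \<Rightarrow> nat \<Rightarrow> nat \<Rightarrow> nat \<Rightarrow> nat" where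
  "corner_tuple d p v = (\<lambda>k. if k \<in> {1..d} then (if k < p then k else v + (k - p)) else 0)"

text \<open>A value \<open>v\<close> at position \<open>p\<close> can be completed to a tuple only
  if \<open>p <= v\<close> and \<open>v + (d - p) <= n\<close>. Taking \<open>v\<close> to be an
  entry of an actual tuple at position \<open>p\<close> secures both bounds.\<close>

lemma corner_tuple_in:
  assumes a: "a \<in> index_tuples d n" and p: "p \<in> {1..d}"
  shows "corner_tuple d p (a p) \<in> index_tuples d n"
proof (rule index_tuplesI)
  have pa: "p \<le> a p" using index_tuples_ge[OF a] p by auto
  fix j k :: nat assume "1 \<le> j" "j < k" "k \<le> d"
  then show "corner_tuple d p (a p) j < corner_tuple d p (a p) k"
    using pa by (auto simp: corner_tuple_def)
next
  fix k assume k: "1 \<le> k" "k \<le> d"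
  show "1 \<le> corner_tuple d p (a p) k \<and> corner_tuple d p (a p) k \<le> n"
    using index_tuples_gap[OF a, of p k] k p index_tuples_range[OF a, of k]
      index_tuples_range[OF a, of p] index_tuples_ge[OF a, of k]
    by (auto simp: corner_tuple_def)
qed (auto simp: corner_tuple_def)

lemma corner_tuple_at: "p \<in> {1..d} \<Longrightarrow> corner_tuple d p v p = v"
  by (simp add: corner_tuple_def)

text \<open>One inequality decides the whole comparison: before \<open>p\<close> the corner has the
  least possible entries, and after \<open>p\<close> it grows by one per step, as slowly as any
  strictly increasing sequence can.\<close>

lemma corner_tuple_le_iff:
  assumes a: "a \<in> index_tuples d n" and p: "p \<in> {1..d}"
  shows "corner_tuple d p v \<le> a \<longleftrightarrow> v \<le> a p"
proof
  assume "corner_tuple d p v \<le> a"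
  then have "corner_tuple d p v p \<le> a p" by (rule le_funD)
  then show "v \<le> a p" by (simp only: corner_tuple_at[OF p])
next
  assume v: "v \<le> a p"
  show "corner_tuple d p v \<le> a"
  proof (rule le_funI)
    fix k
    show "corner_tuple d p v k \<le> a k"
      using index_tuples_ge[OF a, of k] index_tuples_gap[OF a, of p k] v p
      by (auto simp: corner_tuple_def)
  qed
qed

text \<open>Corners are even join-prime: lying below a join is a condition on the single entry at
  \<open>p\<close>, and a maximum of two numbers reaches a bound only if one of them does.\<close>

lemma join_irreducible_corner:
  assumes a: "a \<in> index_tuples d n" and p: "p \<in> {1..d}"
  shows "join_irreducible (index_tuples d n) (corner_tuple d p (a p))"
  unfolding join_irreducible_def
proof (intro conjI ballI impI)
  show "corner_tuple d p (a p) \<in> index_tuples d n" by (rule corner_tuple_in[OF assms])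
  fix x y assume x: "x \<in> index_tuples d n" and y: "y \<in> index_tuples d n"
    and eq: "corner_tuple d p (a p) = sup x y"
  have "a p = sup x y p" using corner_tuple_at[OF p, of "a p"] eq by simp
  then have "a p \<le> x p \<or> a p \<le> y p" by (auto simp: sup_nat_def max_def split: if_splits)
  then have "sup x y \<le> x \<or> sup x y \<le> y"
    using corner_tuple_le_iff[OF x p] corner_tuple_le_iff[OF y p] eq by metis
  then show "corner_tuple d p (a p) = x \<or> corner_tuple d p (a p) = y"
    unfolding eq by (metis sup.cobounded1 sup.cobounded2 antisym)
qed

text \<open>Extends irreducibility from binary to finite nonempty joins. Membership of the join in
  \<open>L\<close> is proved in the same induction, because the binary condition quantifies over
  \<open>L\<close> only.\<close>

lemma join_irreducible_Sup_fin:
  assumes m: "join_irreducible L m" and L: "finite_dist_lattice L"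
    and S: "finite S" "S \<noteq> {}" "S \<subseteq> L"
  shows "Sup_fin S \<in> L \<and> (m = Sup_fin S \<longrightarrow> m \<in> S)"
  using S
proof (induction S rule: finite_ne_induct)
  case (insert x F)
  then have F: "Sup_fin F \<in> L" "m = Sup_fin F \<longrightarrow> m \<in> F" and x: "x \<in> L" by auto
  have eq: "Sup_fin (insert x F) = sup x (Sup_fin F)" using insert by simp
  have "sup x (Sup_fin F) \<in> L" using F x L by (simp add: finite_dist_lattice_def)
  moreover have "m = sup x (Sup_fin F) \<longrightarrow> m = x \<or> m = Sup_fin F"
    using m F x by (simp only: join_irreducible_def) blast
  ultimately show ?case using F eq by auto
qed simp

text \<open>Every tuple is the join of the \<open>d\<close> corners cut out by its own entries, so
  an irreducible tuple must be one of them.\<close>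

lemma join_irreducible_imp_corner:
  assumes m: "join_irreducible (index_tuples d n) m" and d: "1 \<le> d" "d \<le> n"
  obtains p where "p \<in> {1..d}" "m = corner_tuple d p (m p)"
proof -
  let ?S = "(\<lambda>p. corner_tuple d p (m p)) ` {1..d}"
  have mL: "m \<in> index_tuples d n" using m by (simp add: join_irreducible_def)
  have "m \<le> Sup_fin ?S"
  proof (subst index_tuples_le_iff[OF mL], intro ballI)
    fix k assume k: "k \<in> {1..d}"
    then have "corner_tuple d k (m k) \<le> Sup_fin ?S" by (intro Sup_fin.coboundedI) auto
    then have "corner_tuple d k (m k) k \<le> Sup_fin ?S k" by (rule le_funD)
    then show "m k \<le> Sup_fin ?S k" using corner_tuple_at[OF k] by simp
  qed
  moreover have "Sup_fin ?S \<le> m"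
    using d corner_tuple_le_iff[OF mL] by (intro Sup_fin.boundedI) auto
  ultimately have "m = Sup_fin ?S" by (rule antisym)
  moreover have "?S \<subseteq> index_tuples d n" using corner_tuple_in[OF mL] by auto
  ultimately have "m \<in> ?S"
    using join_irreducible_Sup_fin[OF m finite_dist_lattice_index_tuples[OF d(2)], of ?S] d by auto
  then show ?thesis using that by auto
qed

text \<open>A corner of height \<open>m p\<close> can be raised to height \<open>l p\<close> without
  leaving the elements below \<open>l\<close>; maximality leaves no room for this, so the height is
  already \<open>l p\<close>.\<close>

lemma maxSpec_corner:
  assumes m: "m \<in> maxSpec (index_tuples d n) l" and l: "l \<in> index_tuples d n"
    and d: "1 \<le> d" "d \<le> n"
  obtains p where "p \<in> {1..d}" "m = corner_tuple d p (l p)"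
proof -
  have ji: "join_irreducible (index_tuples d n) m" and ml: "m \<le> l"
    using m by (auto simp: maxSpec_def Spec_def)
  obtain p where p: "p \<in> {1..d}" "m = corner_tuple d p (m p)"
    using join_irreducible_imp_corner[OF ji d] .
  have in_Spec: "corner_tuple d p (l p) \<in> Spec (index_tuples d n) l"
    using join_irreducible_corner[OF l p(1)] corner_tuple_le_iff[OF l p(1)]
    by (simp add: Spec_def)
  have "m \<le> corner_tuple d p (l p)"
    using corner_tuple_le_iff[OF corner_tuple_in[OF l p(1)] p(1)] corner_tuple_at[OF p(1)]
      le_funD[OF ml, of p] p(2) by metis
  then have "m = corner_tuple d p (l p)"
    using in_Spec m by (auto simp: maxSpec_def order_le_less)
  then show ?thesis using that p(1) by blast
qed

lemma Spec_le_maxSpec: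
  assumes "finite L" "h \<in> Spec L l"
  obtains h' where "h' \<in> maxSpec L l" "h \<le> h'"
proof -
  have "finite (Spec L l)"
    using assms(1) by (auto simp: Spec_def join_irreducible_def intro: finite_subset[of _ L])
  from finite_has_maximal2[OF this assms(2)]
  show ?thesis using that by (auto simp: maxSpec_def order_less_le)
qed

section \<open>Contents of pairs of tuples\<close>

text \<open>The multidegree of a product of two coordinates under rescaling of the columns. It is a
  sum of singletons so that the general rules for permuting and splitting sums apply to it
  directly.\<close>

definition pair_content :: "nat \<Rightarrow> (nat \<Rightarrow> nat) \<times> (nat \<Rightarrow> nat) \<Rightarrow> nat multiset" where
  "pair_content d x = (\<Sum>k=1..d. {#fst x k#}) + (\<Sum>k=1..d. {#snd x k#})"

lemma pair_content_sup_inf: "pair_content d (sup a b, inf a b) = pair_content d (a, b)"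
proof -
  have "{#sup a b k#} + {#inf a b k#} = {#a k#} + {#b k#}" for k
    by (simp add: sup_nat_def inf_nat_def max_def min_def)
  then show ?thesis by (simp add: pair_content_def del: sup_apply inf_apply flip: sum.distrib)
qed

lemma size_filter_sum_singleton:
  assumes "finite A"
  shows "size (filter_mset P (\<Sum>k\<in>A. {#f k#})) = card {k\<in>A. P (f k)}"
  using assms
proof (induction A rule: finite_induct)
  case (insert x A)
  have "{k \<in> insert x A. P (f k)} = (if P (f x) then insert x {k\<in>A. P (f k)} else {k\<in>A. P (f k)})"
    by auto
  then show ?case using insert by simp
qed simp

text \<open>Entries increase, so those below \<open>v\<close> fill an initial segment of positions.
  This turns comparisons of entries into counts, which depend only on the multiset of
  columns.\<close>

lemma card_less_entry_le:
  assumes a: "a \<in> index_tuples d n" and p: "p \<in> {1..d}"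
  shows "card {k\<in>{1..d}. a k < v} \<ge> p \<longleftrightarrow> a p < v"
proof
  assume "a p < v"
  moreover have "a k \<le> a p" if "k \<in> {1..p}" for k
    using index_tuples_less[OF a, of k p] that p by (cases "k = p") auto
  ultimately have "{1..p} \<subseteq> {k\<in>{1..d}. a k < v}" using p by fastforce
  then show "card {k\<in>{1..d}. a k < v} \<ge> p" using card_mono[of "{k\<in>{1..d}. a k < v}" "{1..p}"] by simp
next
  assume c: "card {k\<in>{1..d}. a k < v} \<ge> p"
  show "a p < v"
  proof (rule ccontr)
    assume "\<not> a p < v"
    moreover have "a p \<le> a k" if "k \<in> {p..d}" for k
      using index_tuples_less[OF a, of p k] that p by (cases "k = p") auto
    ultimately have "{k\<in>{1..d}. a k < v} \<subseteq> {1..<p}" by (force simp: not_less)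
    then have "card {k\<in>{1..d}. a k < v} \<le> p - 1" using card_mono[of "{1..<p}"] by fastforce
    then show False using c p by auto
  qed
qed

text \<open>Each alternative includes the failure of the earlier ones. Refuting the whole
  disjunction therefore makes all three bare existence claims fail at once, which is why the
  argument is by contradiction.\<close>

lemma straightening_cond_of_content:
  assumes d: "1 \<le> d" "d \<le> n"
    and L: "J \<in> index_tuples d n" "M \<in> index_tuples d n" "k1 \<in> index_tuples d n" "k2 \<in> index_tuples d n"
    and Jk: "J \<le> k1" and cont: "pair_content d (k1, k2) = pair_content d (J, M)"
    and m1: "m1 \<in> maxSpec (index_tuples d n) J" and m2: "m2 \<in> maxSpec (index_tuples d n) M"
    and m12: "m2 \<le> m1"
  shows "straightening_cond (index_tuples d n) k1 k2 m1 m2"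
proof (rule ccontr)
  let ?L = "index_tuples d n"
  assume nsc: "\<not> straightening_cond ?L k1 k2 m1 m2"
  have fin: "finite ?L" by (rule finite_index_tuples)
  obtain p2 where p2: "p2 \<in> {1..d}" "m2 = corner_tuple d p2 (M p2)"
    using maxSpec_corner[OF m2 L(2) d] .
  have m1J: "m1 \<le> J" and ji1: "join_irreducible ?L m1" and ji2: "join_irreducible ?L m2"
    using m1 m2 by (auto simp: maxSpec_def Spec_def)
  have "m1 \<in> Spec ?L k1" using m1J Jk ji1 by (auto simp: Spec_def)
  then obtain h where h: "h \<in> maxSpec ?L k1" "m1 \<le> h" using Spec_le_maxSpec[OF fin] by blast
  have not_i: "\<not> (\<exists>h\<in>maxSpec ?L k1. h > m1)"
    using nsc by (auto simp: straightening_cond_def Let_def)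
  \<comment> \<open>Some maximal element of \<open>k1\<close> lies above \<open>m1\<close>; without
    alternative (i) it is \<open>m1\<close> itself, and this provides the equality
    \<open>h = m1\<close> asked for in (ii) and (iii).\<close>
  have m1_max: "m1 \<in> maxSpec ?L k1" using h not_i by (auto simp: order_le_less)
  have not_ii: "\<not> (h' \<in> maxSpec ?L k1 \<and> h' \<noteq> m1 \<and> h' > m2)" for h'
    using nsc m1_max by (auto simp: straightening_cond_def Let_def)
  have not_iii: "\<not> (h' \<in> maxSpec ?L k2 \<and> h' \<ge> m2)" for h'
    using nsc m1_max by (auto simp: straightening_cond_def Let_def)
  have k2_less: "k2 p2 < M p2"
  proof (rule ccontr)
    assume "\<not> k2 p2 < M p2"
    then have "m2 \<in> Spec ?L k2"
      using corner_tuple_le_iff[OF L(4) p2(1), of "M p2"] p2(2) ji2 by (simp add: Spec_def)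
    then show False using Spec_le_maxSpec[OF fin] not_iii by blast
  qed
  let ?c = "\<lambda>a. card {k\<in>{1..d}. a k < M p2}"
  \<comment> \<open>The total count is fixed by the content. As \<open>k2\<close> has more entries
    below \<open>M p2\<close> than \<open>M\<close> has, \<open>k1\<close> must have fewer than
    \<open>J\<close>.\<close>
  have "?c k1 + ?c k2 = ?c J + ?c M"
    using arg_cong[OF cont, of "\<lambda>X. size (filter_mset (\<lambda>v. v < M p2) X)"]
    by (simp only: pair_content_def fst_conv snd_conv filter_union_mset size_union
        size_filter_sum_singleton finite_atLeastAtMost)
  moreover have "?c k2 \<ge> p2" using card_less_entry_le[OF L(4) p2(1)] k2_less by simp
  moreover have "\<not> ?c M \<ge> p2" using card_less_entry_le[OF L(2) p2(1)] by simp
  ultimately have "\<not> ?c J \<le> ?c k1" by linarith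
  then have "\<not> {k\<in>{1..d}. J k < M p2} \<subseteq> {k\<in>{1..d}. k1 k < M p2}"
    using card_mono[of "{k\<in>{1..d}. k1 k < M p2}"] by fastforce
  then obtain q where "q \<in> {k\<in>{1..d}. J k < M p2}" "q \<notin> {k\<in>{1..d}. k1 k < M p2}"
    by blast
  then have q: "q \<in> {1..d}" "J q < M p2" "M p2 \<le> k1 q" by simp_all
  \<comment> \<open>The relation \<open>m2 <= m1\<close> enters here: it gives
    \<open>M p2 <= J p2\<close>, so an entry of \<open>J\<close> below \<open>M p2\<close> sits
    strictly before position \<open>p2\<close>.\<close>
  have m2J: "m2 \<le> J" using m12 m1J by simp
  have "M p2 \<le> J p2" using corner_tuple_le_iff[OF L(1) p2(1), of "M p2"] m2J p2(2) by simp
  then have qp: "q < p2"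
    using q index_tuples_gap[OF L(1), of p2 q] p2(1) by (cases "q < p2") auto
  let ?h = "corner_tuple d q (k1 q)"
  have "?h \<in> Spec ?L k1"
    using join_irreducible_corner[OF L(3) q(1)] corner_tuple_le_iff[OF L(3) q(1)] by (simp add: Spec_def)
  then obtain h' where h': "h' \<in> maxSpec ?L k1" "?h \<le> h'" using Spec_le_maxSpec[OF fin] by blast
  \<comment> \<open>The corner gains one per position between \<open>q\<close> and
    \<open>p2\<close>, which turns \<open>M p2 <= k1 q\<close> into a strict inequality at
    \<open>p2\<close>.\<close>
  have "M p2 < ?h p2" using q qp p2(1) by (auto simp: corner_tuple_def)
  then have less: "M p2 < h' p2" using le_funD[OF h'(2), of p2] by simp
  have "h' \<in> ?L" using h' by (auto simp: maxSpec_def Spec_def join_irreducible_def)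
  then have "m2 \<le> h'" using corner_tuple_le_iff[of h', OF _ p2(1), of n "M p2"] less p2(2) by simp
  moreover have "m2 \<noteq> h'" using less p2 corner_tuple_at[OF p2(1)] by (metis less_irrefl)
  ultimately have "m2 < h'" by simp
  \<comment> \<open>Without (ii) the element above the corner can only be \<open>m1\<close>. But
    \<open>m1 <= J\<close> would then give \<open>k1 q <= J q\<close>, against the choice of
    \<open>q\<close>.\<close>
  then have "h' = m1" using not_ii h' by blast
  then have "?h q \<le> J q" using h'(2) m1J le_funD order_trans by metis
  then show False using q corner_tuple_at[OF q(1)] by simp
qed

section \<open>Determinants and minors\<close>

text \<open>The index set is a parameter because determinants of size \<open>d\<close> and of size
  \<open>d + 1\<close> both occur. The permutation acts on the column index, as in
  \<open>wedge\<close>.\<close>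

definition ldet :: "'i set \<Rightarrow> ('i \<Rightarrow> 'i \<Rightarrow> complex) \<Rightarrow> complex" where
  "ldet S M = (\<Sum>p | p permutes S. of_int (sign p) * (\<Prod>k\<in>S. M k (p k)))"

lemma ldet_cong:
  assumes "\<And>i j. i \<in> S \<Longrightarrow> j \<in> S \<Longrightarrow> M i j = M' i j"
  shows "ldet S M = ldet S M'"
  unfolding ldet_def using assms
  by (intro sum.cong prod.cong arg_cong2[where f = "(*)"]) (auto simp: permutes_in_image)

lemma ldet_permute_columns:
  assumes S: "finite S" and \<sigma>: "\<sigma> permutes S"
  shows "ldet S (\<lambda>i j. M i (\<sigma> j)) = of_int (sign \<sigma>) * ldet S M"
proof -
  have "of_int (sign \<sigma>) * ldet S M =
      (\<Sum>p | p permutes S. of_int (sign \<sigma>) * (of_int (sign (\<sigma> \<circ> p)) * (\<Prod>k\<in>S. M k ((\<sigma> \<circ> p) k))))"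
    unfolding ldet_def sum_distrib_left by (rule setum_permutations_compose_left[OF \<sigma>])
  also have "\<dots> = ldet S (\<lambda>i j. M i (\<sigma> j))"
    unfolding ldet_def
  proof (rule sum.cong)
    fix p assume "p \<in> {p. p permutes S}"
    then have "sign (\<sigma> \<circ> p) = sign \<sigma> * sign p"
      using S \<sigma> by (intro sign_compose) (auto intro: permutes_imp_permutation)
    moreover have "of_int (sign \<sigma>) * (of_int (sign \<sigma> * sign p) * y) = of_int (sign p) * y" for y :: complex
      by (simp flip: mult.assoc of_int_mult)
    ultimately show "of_int (sign \<sigma>) * (of_int (sign (\<sigma> \<circ> p)) * (\<Prod>k\<in>S. M k ((\<sigma> \<circ> p) k))) =
        of_int (sign p) * (\<Prod>k\<in>S. M k (\<sigma> (p k)))" by simp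
  qed simp
  finally show ?thesis by simp
qed

lemma ldet_permute_rows:
  assumes S: "finite S" and \<sigma>: "\<sigma> permutes S"
  shows "ldet S (\<lambda>i. M (\<sigma> i)) = of_int (sign \<sigma>) * ldet S M"
proof -
  have "of_int (sign \<sigma>) * ldet S M =
      (\<Sum>p | p permutes S. of_int (sign \<sigma>) * (of_int (sign (p \<circ> inv_into UNIV \<sigma>)) * (\<Prod>k\<in>S. M k ((p \<circ> inv_into UNIV \<sigma>) k))))"
    unfolding ldet_def sum_distrib_left
    by (rule sum_permutations_compose_right[OF permutes_inv[OF \<sigma>]])
  also have "\<dots> = ldet S (\<lambda>i. M (\<sigma> i))"
    unfolding ldet_def
  proof (rule sum.cong)
    fix p assume "p \<in> {p. p permutes S}"
    then have "sign (p \<circ> inv_into UNIV \<sigma>) = sign p * sign \<sigma>"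
      using S \<sigma> permutes_imp_permutation[OF S \<sigma>] permutes_inv[OF \<sigma>]
      by (subst sign_compose) (auto intro: permutes_imp_permutation simp: sign_inverse)
    moreover have "of_int (sign \<sigma>) * (of_int (sign p * sign \<sigma>) * y) = of_int (sign p) * y" for y :: complex
      by (simp flip: mult.assoc of_int_mult add: mult.commute)
    moreover have "(\<Prod>k\<in>S. M k ((p \<circ> inv_into UNIV \<sigma>) k)) = (\<Prod>k\<in>S. M (\<sigma> k) (p k))"
      by (subst prod.permute[OF \<sigma>]) (simp add: o_def permutes_inverses[OF \<sigma>])
    ultimately show "of_int (sign \<sigma>) * (of_int (sign (p \<circ> inv_into UNIV \<sigma>)) * (\<Prod>k\<in>S. M k ((p \<circ> inv_into UNIV \<sigma>) k))) =
        of_int (sign p) * (\<Prod>k\<in>S. M (\<sigma> k) (p k))" by simp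
  qed simp
  finally show ?thesis by simp
qed

text \<open>Swapping the two rows fixes the matrix and negates the determinant.\<close>

lemma ldet_equal_rows:
  assumes S: "finite S" "i \<in> S" "j \<in> S" "i \<noteq> j" and eq: "\<And>k. k \<in> S \<Longrightarrow> M i k = M j k"
  shows "ldet S M = 0"
proof -
  have "ldet S (\<lambda>k. M (transpose i j k)) = ldet S M"
    using eq by (intro ldet_cong) (auto simp: transpose_def)
  then have "ldet S M = - ldet S M"
    using ldet_permute_rows[OF S(1) permutes_swap_id[OF S(2,3)], of M] S(4) by (simp add: sign_swap_id)
  then show ?thesis by simp
qed

lemma ldet_equal_columns:
  assumes S: "finite S" "i \<in> S" "j \<in> S" "i \<noteq> j" and eq: "\<And>k. k \<in> S \<Longrightarrow> M k i = M k j"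
  shows "ldet S M = 0"
proof -
  have "ldet S (\<lambda>k l. M k (transpose i j l)) = ldet S M"
    using eq by (intro ldet_cong) (auto simp: transpose_def)
  then have "ldet S M = - ldet S M"
    using ldet_permute_columns[OF S(1) permutes_swap_id[OF S(2,3)], of M] S(4) by (simp add: sign_swap_id)
  then show ?thesis by simp
qed

text \<open>Multiplicativity of the determinant without naming the factor. The order of quantifiers
  matters: one \<open>c\<close>, depending only on \<open>X\<close>, serves every \<open>N\<close>,
  hence all choices of columns at once. Expanding the rows, non-injective choices repeat a row and
  injective ones only permute rows.\<close>

lemma ldet_row_combination:
  assumes S: "finite S"
  shows "\<exists>c. \<forall>N. ldet S (\<lambda>i l. \<Sum>j\<in>S. X i j * N j l) = c * ldet S N"
proof -
  have expand: "ldet S (\<lambda>i l. \<Sum>j\<in>S. X i j * N j l) =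
      (\<Sum>f\<in>PiE S (\<lambda>_. S). (\<Prod>k\<in>S. X k (f k)) * ldet S (\<lambda>k. N (f k)))" for N
  proof -
    have "ldet S (\<lambda>i l. \<Sum>j\<in>S. X i j * N j l) =
        (\<Sum>p | p permutes S. of_int (sign p) * (\<Sum>f\<in>PiE S (\<lambda>_. S). \<Prod>k\<in>S. X k (f k) * N (f k) (p k)))"
      unfolding ldet_def using S by (subst prod_sum_PiE) auto
    also have "\<dots> = (\<Sum>f\<in>PiE S (\<lambda>_. S). (\<Prod>k\<in>S. X k (f k)) * ldet S (\<lambda>k. N (f k)))"
      unfolding ldet_def sum_distrib_left
      by (subst sum.swap) (intro sum.cong, auto simp: prod.distrib algebra_simps)
    finally show ?thesis .
  qed
  have "\<exists>c. \<forall>N. ldet S (\<lambda>k. N (f k)) = c * ldet S N" if f: "f \<in> PiE S (\<lambda>_. S)" for f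
  proof (cases "inj_on f S")
    case False
    then obtain i j where "i \<in> S" "j \<in> S" "i \<noteq> j" "f i = f j" by (auto simp: inj_on_def)
    then have "ldet S (\<lambda>k. N (f k)) = 0" for N by (intro ldet_equal_rows[OF S, of i j]) auto
    then show ?thesis by (intro exI[of _ 0]) simp
  next
    case True
    \<comment> \<open>A function in \<open>PiE\<close> is \<open>undefined\<close> off
      \<open>S\<close>, whereas \<open>permutes\<close> asks for the identity there.\<close>
    define \<sigma> where "\<sigma> = (\<lambda>k. if k \<in> S then f k else k)"
    have "f ` S = S" using True f S by (intro endo_inj_surj) (auto simp: PiE_def Pi_def)
    then have "bij_betw \<sigma> S S" using True by (auto simp: bij_betw_def \<sigma>_def inj_on_def)
    then have "\<sigma> permutes S" by (rule bij_imp_permutes) (simp add: \<sigma>_def)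
    moreover have "ldet S (\<lambda>k. N (f k)) = ldet S (\<lambda>k. N (\<sigma> k))" for N
      by (intro ldet_cong) (simp add: \<sigma>_def)
    ultimately show ?thesis using ldet_permute_rows[OF S, of \<sigma>] by metis
  qed
  then obtain c where "\<forall>f\<in>PiE S (\<lambda>_. S). \<forall>N. ldet S (\<lambda>k. N (f k)) = c f * ldet S N" by metis
  then have "ldet S (\<lambda>i l. \<Sum>j\<in>S. X i j * N j l) =
      (\<Sum>f\<in>PiE S (\<lambda>_. S). (\<Prod>k\<in>S. X k (f k)) * c f) * ldet S N" for N
    unfolding expand sum_distrib_right by (intro sum.cong) auto
  then show ?thesis by blast
qed

lemma ldet_scale_row:
  assumes "finite S" "r \<in> S"
  shows "ldet S (\<lambda>i j. if i = r then c * M i j else M i j) = c * ldet S M"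
proof -
  have "(\<Prod>k\<in>S. if k = r then c * M k (p k) else M k (p k)) = c * (\<Prod>k\<in>S. M k (p k))" for p
    using assms by (simp add: prod.remove[of S r] mult.assoc)
  then show ?thesis by (simp add: ldet_def sum_distrib_left mult.left_commute)
qed

definition minor :: "nat \<Rightarrow> (nat \<Rightarrow> nat \<Rightarrow> complex) \<Rightarrow> (nat \<Rightarrow> nat) \<Rightarrow> complex" where
  "minor d w c = ldet {1..d} (\<lambda>k j. w k (c j))"

lemma wedge_eq_minor: "i \<in> index_tuples d n \<Longrightarrow> wedge d n w i = minor d w i"
  by (simp add: wedge_def minor_def ldet_def)

lemma minor_cong: "(\<And>k. k \<in> {1..d} \<Longrightarrow> c k = c' k) \<Longrightarrow> minor d w c = minor d w c'"
  unfolding minor_def by (intro ldet_cong) auto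

lemma minor_permute:
  "\<sigma> permutes {1..d} \<Longrightarrow> minor d w (c \<circ> \<sigma>) = of_int (sign \<sigma>) * minor d w c"
  unfolding minor_def o_def by (rule ldet_permute_columns) auto

lemma minor_not_inj: "\<not> inj_on c {1..d} \<Longrightarrow> minor d w c = 0"
  unfolding minor_def inj_on_def using ldet_equal_columns[of "{1..d}" _ _ "\<lambda>k j. w k (c j)"] by auto

text \<open>Turns a minor with distinct unsorted columns into a signed Pluecker coordinate. The
  permutation is kept for its sign and for the comparison of columns.\<close>

lemma sort_columns:
  assumes inj: "inj_on c {1..d}" and range: "c ` {1..d} \<subseteq> {1..n}"
  obtains a \<pi> where "a \<in> index_tuples d n" "\<pi> permutes {1..d}" "\<And>k. k \<in> {1..d} \<Longrightarrow> a k = c (\<pi> k)"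
proof -
  define xs where "xs = sorted_list_of_set (c ` {1..d})"
  have len: "length xs = d" using inj by (simp add: xs_def card_image)
  define a where "a = (\<lambda>k. if k \<in> {1..d} then xs ! (k - 1) else 0)"
  have in_c: "a k \<in> c ` {1..d}" if "k \<in> {1..d}" for k
  proof -
    have "xs ! (k - 1) \<in> set xs" using that len by (intro nth_mem) auto
    then show ?thesis using that by (simp add: a_def xs_def)
  qed
  have less: "a j < a k" if "1 \<le> j" "j < k" "k \<le> d" for j k
  proof -
    have "sorted_wrt (<) xs" by (simp add: xs_def)
    then have "xs ! (j - 1) < xs ! (k - 1)" using that len by (intro sorted_wrt_nth_less[of "(<)" xs]) auto
    then show ?thesis using that by (simp add: a_def)
  qed
  have aL: "a \<in> index_tuples d n"
  proof (rule index_tuplesI)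
    fix k assume "1 \<le> k" "k \<le> d"
    then have "a k \<in> {1..n}" using in_c[of k] range by auto
    then show "1 \<le> a k \<and> a k \<le> n" by simp
  qed (use less in \<open>auto simp: a_def\<close>)
  define \<pi> where "\<pi> = (\<lambda>k. if k \<in> {1..d} then the_inv_into {1..d} c (a k) else k)"
  have eq: "a k = c (\<pi> k)" if "k \<in> {1..d}" for k
    using f_the_inv_into_f[OF inj in_c[OF that]] that by (simp add: \<pi>_def)
  have sub: "\<pi> k \<in> {1..d}" if "k \<in> {1..d}" for k
    using the_inv_into_into[OF inj in_c[OF that] subset_refl] that by (simp add: \<pi>_def)
  have "inj_on \<pi> {1..d}"
  proof (rule inj_onI)
    fix j k assume jk: "j \<in> {1..d}" "k \<in> {1..d}" "\<pi> j = \<pi> k"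
    then have "a j = a k" using eq by simp
    then show "j = k" using jk less[of j k] less[of k j] by (cases j k rule: linorder_cases) auto
  qed
  moreover from this have "\<pi> ` {1..d} = {1..d}"
    using sub by (intro endo_inj_surj) auto
  ultimately have "bij_betw \<pi> {1..d} {1..d}" by (simp add: bij_betw_def)
  then have "\<pi> permutes {1..d}" by (rule bij_imp_permutes) (auto simp: \<pi>_def)
  then show ?thesis using that aL eq by blast
qed

section \<open>Garnir relations\<close>

text \<open>Here the permutation acts on the rows, so the factor at position \<open>k\<close> always
  belongs to column \<open>c k\<close>. Exchanged columns can then be separated from fixed ones
  factor by factor.\<close>

lemma minor_row_form:
  "minor d w c = (\<Sum>p | p permutes {1..d}. of_int (sign p) * (\<Prod>k=1..d. w (p k) (c k)))"
proof -
  have "minor d w c = (\<Sum>p | p permutes {1..d}.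
      of_int (sign (inv_into UNIV p)) * (\<Prod>k=1..d. w k (c (inv_into UNIV p k))))"
    unfolding minor_def ldet_def by (rule sum_permutations_inverse)
  also have "\<dots> = (\<Sum>p | p permutes {1..d}. of_int (sign p) * (\<Prod>k=1..d. w (p k) (c k)))"
  proof (rule sum.cong)
    fix p assume "p \<in> {p. p permutes {1..d}}"
    then have p: "p permutes {1..d}" by simp
    have "(\<Prod>k=1..d. w k (c (inv_into UNIV p k))) = (\<Prod>k=1..d. w (p k) (c k))"
      by (subst prod.permute[OF p]) (simp add: o_def permutes_inverses[OF p])
    moreover have "sign (inv_into UNIV p) = sign p"
      using permutes_imp_permutation[OF _ p] by (intro sign_inverse) simp
    ultimately show "of_int (sign (inv_into UNIV p)) * (\<Prod>k=1..d. w k (c (inv_into UNIV p k))) =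
        of_int (sign p) * (\<Prod>k=1..d. w (p k) (c k))" by simp
  qed simp
  finally show ?thesis .
qed

text \<open>Stated for a general commutative operation so that one splitting serves both products of
  matrix entries and sums of column multisets. Of the \<open>d + 1\<close> exchanged items
  \<open>u\<close>, the first \<open>q\<close> go to the first factor; the others occupy positions
  \<open>q, ..., d\<close> of the second, one place earlier.\<close>

lemma (in comm_monoid_set) split_shifted_pair:
  fixes q d :: nat
  assumes q: "1 \<le> q" "q \<le> d"
  shows "f (F (\<lambda>k. if k \<le> q then u k else v k) {1..d}) (F (\<lambda>k. if k < q then v' k else u (Suc k)) {1..d})
    = f (f (F v {q<..d}) (F v' {1..<q})) (F u {1..Suc d})"
proof -
  have "{1..d} = {1..q} \<union> {q<..d}" using q by auto
  then have "F (\<lambda>k. if k \<le> q then u k else v k) {1..d} = f (F u {1..q}) (F v {q<..d})"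
    by (simp only:) (subst union_disjoint, auto intro!: arg_cong2[where f = f] cong)
  moreover have "{1..d} = {1..<q} \<union> {q..d}" using q by auto
  then have "F (\<lambda>k. if k < q then v' k else u (Suc k)) {1..d} =
      f (F v' {1..<q}) (F (\<lambda>k. u (Suc k)) {q..d})"
    by (simp only:) (subst union_disjoint, auto intro!: arg_cong2[where f = f] cong)
  moreover have "F (\<lambda>k. u (Suc k)) {q..d} = F u {Suc q..Suc d}"
    by (rule shift_bounds_cl_Suc_ivl[symmetric])
  moreover have "{1..Suc d} = {1..q} \<union> {Suc q..Suc d}" using q by auto
  then have "F u {1..Suc d} = f (F u {1..q}) (F u {Suc q..Suc d})"
    by (simp only:) (subst union_disjoint, auto)
  ultimately show ?thesis by (simp add: ac_simps)
qed

text \<open>After expanding both minors, each pair of row permutations contributes a determinant of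
  size \<open>d + 1\<close> whose rows are taken from only \<open>d\<close> rows of \<open>w\<close>.\<close>

lemma garnir_sum_zero:
  assumes q: "1 \<le> q" "q \<le> d"
  shows "(\<Sum>\<sigma> | \<sigma> permutes {1..Suc d}. of_int (sign \<sigma>) *
    (minor d w (\<lambda>k. if k \<le> q then x (\<sigma> k) else a k) *
     minor d w (\<lambda>k. if k < q then b k else x (\<sigma> (Suc k))))) = 0"
proof -
  let ?P = "{p. p permutes {1..d}}" and ?Q = "{p. p permutes {1..Suc d}}"
  \<comment> \<open>\<open>r\<close> gives the row used by the exchanged column \<open>j\<close>;
    beyond \<open>q\<close> that column sits at position \<open>j - 1\<close> of the second minor.
    \<open>C\<close> collects the unmoved columns and does not depend on
    \<open>\<sigma>\<close>.\<close>
  define r where "r = (\<lambda>\<tau> \<rho> j. if j \<le> q then \<tau> j else \<rho> (j - 1) :: nat)"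
  define C where "C = (\<lambda>\<tau> \<rho>. (\<Prod>k\<in>{q<..d}. w (\<tau> k) (a k)) * (\<Prod>k\<in>{1..<q}. w (\<rho> k) (b k)))"
  have term_eq: "(\<Prod>k=1..d. w (\<tau> k) (if k \<le> q then x (\<sigma> k) else a k)) *
      (\<Prod>k=1..d. w (\<rho> k) (if k < q then b k else x (\<sigma> (Suc k)))) =
      C \<tau> \<rho> * (\<Prod>j=1..Suc d. w (r \<tau> \<rho> j) (x (\<sigma> j)))" for \<tau> \<rho> \<sigma>
  proof -
    have "(\<Prod>k=1..d. w (\<tau> k) (if k \<le> q then x (\<sigma> k) else a k)) =
        (\<Prod>k=1..d. if k \<le> q then w (r \<tau> \<rho> k) (x (\<sigma> k)) else w (\<tau> k) (a k))"
      by (intro prod.cong) (auto simp: r_def)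
    moreover have "(\<Prod>k=1..d. w (\<rho> k) (if k < q then b k else x (\<sigma> (Suc k)))) =
        (\<Prod>k=1..d. if k < q then w (\<rho> k) (b k) else w (r \<tau> \<rho> (Suc k)) (x (\<sigma> (Suc k))))"
      by (intro prod.cong) (auto simp: r_def)
    ultimately show ?thesis
      using prod.split_shifted_pair[OF q, of "\<lambda>j. w (r \<tau> \<rho> j) (x (\<sigma> j))"] by (simp add: C_def)
  qed
  have det_zero: "ldet {1..Suc d} (\<lambda>i j. w (r \<tau> \<rho> i) (x j)) = 0" if "\<tau> \<in> ?P" "\<rho> \<in> ?P" for \<tau> \<rho>
  proof -
    have "r \<tau> \<rho> j \<in> {1..d}" if "j \<in> {1..Suc d}" for j
    proof (cases "j \<le> q")
      case True
      then show ?thesis using permutes_in_image[of \<tau> "{1..d}" j] \<open>\<tau> \<in> ?P\<close> that q by (simp add: r_def)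
    next
      case False
      then show ?thesis
        using permutes_in_image[of \<rho> "{1..d}" "j - 1"] \<open>\<rho> \<in> ?P\<close> that q by (auto simp: r_def)
    qed
    then have "card (r \<tau> \<rho> ` {1..Suc d}) \<le> card {1..d}" by (intro card_mono) auto
    then have "\<not> inj_on (r \<tau> \<rho>) {1..Suc d}" by (intro pigeonhole) simp
    then obtain i j where "i \<in> {1..Suc d}" "j \<in> {1..Suc d}" "i \<noteq> j" "r \<tau> \<rho> i = r \<tau> \<rho> j"
      by (auto simp: inj_on_def)
    then show ?thesis by (intro ldet_equal_rows[of _ i j]) auto
  qed
  have "(\<Sum>\<sigma>\<in>?Q. of_int (sign \<sigma>) *
    (minor d w (\<lambda>k. if k \<le> q then x (\<sigma> k) else a k) *
     minor d w (\<lambda>k. if k < q then b k else x (\<sigma> (Suc k))))) =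
    (\<Sum>\<sigma>\<in>?Q. \<Sum>\<tau>\<in>?P. \<Sum>\<rho>\<in>?P. of_int (sign \<tau>) * of_int (sign \<rho>) * C \<tau> \<rho> *
      (of_int (sign \<sigma>) * (\<Prod>j=1..Suc d. w (r \<tau> \<rho> j) (x (\<sigma> j)))))"
    unfolding minor_row_form sum_product unfolding sum_distrib_left
  proof (intro sum.cong refl)
    fix \<sigma> \<tau> \<rho> :: "nat \<Rightarrow> nat"
    have rearrange: "of_int (sign \<sigma>) * (of_int (sign \<tau>) * y * (of_int (sign \<rho>) * z)) =
        of_int (sign \<tau>) * of_int (sign \<rho>) * (of_int (sign \<sigma>) * (y * z))" for y z :: complex
      by (simp add: ac_simps)
    show "of_int (sign \<sigma>) * (of_int (sign \<tau>) * (\<Prod>k=1..d. w (\<tau> k) (if k \<le> q then x (\<sigma> k) else a k)) *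
        (of_int (sign \<rho>) * (\<Prod>k=1..d. w (\<rho> k) (if k < q then b k else x (\<sigma> (Suc k)))))) =
        of_int (sign \<tau>) * of_int (sign \<rho>) * C \<tau> \<rho> *
        (of_int (sign \<sigma>) * (\<Prod>j=1..Suc d. w (r \<tau> \<rho> j) (x (\<sigma> j))))"
      unfolding rearrange term_eq by simp
  qed
  also have "\<dots> = (\<Sum>\<tau>\<in>?P. \<Sum>\<sigma>\<in>?Q. \<Sum>\<rho>\<in>?P. of_int (sign \<tau>) * of_int (sign \<rho>) * C \<tau> \<rho> *
      (of_int (sign \<sigma>) * (\<Prod>j=1..Suc d. w (r \<tau> \<rho> j) (x (\<sigma> j)))))"
    by (rule sum.swap)
  also have "\<dots> = (\<Sum>\<tau>\<in>?P. \<Sum>\<rho>\<in>?P. \<Sum>\<sigma>\<in>?Q. of_int (sign \<tau>) * of_int (sign \<rho>) * C \<tau> \<rho> *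
      (of_int (sign \<sigma>) * (\<Prod>j=1..Suc d. w (r \<tau> \<rho> j) (x (\<sigma> j)))))"
    by (intro sum.cong refl sum.swap)
  also have "\<dots> = (\<Sum>\<tau>\<in>?P. \<Sum>\<rho>\<in>?P. of_int (sign \<tau>) * of_int (sign \<rho>) * C \<tau> \<rho> *
      ldet {1..Suc d} (\<lambda>i j. w (r \<tau> \<rho> i) (x j)))"
    by (simp only: ldet_def sum_distrib_left)
  also have "\<dots> = 0" using det_zero by (intro sum.neutral ballI) simp
  finally show ?thesis .
qed

section \<open>Permutations preserving the two blocks of exchanged columns\<close>

text \<open>An injective map sending a finite block into itself permutes it, hence also permutes the
  complementary block, and the two restrictions act independently.\<close>

lemma permutes_split:
  assumes \<sigma>: "\<sigma> permutes {1..m}" and sub: "\<sigma> ` {1..q} \<subseteq> {1..q}" and q: "q \<le> m"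
  obtains \<sigma>1 \<sigma>2 where "\<sigma>1 permutes {1..q}" "\<sigma>2 permutes {Suc q..m}" "\<sigma> = \<sigma>1 \<circ> \<sigma>2"
proof -
  have inj: "inj \<sigma>" using permutes_inj[OF \<sigma>] .
  have img: "\<sigma> ` {1..q} = {1..q}"
    using sub inj by (intro endo_inj_surj) (auto intro: inj_on_subset)
  define \<sigma>1 where "\<sigma>1 = (\<lambda>k. if k \<in> {1..q} then \<sigma> k else k)"
  define \<sigma>2 where "\<sigma>2 = (\<lambda>k. if k \<in> {Suc q..m} then \<sigma> k else k)"
  have bij1: "bij_betw \<sigma> {1..q} {1..q}" using img inj by (auto simp: bij_betw_def intro: inj_on_subset)
  have bij2: "bij_betw \<sigma> {Suc q..m} {Suc q..m}"
  proof -
    have "{Suc q..m} = {1..m} - {1..q}" using q by auto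
    then have "\<sigma> ` {Suc q..m} = \<sigma> ` {1..m} - \<sigma> ` {1..q}" using image_set_diff[OF inj] by simp
    then have "\<sigma> ` {Suc q..m} = {Suc q..m}"
      using img permutes_image[OF \<sigma>] \<open>{Suc q..m} = {1..m} - {1..q}\<close> by simp
    then show ?thesis using inj by (auto simp: bij_betw_def intro: inj_on_subset)
  qed
  have "bij_betw \<sigma>1 {1..q} {1..q}" using bij1 by (rule bij_betw_cong[THEN iffD1, rotated]) (simp add: \<sigma>1_def)
  then have 1: "\<sigma>1 permutes {1..q}" by (rule bij_imp_permutes) (auto simp: \<sigma>1_def)
  have "bij_betw \<sigma>2 {Suc q..m} {Suc q..m}"
    using bij2 by (rule bij_betw_cong[THEN iffD1, rotated]) (simp add: \<sigma>2_def)
  then have 2: "\<sigma>2 permutes {Suc q..m}" by (rule bij_imp_permutes) (auto simp: \<sigma>2_def)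
  have "\<sigma> k = \<sigma>1 (\<sigma>2 k)" for k
  proof (cases "k \<in> {Suc q..m}")
    case True
    then have "\<sigma> k \<in> {Suc q..m}" using bij2 by (auto simp: bij_betw_def)
    then show ?thesis using True by (simp add: \<sigma>1_def \<sigma>2_def)
  next
    case False
    then show ?thesis using permutes_not_in[OF \<sigma>, of k] by (auto simp: \<sigma>1_def \<sigma>2_def)
  qed
  then have "\<sigma> = \<sigma>1 \<circ> \<sigma>2" by (simp add: fun_eq_iff)
  then show ?thesis using that 1 2 by blast
qed

text \<open>Such a permutation only reorders columns inside each minor. The sign it produces there
  cancels the sign in front, one transposition at a time.\<close>

lemma garnir_stabilizer_term:
  fixes x a b :: "nat \<Rightarrow> nat" and w :: "nat \<Rightarrow> nat \<Rightarrow> complex"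
  assumes q: "1 \<le> q" "q \<le> d"
  defines "G \<equiv> \<lambda>\<sigma>. of_int (sign \<sigma>) *
    (minor d w (\<lambda>k. if k \<le> q then x (\<sigma> k) else a k) *
     minor d w (\<lambda>k. if k < q then b k else x (\<sigma> (Suc k))))"
  assumes \<sigma>: "\<sigma> permutes {1..Suc d}" and sub: "\<sigma> ` {1..q} \<subseteq> {1..q}"
  shows "G \<sigma> = G id"
proof -
  have sgn: "sign (p \<circ> transpose i j) = - sign p"
    if "p permutes {1..Suc d}" "i \<noteq> j" for i j and p :: "nat \<Rightarrow> nat"
    using permutes_imp_permutation[OF _ that(1)] that(2)
    by (simp add: sign_compose permutation_swap_id sign_swap_id)
  have step1: "G (p \<circ> transpose i j) = G p"
    if p: "p permutes {1..Suc d}" and ij: "i \<noteq> j" "i \<in> {1..q}" "j \<in> {1..q}" for p i j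
  proof -
    have "(\<lambda>k. if k \<le> q then x ((p \<circ> transpose i j) k) else a k) =
        (\<lambda>k. if k \<le> q then x (p k) else a k) \<circ> transpose i j"
      using ij by (auto simp: transpose_def fun_eq_iff)
    moreover have "(\<lambda>k. if k < q then b k else x ((p \<circ> transpose i j) (Suc k))) =
        (\<lambda>k. if k < q then b k else x (p (Suc k)))"
      using ij by (auto simp: transpose_def fun_eq_iff)
    moreover have "transpose i j permutes {1..d}" using ij q by (intro permutes_swap_id) auto
    ultimately show ?thesis
      unfolding G_def using sgn[OF p ij(1)] ij(1) by (simp only: minor_permute sign_swap_id) simp
  qed
  have step2: "G (p \<circ> transpose i j) = G p"
    if p: "p permutes {1..Suc d}" and ij: "i \<noteq> j" "i \<in> {Suc q..Suc d}" "j \<in> {Suc q..Suc d}" for p i j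
  proof -
    \<comment> \<open>Index \<open>i\<close> of the exchanged list is column position
      \<open>i - 1\<close> of the second minor, so the transposition shifts down by one.\<close>
    have "(\<lambda>k. if k < q then b k else x ((p \<circ> transpose i j) (Suc k))) =
        (\<lambda>k. if k < q then b k else x (p (Suc k))) \<circ> transpose (i - 1) (j - 1)"
      using ij by (auto simp: transpose_def fun_eq_iff)
    moreover have "(\<lambda>k. if k \<le> q then x ((p \<circ> transpose i j) k) else a k) =
        (\<lambda>k. if k \<le> q then x (p k) else a k)"
      using ij by (auto simp: transpose_def fun_eq_iff)
    moreover have "transpose (i - 1) (j - 1) permutes {1..d}" using ij q by (intro permutes_swap_id) auto
    moreover have "i - 1 \<noteq> j - 1" using ij by auto
    ultimately show ?thesis
      unfolding G_def using sgn[OF p ij(1)] by (simp only: minor_permute sign_swap_id) simp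
  qed
  obtain \<sigma>1 \<sigma>2 where split: "\<sigma>1 permutes {1..q}" "\<sigma>2 permutes {Suc q..Suc d}" "\<sigma> = \<sigma>1 \<circ> \<sigma>2"
    using permutes_split[OF \<sigma> sub] q by auto
  have lift1: "p permutes {1..Suc d}" if "p permutes {1..q}" for p
    using permutes_subset[OF that] q by auto
  have lift2: "p permutes {1..Suc d}" if "p permutes {Suc q..Suc d}" for p
    using permutes_subset[OF that] q by auto
  have "G \<sigma>1 = G id"
    using finite_atLeastAtMost split(1)
  proof (induction rule: permutes_rev_induct)
    case (swap i j p)
    then show ?case using step1[OF lift1] by metis
  qed simp
  moreover have "G (\<sigma>1 \<circ> \<sigma>2) = G \<sigma>1"
    using finite_atLeastAtMost split(2)
  proof (induction rule: permutes_rev_induct)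
    case (swap i j p)
    have "\<sigma>1 \<circ> p permutes {1..Suc d}"
      using lift1[OF split(1)] lift2[OF swap.hyps(4)] by (rule permutes_compose[rotated])
    then have "G (\<sigma>1 \<circ> p \<circ> transpose i j) = G (\<sigma>1 \<circ> p)" using step2 swap by metis
    then show ?case using swap by (simp only: o_assoc)
  qed simp
  ultimately show ?thesis using split by simp
qed

lemma sum_fun_apply:
  fixes F :: "'i \<Rightarrow> 'v \<Rightarrow> complex"
  shows "(\<Sum>i\<in>A. F i) w = (\<Sum>i\<in>A. F i w)"
  by (induction A rule: infinite_finite_induct) auto

lemma span_in_span:
  assumes "x \<in> cfun.span S" "S \<subseteq> cfun.span T"
  shows "x \<in> cfun.span T"
  using cfun.span_minimal[OF assms(2) cfun.subspace_span] assms(1) by blast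

lemma span_mult:
  fixes g :: "'v \<Rightarrow> complex"
  assumes "f \<in> cfun.span S"
  shows "(\<lambda>w. g w * f w) \<in> cfun.span ((\<lambda>f w. g w * f w) ` S)"
  using assms
proof (induction rule: cfun.span_induct_alt)
  case base
  show ?case using cfun.span_zero[of "(\<lambda>f w. g w * f w) ` S"] by (simp add: zero_fun_def)
next
  case (step c x y)
  have "(\<lambda>w. g w * x w) \<in> cfun.span ((\<lambda>f w. g w * f w) ` S)"
    using step(1) by (intro cfun.span_base) auto
  from cfun.span_add[OF cfun.span_scale[OF this, of c] step(2)]
  have "cscale c (\<lambda>w. g w * x w) + (\<lambda>w. g w * y w) \<in> cfun.span ((\<lambda>f w. g w * f w) ` S)" .
  also have "cscale c (\<lambda>w. g w * x w) + (\<lambda>w. g w * y w) = (\<lambda>w. g w * (cscale c x + y) w)"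
    by (auto simp: cscale_def fun_eq_iff algebra_simps)
  finally show ?case .
qed

text \<open>Sorting hides where an entry ends up, so tuples are compared through the number of
  entries below each \<open>y\<close>. For \<open>y\<close> at most \<open>a q\<close>, a small
  exchanged column must come from an index before \<open>q\<close>, and \<open>\<sigma>\<close>
  injects the small columns of the new tuple into those of \<open>a\<close>.\<close>

lemma strict_less_of_exchange:
  assumes a: "a \<in> index_tuples d n" and a': "a' \<in> index_tuples d n" and q: "q \<in> {1..d}"
    and x: "strict_mono_on {1..Suc d} x" "\<And>k. k \<in> {1..q} \<Longrightarrow> x k = a k"
    and \<sigma>: "\<sigma> permutes {1..Suc d}" and moved: "k0 \<in> {1..q}" "q < \<sigma> k0"
    and \<pi>: "\<pi> permutes {1..d}"
    and sorted: "\<And>k. k \<in> {1..d} \<Longrightarrow> a' k = (if \<pi> k \<le> q then x (\<sigma> (\<pi> k)) else a (\<pi> k))"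
  shows "a < a'"
proof -
  define c where "c = (\<lambda>k. if k \<le> q then x (\<sigma> k) else a k)"
  have \<sigma>_in: "\<sigma> k \<in> {1..Suc d}" if "k \<in> {1..q}" for k
    using permutes_in_image[OF \<sigma>, of k] that q by auto
  have \<sigma>_inj: "inj_on \<sigma> B" for B using permutes_inj[OF \<sigma>] by (rule inj_on_subset) simp
  have x_mono: "x i \<le> x j" if "i \<in> {1..Suc d}" "j \<in> {1..Suc d}" "i \<le> j" for i j
    using strict_mono_onD[OF x(1), of i j] that by (cases "i = j") auto
  have a_mono: "a i \<le> a j" if "i \<in> {1..d}" "j \<in> {1..d}" "i \<le> j" for i j
    using index_tuples_less[OF a, of i j] that by (cases "i = j") auto
  have card_a': "card {k\<in>{1..d}. a' k < y} = card {k\<in>{1..d}. c k < y}" for y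
  proof (rule bij_betw_same_card[of \<pi>])
    have "{k\<in>{1..d}. c k < y} = \<pi> ` {k\<in>{1..d}. a' k < y}"
    proof (intro equalityI subsetI)
      fix k assume k: "k \<in> {k\<in>{1..d}. c k < y}"
      then obtain j where "j \<in> {1..d}" "k = \<pi> j" using permutes_image[OF \<pi>] by blast
      then show "k \<in> \<pi> ` {k\<in>{1..d}. a' k < y}" using k sorted by (auto simp: c_def)
    next
      fix k assume "k \<in> \<pi> ` {k\<in>{1..d}. a' k < y}"
      then obtain j where "j \<in> {1..d}" "k = \<pi> j" "a' j < y" by blast
      then show "k \<in> {k\<in>{1..d}. c k < y}"
        using sorted permutes_in_image[OF \<pi>, of j] by (simp add: c_def)
    qed
    then show "bij_betw \<pi> {k\<in>{1..d}. a' k < y} {k\<in>{1..d}. c k < y}"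
      using permutes_inj[OF \<pi>] by (auto simp: bij_betw_def intro: inj_on_subset)
  qed
  have card_le: "card {k\<in>{1..d}. c k < y} \<le> card {k\<in>{1..d}. a k < y}" for y
  proof (cases "a q < y")
    case True
    have "{k\<in>{1..d}. c k < y} \<subseteq> {k\<in>{1..d}. a k < y}"
    proof
      fix k assume k: "k \<in> {k\<in>{1..d}. c k < y}"
      then show "k \<in> {k\<in>{1..d}. a k < y}"
        using a_mono[of k q] True q by (cases "k \<le> q") (auto simp: c_def)
    qed
    then show ?thesis by (intro card_mono) auto
  next
    case False
    have sub: "k \<in> {1..q} \<and> \<sigma> k \<in> {k\<in>{1..d}. a k < y}" if k: "k \<in> {k\<in>{1..d}. c k < y}" for k
    proof (cases "k \<le> q")
      case True
      then have xk: "x (\<sigma> k) < y" and kq: "k \<in> {1..q}" using k by (auto simp: c_def)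
      have "\<sigma> k < q"
      proof (rule ccontr)
        assume "\<not> \<sigma> k < q"
        then have "x q \<le> x (\<sigma> k)" using \<sigma>_in[OF kq] q by (intro x_mono) auto
        then show False using xk x(2)[of q] q False by auto
      qed
      then show ?thesis using xk x(2)[of "\<sigma> k"] kq \<sigma>_in[OF kq] q by auto
    next
      case Fk: False
      then show ?thesis using a_mono[of q k] k q False by (auto simp: c_def)
    qed
    then show ?thesis by (intro card_inj_on_le[of \<sigma>]) (auto simp: \<sigma>_inj)
  qed
  have "a \<le> a'"
    unfolding index_tuples_le_iff[OF a]
  proof (intro ballI leI notI)
    fix k assume k: "k \<in> {1..d}" "a' k < a k"
    then have "k \<le> card {j\<in>{1..d}. a' j < a k}" using card_less_entry_le[OF a' k(1)] by simp
    also have "\<dots> \<le> card {j\<in>{1..d}. a j < a k}" using card_a' card_le by simp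
    finally show False using card_less_entry_le[OF a k(1)] by simp
  qed
  moreover have "a \<noteq> a'"
  proof
    assume "a = a'"
    \<comment> \<open>Counting below \<open>Suc (a q)\<close> counts entries at most
      \<open>a q\<close>. The tuple \<open>a\<close> has at least \<open>q\<close> of them; the new
      columns lose the one at \<open>k0\<close>, which now exceeds \<open>a q\<close>.\<close>
    have "{k\<in>{1..d}. c k < Suc (a q)} \<subseteq> {1..q} - {k0}"
    proof
      fix k assume k: "k \<in> {k\<in>{1..d}. c k < Suc (a q)}"
      have "k \<le> q" using k index_tuples_less[OF a, of q k] q by (cases "k \<le> q") (auto simp: c_def)
      moreover have "k \<noteq> k0"
      proof
        assume "k = k0"
        then have "x q < x (\<sigma> k)" using moved \<sigma>_in[of k0] q by (intro strict_mono_onD[OF x(1)]) auto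
        then show False using k \<open>k \<le> q\<close> x(2)[of q] q by (auto simp: c_def)
      qed
      ultimately show "k \<in> {1..q} - {k0}" using k by auto
    qed
    then have "card {k\<in>{1..d}. c k < Suc (a q)} \<le> card ({1..q} - {k0})" by (intro card_mono) auto
    also have "\<dots> = q - 1" using moved by simp
    finally have "\<not> q \<le> card {k\<in>{1..d}. a k < Suc (a q)}" using card_a' \<open>a = a'\<close> q by auto
    then show False using card_less_entry_le[OF a q, of "Suc (a q)"] by simp
  qed
  ultimately show ?thesis by simp
qed

text \<open>In the vanishing alternating sum, block-preserving permutations all reproduce the
  original product. Each of the others gives zero, through a repeated column, or a signed product of
  sorted minors.\<close>

lemma garnir_relation:
  assumes a: "a \<in> index_tuples d n" and b: "b \<in> index_tuples d n"
    and q: "q \<in> {1..d}" "a q < b q"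
  shows "(\<lambda>w. minor d w a * minor d w b) \<in> cfun.span {\<lambda>w. minor d w a' * minor d w b' | a' b'.
    a' \<in> index_tuples d n \<and> b' \<in> index_tuples d n \<and> a < a' \<and> pair_content d (a', b') = pair_content d (a, b)}"
    (is "?F \<in> cfun.span ?S")
proof -
  \<comment> \<open>The columns \<open>a 1 < ... < a q < b q < ... < b d\<close>; the single
    inequality \<open>a q < b q\<close> makes the whole list increasing.\<close>
  define x where "x = (\<lambda>k. if k \<le> q then a k else b (k - 1))"
  define c1 where "c1 = (\<lambda>\<sigma> k. if k \<le> q then x (\<sigma> k) else a k)"
  define c2 where "c2 = (\<lambda>\<sigma> k. if k < q then b k else x (\<sigma> (Suc k)))"
  define G where "G = (\<lambda>\<sigma> w. of_int (sign \<sigma>) * (minor d w (c1 \<sigma>) * minor d w (c2 \<sigma>)))"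
  let ?Q = "{\<sigma>. \<sigma> permutes {1..Suc d}}"
  define A where "A = {\<sigma> \<in> ?Q. \<sigma> ` {1..q} \<subseteq> {1..q}}"
  have q': "1 \<le> q" "q \<le> d" using q by auto
  have x_less: "strict_mono_on {1..Suc d} x"
  proof (rule strict_mono_onI)
    fix i j assume ij: "i \<in> {1..Suc d}" "j \<in> {1..Suc d}" "i < j"
    consider "j \<le> q" | "i \<le> q" "q < j" | "q < i" using ij by linarith
    then show "x i < x j"
    proof cases
      case 1
      then show ?thesis using index_tuples_less[OF a, of i j] ij q' by (simp add: x_def)
    next
      case 2
      have "a i \<le> a q" using index_tuples_less[OF a, of i q] ij 2 q' by (cases "i = q") auto
      moreover have "q \<le> j - 1" "j - 1 \<le> d" using ij 2 by auto
      then have "b q \<le> b (j - 1)"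
        using add_leD1[OF index_tuples_gap[OF b q'(1)]] by blast
      ultimately show ?thesis using q 2 by (simp add: x_def)
    next
      case 3
      then show ?thesis using index_tuples_less[OF b, of "i - 1" "j - 1"] ij q' by (auto simp: x_def)
    qed
  qed
  have x_range: "x k \<in> {1..n}" if k: "k \<in> {1..Suc d}" for k
  proof (cases "k \<le> q")
    case True
    then show ?thesis using index_tuples_range[OF a, of k] k q' by (simp add: x_def)
  next
    case False
    then have "k - 1 \<in> {1..d}" using k q' by auto
    then show ?thesis using index_tuples_range[OF b] False by (simp add: x_def)
  qed
  have c1_id: "minor d w (c1 id) = minor d w a" and c2_id: "minor d w (c2 id) = minor d w b" for w
    by (auto intro!: minor_cong simp: c1_def c2_def x_def)
  have stab: "G \<sigma> = ?F" if "\<sigma> \<in> A" for \<sigma>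
  proof
    fix w
    have "G \<sigma> w = G id w"
      unfolding G_def c1_def c2_def
      using that q' by (intro garnir_stabilizer_term) (auto simp: A_def)
    then show "G \<sigma> w = ?F w" by (simp add: G_def c1_id c2_id)
  qed
  have rest: "G \<sigma> \<in> cfun.span ?S" if \<sigma>: "\<sigma> \<in> ?Q - A" for \<sigma>
  proof (cases "inj_on (c1 \<sigma>) {1..d} \<and> inj_on (c2 \<sigma>) {1..d}")
    case False
    then have "G \<sigma> = 0" using minor_not_inj by (auto simp: G_def fun_eq_iff)
    then show ?thesis using cfun.span_zero by simp
  next
    case True
    have \<sigma>p: "\<sigma> permutes {1..Suc d}" using \<sigma> by simp
    have x\<sigma>: "x (\<sigma> k) \<in> {1..n}" if "k \<in> {1..Suc d}" for k
      using x_range permutes_in_image[OF \<sigma>p] that by simp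
    have "c1 \<sigma> k \<in> {1..n}" "c2 \<sigma> k \<in> {1..n}" if "k \<in> {1..d}" for k
      using x\<sigma>[of k] x\<sigma>[of "Suc k"] that index_tuples_range[OF a that] index_tuples_range[OF b that]
      by (auto simp: c1_def c2_def)
    then have "c1 \<sigma> ` {1..d} \<subseteq> {1..n}" "c2 \<sigma> ` {1..d} \<subseteq> {1..n}" by auto
    from sort_columns[OF conjunct1[OF True] this(1)] sort_columns[OF conjunct2[OF True] this(2)]
    obtain a' \<pi> b' \<rho> where a': "a' \<in> index_tuples d n" "\<pi> permutes {1..d}"
        "\<And>k. k \<in> {1..d} \<Longrightarrow> a' k = c1 \<sigma> (\<pi> k)"
      and b': "b' \<in> index_tuples d n" "\<rho> permutes {1..d}"
        "\<And>k. k \<in> {1..d} \<Longrightarrow> b' k = c2 \<sigma> (\<rho> k)" by metis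
    have unsort: "minor d w c = of_int (sign \<pi>) * minor d w c'"
      if "\<pi> permutes {1..d}" "\<And>k. k \<in> {1..d} \<Longrightarrow> c' k = c (\<pi> k)" for w c c' \<pi>
    proof -
      have "minor d w c' = minor d w (c \<circ> \<pi>)" using that by (intro minor_cong) auto
      then have "minor d w c' = of_int (sign \<pi>) * minor d w c" using minor_permute[OF that(1)] by simp
      then show ?thesis by (simp flip: mult.assoc of_int_mult)
    qed
    have G_eq: "G \<sigma> = cscale (of_int (sign \<sigma> * sign \<pi> * sign \<rho>)) (\<lambda>w. minor d w a' * minor d w b')"
      using unsort[where c = "c1 \<sigma>" and c' = a', OF a'(2,3)]
        unsort[where c = "c2 \<sigma>" and c' = b', OF b'(2,3)] by (simp add: G_def cscale_def fun_eq_iff)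
    have "\<not> \<sigma> ` {1..q} \<subseteq> {1..q}" using \<sigma> by (simp add: A_def)
    then obtain k0 where k0: "k0 \<in> {1..q}" "\<not> \<sigma> k0 \<in> {1..q}" by blast
    then have "q < \<sigma> k0" using permutes_in_image[OF \<sigma>p, of k0] q' by auto
    moreover have "a' k = (if \<pi> k \<le> q then x (\<sigma> (\<pi> k)) else a (\<pi> k))" if "k \<in> {1..d}" for k
      using a'(3)[OF that] by (simp add: c1_def)
    ultimately have "a < a'"
      using strict_less_of_exchange[OF a a'(1) q(1) x_less _ \<sigma>p k0(1) _ a'(2)] by (simp add: x_def)
    moreover have "pair_content d (a', b') = pair_content d (a, b)"
    proof -
      \<comment> \<open>Between them the two minors use each exchanged column exactly once, and the
        remaining columns stay fixed, so the content does not depend on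
        \<open>\<sigma>\<close>.\<close>
      have pair: "(\<Sum>k=1..d. {#c1 \<sigma> k#}) + (\<Sum>k=1..d. {#c2 \<sigma> k#}) =
          (\<Sum>k\<in>{q<..d}. {#a k#}) + (\<Sum>k\<in>{1..<q}. {#b k#}) + (\<Sum>j=1..Suc d. {#x (\<sigma> j)#})" for \<sigma>
        using sum.split_shifted_pair[OF q', of "\<lambda>j. {#x (\<sigma> j)#}" "\<lambda>k. {#a k#}" "\<lambda>k. {#b k#}"]
        by (simp add: c1_def c2_def if_distrib[of "\<lambda>v. {#v#}"])
      have perm: "(\<Sum>k=1..d. {#c (\<pi> k)#}) = (\<Sum>k=1..d. {#c k#})" if "\<pi> permutes {1..d}"
        for c :: "nat \<Rightarrow> nat" and \<pi>
        using sum.permute[OF that, of "\<lambda>k. {#c k#}"] by (simp add: o_def)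
      have "pair_content d (a', b') = (\<Sum>k=1..d. {#c1 \<sigma> (\<pi> k)#}) + (\<Sum>k=1..d. {#c2 \<sigma> (\<rho> k)#})"
        unfolding pair_content_def fst_conv snd_conv
        using a'(3) b'(3) by (intro arg_cong2[where f = "(+)"] sum.cong) auto
      also have "\<dots> = (\<Sum>k=1..d. {#c1 \<sigma> k#}) + (\<Sum>k=1..d. {#c2 \<sigma> k#})"
        by (simp only: perm[OF a'(2)] perm[OF b'(2)])
      also have "\<dots> = (\<Sum>k=1..d. {#c1 id k#}) + (\<Sum>k=1..d. {#c2 id k#})"
        unfolding pair using sum.permute[OF \<sigma>p, of "\<lambda>k. {#x k#}"] by (simp add: o_def)
      also have "\<dots> = pair_content d (a, b)"
        unfolding pair_content_def fst_conv snd_conv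
        by (intro arg_cong2[where f = "(+)"] sum.cong) (auto simp: c1_def c2_def x_def)
      finally show ?thesis .
    qed
    ultimately show ?thesis
      unfolding G_eq using a'(1) b'(1) by (intro cfun.span_scale cfun.span_base) auto
  qed
  have finQ: "finite ?Q" by (intro finite_permutations) simp
  have finA: "finite A" using finQ by (simp add: A_def)
  have "id \<in> A" by (auto simp: A_def permutes_id)
  then have card: "card A \<noteq> 0" using finA by auto
  \<comment> \<open>Solving for the original product divides by the number of its copies, which is
    nonzero because the identity is among them.\<close>
  have "?F = cscale (- inverse (of_nat (card A))) (\<Sum>\<sigma>\<in>?Q - A. G \<sigma>)"
  proof
    fix w
    have "0 = (\<Sum>\<sigma>\<in>?Q. G \<sigma> w)"
      unfolding G_def c1_def c2_def using garnir_sum_zero[OF q'] by simp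
    also have "\<dots> = (\<Sum>\<sigma>\<in>?Q - A. G \<sigma> w) + (\<Sum>\<sigma>\<in>A. G \<sigma> w)"
      by (rule sum.subset_diff[OF _ finQ]) (auto simp: A_def)
    also have "(\<Sum>\<sigma>\<in>A. G \<sigma> w) = of_nat (card A) * ?F w" using stab by simp
    finally have "of_nat (card A) * ?F w = - (\<Sum>\<sigma>\<in>?Q - A. G \<sigma> w)"
      by (simp add: eq_neg_iff_add_eq_0 add.commute)
    moreover have "(\<Sum>\<sigma>\<in>?Q - A. G \<sigma>) w = (\<Sum>\<sigma>\<in>?Q - A. G \<sigma> w)"
      by (rule sum_fun_apply)
    ultimately show "?F w = cscale (- inverse (of_nat (card A))) (\<Sum>\<sigma>\<in>?Q - A. G \<sigma>) w"
      using card by (simp add: cscale_def field_simps)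
  qed
  then show ?thesis using rest by (simp only:) (intro cfun.span_scale cfun.span_sum)
qed

section \<open>Straightening\<close>

definition monomial_fun :: "nat \<Rightarrow> (nat \<Rightarrow> nat) list \<Rightarrow> (nat \<Rightarrow> nat \<Rightarrow> complex) \<Rightarrow> complex" where
  "monomial_fun d ks w = (\<Prod>k\<leftarrow>ks. minor d w k)"

text \<open>The termination measure of straightening: entries are bounded by \<open>n\<close>, so
  the total distance to \<open>n\<close> drops whenever the first tuple grows.\<close>

lemma index_tuples_rank_less:
  assumes a: "a \<in> index_tuples d n" and b: "b \<in> index_tuples d n" and less: "a < b"
  shows "(\<Sum>k=1..d. n - b k) < (\<Sum>k=1..d. n - a k)"
proof (rule sum_strict_mono_ex1)
  show "\<forall>k\<in>{1..d}. n - b k \<le> n - a k"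
    using less by (auto simp: less_le le_fun_def intro: diff_le_mono2)
  have "a \<noteq> b" using less by simp
  then have "\<exists>k\<in>{1..d}. a k \<noteq> b k" using index_tuples_eqI[OF a b] by blast
  then obtain k where k: "k \<in> {1..d}" "a k \<noteq> b k" by blast
  then have "a k < b k" using less by (simp add: less_le le_fun_def)
  then show "\<exists>k\<in>{1..d}. n - b k < n - a k"
    using k(1) index_tuples_range[OF b k(1)] by (intro bexI[of _ k]) auto
qed simp

lemma not_le_index_tuplesE:
  assumes "b \<in> index_tuples d n" "\<not> b \<le> a"
  obtains q where "q \<in> {1..d}" "a q < b q"
  using assms index_tuples_le_iff[OF assms(1)] by (auto simp: not_le)

text \<open>The bound \<open>a <= k1\<close> and the content are invariants: the first tuple only
  grows and exchanges preserve columns, so both pass through the recursion by transitivity.\<close>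

lemma pair_in_span:
  assumes "a \<in> index_tuples d n" "b \<in> index_tuples d n"
  shows "(\<lambda>w. minor d w a * minor d w b) \<in> cfun.span {\<lambda>w. minor d w k1 * minor d w k2 | k1 k2.
    k1 \<in> index_tuples d n \<and> k2 \<in> index_tuples d n \<and> k2 \<le> k1 \<and> a \<le> k1 \<and>
    pair_content d (k1, k2) = pair_content d (a, b)}"
  using assms
proof (induction "\<Sum>k=1..d. n - a k" arbitrary: a b rule: less_induct)
  case less
  let ?S = "\<lambda>a b. {\<lambda>w. minor d w k1 * minor d w k2 | k1 k2.
    k1 \<in> index_tuples d n \<and> k2 \<in> index_tuples d n \<and> k2 \<le> k1 \<and> a \<le> k1 \<and>
    pair_content d (k1, k2) = pair_content d (a, b)}"
  show ?case
  proof (cases "b \<le> a")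
    case True
    then show ?thesis using less.prems by (intro cfun.span_base) blast
  next
    case False
    then obtain q where q: "q \<in> {1..d}" "a q < b q" by (rule not_le_index_tuplesE[OF less.prems(2)])
    show ?thesis
    proof (rule span_in_span[OF garnir_relation[OF less.prems q]], rule subsetI)
      fix f assume "f \<in> {\<lambda>w. minor d w a' * minor d w b' | a' b'. a' \<in> index_tuples d n \<and>
        b' \<in> index_tuples d n \<and> a < a' \<and> pair_content d (a', b') = pair_content d (a, b)}"
      then obtain a' b' where f: "f = (\<lambda>w. minor d w a' * minor d w b')" "a' \<in> index_tuples d n"
        "b' \<in> index_tuples d n" "a < a'" "pair_content d (a', b') = pair_content d (a, b)" by blast
      have "f \<in> cfun.span (?S a' b')"
        unfolding f(1) using index_tuples_rank_less[OF less.prems(1) f(2,4)] f(2,3)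
        by (rule less.hyps)
      moreover have "?S a' b' \<subseteq> ?S a b" using f(4,5) by (force intro: order_trans)
      ultimately show "f \<in> cfun.span (?S a b)" using cfun.span_mono by blast
    qed
  qed
qed

text \<open>Two nested inductions: the length handles the tail, the rank handles the head. An
  exchange at the head may destroy the order of the tail, but it strictly raises the head, and the
  shorter tail can be straightened again.\<close>

lemma monomial_fun_in_span:
  assumes "set ks \<subseteq> index_tuples d n"
  shows "monomial_fun d ks \<in> cfun.span (monomial_fun d ` {t \<in> multichains (index_tuples d n). length t = length ks})"
  using assms
proof (induction "length ks" arbitrary: ks)
  case 0
  then have "ks \<in> {t \<in> multichains (index_tuples d n). length t = length ks}"
    by (simp add: multichains_def)
  then show ?case by (intro cfun.span_base) blast
next
  case (Suc r)
  let ?L = "index_tuples d n"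
  let ?T = "\<lambda>r. {t \<in> multichains ?L. length t = r}"
  have cons: "monomial_fun d (h # t) \<in> cfun.span (monomial_fun d ` ?T (Suc r))"
    if "h \<in> ?L" "set t \<subseteq> ?L" "length t = r" for h t
    using that
  proof (induction "\<Sum>k=1..d. n - h k" arbitrary: h t rule: less_induct)
    case less
    have fun_Cons: "monomial_fun d (h # t) = (\<lambda>w. minor d w h * monomial_fun d t w)" for h t
      by (simp add: monomial_fun_def fun_eq_iff)
    have "monomial_fun d t \<in> cfun.span (monomial_fun d ` ?T r)"
      using Suc.hyps(1)[of t] less.prems by simp
    then have "monomial_fun d (h # t) \<in>
        cfun.span ((\<lambda>f w. minor d w h * f w) ` monomial_fun d ` ?T r)"
      unfolding fun_Cons by (rule span_mult)
    then show ?case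
    proof (rule span_in_span, intro subsetI)
      fix f assume "f \<in> (\<lambda>f w. minor d w h * f w) ` monomial_fun d ` ?T r"
      then obtain s where s: "s \<in> ?T r" and f: "f = monomial_fun d (h # s)"
        by (auto simp: fun_Cons)
      have sL: "set s \<subseteq> ?L" and sorted: "sorted_wrt (\<ge>) s" and len: "length s = r"
        using s by (auto simp: multichains_def)
      show "f \<in> cfun.span (monomial_fun d ` ?T (Suc r))"
      proof (cases "sorted_wrt (\<ge>) (h # s)")
        case True
        then have "h # s \<in> ?T (Suc r)" using sL len less.prems by (simp add: multichains_def)
        then show ?thesis unfolding f by (intro cfun.span_base) blast
      next
        case False
        then obtain u v where uv: "s = u # v" using sorted by (cases s) auto
        \<comment> \<open>With a sorted tail, only the pair at the front can be out of
          order.\<close>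
        have "\<not> u \<le> h" using False sorted uv by (auto intro: order_trans)
        have uL: "u \<in> ?L" using sL uv by simp
        obtain q where q: "q \<in> {1..d}" "h q < u q"
          using not_le_index_tuplesE[OF uL \<open>\<not> u \<le> h\<close>] .
        have f_eq: "f = (\<lambda>w. monomial_fun d v w * (minor d w h * minor d w u))"
          by (simp add: f uv monomial_fun_def fun_eq_iff ac_simps)
        show ?thesis
          unfolding f_eq
        proof (rule span_in_span[OF span_mult[OF garnir_relation[OF less.prems(1) uL q]]], rule subsetI)
          fix g assume "g \<in> (\<lambda>f w. monomial_fun d v w * f w) ` {\<lambda>w. minor d w a' * minor d w b' | a' b'.
            a' \<in> ?L \<and> b' \<in> ?L \<and> h < a' \<and> pair_content d (a', b') = pair_content d (h, u)}"
          then obtain a' b' where ab: "a' \<in> ?L" "b' \<in> ?L" "h < a'"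
            and g: "g = (\<lambda>w. monomial_fun d v w * (minor d w a' * minor d w b'))" by blast
          have "g = monomial_fun d (a' # b' # v)"
            by (simp add: g monomial_fun_def fun_eq_iff ac_simps)
          moreover have "monomial_fun d (a' # b' # v) \<in> cfun.span (monomial_fun d ` ?T (Suc r))"
            using index_tuples_rank_less[OF less.prems(1) ab(1,3)] ab(1)
            by (rule less.hyps) (use ab sL len uv in auto)
          ultimately show "g \<in> cfun.span (monomial_fun d ` ?T (Suc r))" by simp
        qed
      qed
    qed
  qed
  obtain h t where ks: "ks = h # t" using Suc.hyps(2) by (cases ks) auto
  have "length t = r" using Suc.hyps(2) ks by simp
  then show ?case using cons[of h t] Suc.prems by (simp add: ks)
qed

section \<open>Linear independence of standard monomials\<close>

lemma digits_unique:
  fixes f g :: "nat \<Rightarrow> nat"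
  assumes "\<And>j. j < m \<Longrightarrow> f j < B" "\<And>j. j < m \<Longrightarrow> g j < B"
    and "(\<Sum>j<m. f j * B ^ j) = (\<Sum>j<m. g j * B ^ j)" and "j < m"
  shows "f j = g j"
  using assms
proof (induction m arbitrary: f g j)
  case (Suc m)
  have shift: "(\<Sum>j<Suc m. h j * B ^ j) = h 0 + B * (\<Sum>j<m. h (Suc j) * B ^ j)" for h :: "nat \<Rightarrow> nat"
    unfolding sum.lessThan_Suc_shift sum_distrib_left by (simp add: ac_simps)
  have eq: "f 0 + B * (\<Sum>j<m. f (Suc j) * B ^ j) = g 0 + B * (\<Sum>j<m. g (Suc j) * B ^ j)"
    using Suc.prems(3) by (simp only: shift)
  have less: "f 0 < B" "g 0 < B" using Suc.prems(1,2) by simp_all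
  have "f 0 = g 0" using arg_cong[OF eq, of "\<lambda>v. v mod B"] less by simp
  moreover have "(\<Sum>j<m. f (Suc j) * B ^ j) = (\<Sum>j<m. g (Suc j) * B ^ j)"
    using eq \<open>f 0 = g 0\<close> less by simp
  then have "f (Suc i) = g (Suc i)" if "i < m" for i
    using Suc.IH[of "\<lambda>j. f (Suc j)" "\<lambda>j. g (Suc j)" i] Suc.prems(1,2) that by simp
  ultimately show ?case using Suc.prems(4) by (cases j) auto
qed simp

text \<open>With the entry in row \<open>k\<close> and column \<open>v\<close> equal to \<open>t\<close> to the power \<open>B ^ (k * n + v)\<close>, the
  diagonal term of a minor has the largest exponent, and in a base \<open>B\<close> that is large enough the
  leading exponent of a standard monomial determines the monomial.\<close>

definition tuple_weight :: "nat \<Rightarrow> nat \<Rightarrow> nat \<Rightarrow> (nat \<Rightarrow> nat) \<Rightarrow> nat" where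
  "tuple_weight d n B a = (\<Sum>k=1..d. B ^ (k * n + a k))"

definition minor_poly :: "nat \<Rightarrow> nat \<Rightarrow> nat \<Rightarrow> (nat \<Rightarrow> nat) \<Rightarrow> complex poly" where
  "minor_poly d n B a =
     (\<Sum>p | p permutes {1..d}. monom (of_int (sign p)) (tuple_weight d n B (a \<circ> p)))"

lemma poly_minor_poly:
  "poly (minor_poly d n B a) t = minor d (\<lambda>k v. t ^ B ^ (k * n + v)) a"
  by (simp add: minor_poly_def minor_def ldet_def poly_sum poly_monom tuple_weight_def power_sum)

text \<open>The largest moved row \<open>m\<close> decides. Rows beyond it agree; its own column
  moves left, and the at most \<open>d\<close> lower powers cannot make up for the lost power of
  \<open>B\<close> because \<open>d < B\<close>.\<close>

lemma tuple_weight_permuted_less: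
  assumes a: "a \<in> index_tuples d n" and B: "d < B" and p: "p permutes {1..d}" "p \<noteq> id"
  shows "tuple_weight d n B (a \<circ> p) < tuple_weight d n B a"
proof -
  define K where "K = {k\<in>{1..d}. p k \<noteq> k}"
  have "K \<noteq> {}"
  proof
    assume "K = {}"
    then have "p k = k" for k using permutes_not_in[OF p(1), of k] by (auto simp: K_def)
    then show False using p(2) by auto
  qed
  define m where "m = Max K"
  have finK: "finite K" by (simp add: K_def)
  have "m \<in> K" unfolding m_def using finK \<open>K \<noteq> {}\<close> by (rule Max_in)
  then have m: "m \<in> {1..d}" "p m \<noteq> m" by (auto simp: K_def)
  have fixed: "p k = k" if "m < k" for k
  proof (rule ccontr)
    assume "p k \<noteq> k"
    then have "k \<in> K" using permutes_not_in[OF p(1), of k] by (auto simp: K_def)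
    then show False using Max_ge[OF finK, of k] that by (simp add: m_def)
  qed
  have "p m < m"
  proof (rule ccontr)
    assume "\<not> p m < m"
    then have "p (p m) = p m" using m fixed[of "p m"] by simp
    then show False using m permutes_inj[OF p(1)] by (simp add: inj_eq)
  qed
  have p_in: "p k \<in> {1..d}" if "k \<in> {1..d}" for k using permutes_in_image[OF p(1)] that by simp
  let ?e = "m * n + a m"
  have am: "1 \<le> a m" using index_tuples_range[OF a m(1)] by simp
  \<comment> \<open>Rows are \<open>n\<close> apart and columns run through
    \<open>1, ..., n\<close>, so earlier rows have exponents at most \<open>m * n\<close>, strictly
    below \<open>?e\<close> since \<open>a m >= 1\<close>.\<close>
  have exp_le: "k * n + a (p k) \<le> ?e - 1" if k: "k \<in> {1..m}" for k
  proof (cases "k = m")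
    case True
    then show ?thesis using index_tuples_less[OF a p_in[OF m(1)] m(1) \<open>p m < m\<close>] by simp
  next
    case False
    then have "Suc k \<le> m" using k by simp
    then have "Suc k * n \<le> m * n" by (rule mult_le_mono1)
    moreover have "a (p k) \<le> n" using index_tuples_range[OF a p_in, of k] k m by simp
    ultimately show ?thesis using am by simp
  qed
  have split: "{1..d} = {1..m} \<union> {m<..d}" using m by auto
  have "(\<Sum>k=1..m. B ^ (k * n + a (p k))) \<le> (\<Sum>k=1..m. B ^ (?e - 1))"
    using exp_le B by (intro sum_mono power_increasing) auto
  also have "\<dots> = m * B ^ (?e - 1)" by simp
  also have "\<dots> < B * B ^ (?e - 1)" using m B by simp
  also have "\<dots> = B ^ ?e" using am by (simp flip: power_Suc)
  also have "\<dots> \<le> (\<Sum>k=1..m. B ^ (k * n + a k))"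
    using m by (intro member_le_sum[of m "{1..m}" "\<lambda>k. B ^ (k * n + a k)"]) auto
  finally have "(\<Sum>k=1..m. B ^ (k * n + a (p k))) < (\<Sum>k=1..m. B ^ (k * n + a k))" .
  moreover have "(\<Sum>k\<in>{m<..d}. B ^ (k * n + a (p k))) = (\<Sum>k\<in>{m<..d}. B ^ (k * n + a k))"
    using fixed by (intro sum.cong) auto
  ultimately show ?thesis
    unfolding tuple_weight_def split by (subst (1 2) sum.union_disjoint) auto
qed

text \<open>The identity permutation alone attains the top exponent, with sign one, so nothing
  cancels there.\<close>

lemma minor_poly_leading:
  assumes a: "a \<in> index_tuples d n" and B: "d < B"
  shows "degree (minor_poly d n B a) = tuple_weight d n B a \<and> lead_coeff (minor_poly d n B a) = 1"
proof -
  let ?P = "{p. p permutes {1..d}}" and ?e = "tuple_weight d n B a"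
  have fin: "finite ?P" by (intro finite_permutations) simp
  have less: "tuple_weight d n B (a \<circ> p) < ?e" if "p \<in> ?P - {id}" for p
    using tuple_weight_permuted_less[OF a B] that by simp
  have "coeff (minor_poly d n B a) ?e =
      (\<Sum>p\<in>?P. if tuple_weight d n B (a \<circ> p) = ?e then of_int (sign p) else 0)"
    by (simp add: minor_poly_def coeff_sum coeff_monom)
  also have "\<dots> = (\<Sum>p\<in>?P. if p = id then 1 else 0)"
    using less by (intro sum.cong) force+
  also have "\<dots> = 1" using fin by (simp add: permutes_id)
  finally have one: "coeff (minor_poly d n B a) ?e = 1" .
  have "degree (minor_poly d n B a) \<le> ?e"
    unfolding minor_poly_def
  proof (rule degree_sum_le[OF fin])
    fix p assume "p \<in> ?P"
    then have "tuple_weight d n B (a \<circ> p) \<le> ?e" using less[of p] by (cases "p = id") auto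
    then show "degree (monom (of_int (sign p)) (tuple_weight d n B (a \<circ> p)) :: complex poly) \<le> ?e"
      using degree_monom_le order_trans by blast
  qed
  moreover have "?e \<le> degree (minor_poly d n B a)" using one by (intro le_degree) simp
  ultimately show ?thesis using one by simp
qed

definition monomial_poly :: "nat \<Rightarrow> nat \<Rightarrow> nat \<Rightarrow> (nat \<Rightarrow> nat) list \<Rightarrow> complex poly" where
  "monomial_poly d n B ks = (\<Prod>k\<leftarrow>ks. minor_poly d n B k)"

definition monomial_weight :: "nat \<Rightarrow> nat \<Rightarrow> nat \<Rightarrow> (nat \<Rightarrow> nat) list \<Rightarrow> nat" where
  "monomial_weight d n B ks = (\<Sum>k\<leftarrow>ks. tuple_weight d n B k)"

lemma poly_monomial_poly:
  "poly (monomial_poly d n B ks) t = monomial_fun d ks (\<lambda>k v. t ^ B ^ (k * n + v))"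
  by (induction ks) (simp_all add: monomial_poly_def monomial_fun_def poly_minor_poly)

lemma monomial_poly_leading:
  assumes "set ks \<subseteq> index_tuples d n" and B: "d < B"
  shows "degree (monomial_poly d n B ks) = monomial_weight d n B ks \<and>
    lead_coeff (monomial_poly d n B ks) = 1"
  using assms(1)
proof (induction ks)
  case (Cons a ks)
  let ?p = "minor_poly d n B a" and ?q = "monomial_poly d n B ks"
  have p: "degree ?p = tuple_weight d n B a" "lead_coeff ?p = 1"
    using minor_poly_leading[OF _ B, of a n] Cons.prems by (auto simp del: One_nat_def)
  have q: "degree ?q = monomial_weight d n B ks" "lead_coeff ?q = 1" using Cons by auto
  have "?p \<noteq> 0" "?q \<noteq> 0" using p(2) q(2) by auto
  then have "degree (?p * ?q) = monomial_weight d n B (a # ks)"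
    using p(1) q(1) by (simp add: degree_mult_eq monomial_weight_def)
  moreover have "lead_coeff (?p * ?q) = 1" by (simp only: lead_coeff_mult p(2) q(2)) simp
  moreover have "monomial_poly d n B (a # ks) = ?p * ?q" by (simp add: monomial_poly_def)
  ultimately show ?case by (simp only:)
qed (simp add: monomial_poly_def monomial_weight_def)

text \<open>The base-\<open>B\<close> digit of \<open>monomial_weight\<close> at place
  \<open>j\<close>, provided that no carries occur; the number itself does not involve
  \<open>B\<close>.\<close>

definition weight_digit :: "nat \<Rightarrow> nat \<Rightarrow> (nat \<Rightarrow> nat) list \<Rightarrow> nat \<Rightarrow> nat" where
  "weight_digit d n ks j = (\<Sum>k=1..d. length (filter (\<lambda>a. k * n + a k = j) ks))"

text \<open>Every place \<open>k * n + a k\<close> is at most \<open>d * n + n\<close>, which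
  explains the range of the sum.\<close>

lemma monomial_weight_digits:
  assumes "set ks \<subseteq> index_tuples d n"
  shows "monomial_weight d n B ks = (\<Sum>j<Suc d * n + 1. weight_digit d n ks j * B ^ j)"
  using assms
proof (induction ks)
  case Nil
  then show ?case by (simp add: monomial_weight_def weight_digit_def)
next
  case (Cons a ks)
  let ?m = "Suc d * n + 1"
  have less: "k * n + a k < ?m" if k: "k \<in> {1..d}" for k
  proof -
    have "k * n \<le> d * n" using k by simp
    moreover have "a k \<le> n" using index_tuples_range[of a d n, OF _ k] Cons.prems by simp
    ultimately show ?thesis unfolding mult_Suc by linarith
  qed
  have "tuple_weight d n B a = (\<Sum>k=1..d. \<Sum>j<?m. of_bool (k * n + a k = j) * B ^ j)"
    unfolding tuple_weight_def
  proof (rule sum.cong)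
    fix k assume "k \<in> {1..d}"
    then show "B ^ (k * n + a k) = (\<Sum>j<?m. of_bool (k * n + a k = j) * B ^ j)"
      using less[of k] by (simp add: of_bool_def if_distrib[of "\<lambda>v. v * _"] sum.delta cong: if_cong)
  qed simp
  also have "\<dots> = (\<Sum>j<?m. (\<Sum>k=1..d. of_bool (k * n + a k = j)) * B ^ j)"
    unfolding sum_distrib_right by (rule sum.swap)
  finally have "tuple_weight d n B a = (\<Sum>j<?m. (\<Sum>k=1..d. of_bool (k * n + a k = j)) * B ^ j)" .
  moreover have "weight_digit d n (a # ks) j =
      (\<Sum>k=1..d. of_bool (k * n + a k = j)) + weight_digit d n ks j" for j
    unfolding weight_digit_def sum.distrib[symmetric] by (intro sum.cong) auto
  moreover have "monomial_weight d n B (a # ks) = tuple_weight d n B a + monomial_weight d n B ks"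
    by (simp add: monomial_weight_def)
  ultimately show ?case using Cons by (simp only: distrib_right sum.distrib) simp
qed

text \<open>For \<open>v\<close> between \<open>1\<close> and \<open>n\<close> the place
  \<open>k * n + v\<close> determines both \<open>k\<close> and \<open>v\<close>, so a digit is a
  multiplicity in a single column.\<close>

lemma weight_digit_eq:
  assumes ks: "set ks \<subseteq> index_tuples d n" and k: "k \<in> {1..d}" and v: "v \<in> {1..n}"
  shows "weight_digit d n ks (k * n + v) = length (filter (\<lambda>a. a k = v) ks)"
proof -
  have zero: "filter (\<lambda>a. i * n + a i = k * n + v) ks = []" if i: "i \<in> {1..d}" "i \<noteq> k" for i
  proof -
    have "i * n + a i \<noteq> k * n + v" if "a \<in> set ks" for a
    proof -
      have ai: "1 \<le> a i" "a i \<le> n" using index_tuples_range[of a d n i] ks that i by auto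
      consider "Suc i \<le> k" | "Suc k \<le> i" using i by linarith
      then show ?thesis
      proof cases
        case 1
        then have "Suc i * n \<le> k * n" by (rule mult_le_mono1)
        then show ?thesis using ai v by simp
      next
        case 2
        then have "Suc k * n \<le> i * n" by (rule mult_le_mono1)
        then show ?thesis using ai v by simp
      qed
    qed
    then show ?thesis by (simp add: filter_empty_conv)
  qed
  have "weight_digit d n ks (k * n + v) =
      (\<Sum>i=1..d. if i = k then length (filter (\<lambda>a. a k = v) ks) else 0)"
    unfolding weight_digit_def using zero by (intro sum.cong) auto
  then show ?thesis using k by simp
qed

lemma sorted_desc_unique:
  fixes xs ys :: "nat list"
  assumes "sorted_wrt (\<ge>) xs" "sorted_wrt (\<ge>) ys" "mset xs = mset ys"
  shows "xs = ys"
proof -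
  have "sorted (rev xs)" "sorted (rev ys)" using assms by (simp_all add: sorted_wrt_rev)
  then have "rev xs = rev ys" using assms(3) by (metis mset_rev properties_for_sort)
  then show ?thesis by simp
qed

text \<open>The bound on \<open>B\<close> rules out carries, so the weight reveals how often each
  value occurs at each position. In a multichain the entries at one position decrease weakly along
  the list, hence their multiset determines their order.\<close>

lemma monomial_weight_inj:
  assumes d: "1 \<le> d" and ks: "ks \<in> multichains (index_tuples d n)" "d * length ks < B"
    and ls: "ls \<in> multichains (index_tuples d n)" "d * length ls < B"
    and eq: "monomial_weight d n B ks = monomial_weight d n B ls"
  shows "ks = ls"
proof -
  have sub: "set ks \<subseteq> index_tuples d n" "set ls \<subseteq> index_tuples d n"
    and sorted: "sorted_wrt (\<ge>) ks" "sorted_wrt (\<ge>) ls"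
    using ks ls by (auto simp: multichains_def)
  have small: "weight_digit d n xs j < B" if "d * length xs < B" for xs j
  proof -
    have "weight_digit d n xs j \<le> (\<Sum>k=1..d. length xs)"
      unfolding weight_digit_def by (intro sum_mono) simp
    then show ?thesis using that by simp
  qed
  have digit: "weight_digit d n ks j = weight_digit d n ls j" if "j < Suc d * n + 1" for j
    using digits_unique[OF small[OF ks(2)] small[OF ls(2)] _ that]
      eq monomial_weight_digits[OF sub(1)] monomial_weight_digits[OF sub(2)] by simp
  have columns: "map (\<lambda>a. a k) ks = map (\<lambda>a. a k) ls" if k: "k \<in> {1..d}" for k
  proof (rule sorted_desc_unique)
    have "count (mset (map (\<lambda>a. a k) xs)) v = length (filter (\<lambda>a. a k = v) xs)"
      for xs :: "(nat \<Rightarrow> nat) list" and v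
      by (induction xs) auto
    moreover have "length (filter (\<lambda>a. a k = v) ks) = length (filter (\<lambda>a. a k = v) ls)" for v
    proof (cases "v \<in> {1..n}")
      case True
      have "k * n \<le> d * n" using k by simp
      moreover have "v \<le> n" using True by simp
      ultimately have "k * n + v < Suc d * n + 1" unfolding mult_Suc by linarith
      then show ?thesis
        using digit weight_digit_eq[OF sub(1) k True] weight_digit_eq[OF sub(2) k True] by metis
    next
      case False
      have "filter (\<lambda>a. a k = v) xs = []" if "set xs \<subseteq> index_tuples d n" for xs
        using False index_tuples_range[OF _ k] that by (fastforce simp: filter_empty_conv)
      then show ?thesis using sub by simp
    qed
    ultimately show "mset (map (\<lambda>a. a k) ks) = mset (map (\<lambda>a. a k) ls)"
      by (intro multiset_eqI) simp
  next
    show "sorted_wrt (\<ge>) (map (\<lambda>a. a k) ks)" "sorted_wrt (\<ge>) (map (\<lambda>a. a k) ls)"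
      using sorted by (auto simp: sorted_wrt_map le_fun_def elim: sorted_wrt_mono_rel[rotated])
  qed
  \<comment> \<open>Position \<open>1\<close> exists because \<open>d >= 1\<close>; its entries
    recover the length.\<close>
  have len: "length ks = length ls" using arg_cong[OF columns[of 1], of length] d by simp
  show ?thesis
  proof (rule nth_equalityI[OF len])
    fix i assume i: "i < length ks"
    show "ks ! i = ls ! i"
    proof (rule index_tuples_eqI[of _ d n])
      show "ks ! i \<in> index_tuples d n" "ls ! i \<in> index_tuples d n"
        using sub i len nth_mem by (metis subsetD)+
      fix k assume "k \<in> {1..d}"
      then show "(ks ! i) k = (ls ! i) k"
        using arg_cong[OF columns[of k], of "\<lambda>xs. xs ! i"] i len by simp
    qed
  qed
qed

section \<open>Coefficients from leading exponents\<close>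

text \<open>Monic polynomials of distinct degrees cannot cancel at the largest degree that occurs.
  So this degree is visible in \<open>Q\<close>, and every coefficient at \<open>degree Q\<close> is
  the leading coefficient of \<open>Q\<close>.\<close>

lemma triangular_combination:
  fixes P :: "'t \<Rightarrow> complex poly"
  assumes T: "finite T" and inj: "inj_on E T"
    and P: "\<And>t. t \<in> T \<Longrightarrow> degree (P t) = E t \<and> lead_coeff (P t) = 1"
    and Q: "Q = (\<Sum>t\<in>T. smult (a t) (P t))" and t: "t \<in> T"
  shows "a t \<noteq> 0 \<Longrightarrow> E t \<le> degree Q" and "E t = degree Q \<Longrightarrow> a t = lead_coeff Q"
proof -
  have coeff: "coeff Q (E s) = a s"
    if s: "s \<in> T" and high: "\<And>u. u \<in> T \<Longrightarrow> a u \<noteq> 0 \<Longrightarrow> E u \<le> E s" for s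
  proof -
    have "coeff Q (E s) = (\<Sum>u\<in>T. a u * coeff (P u) (E s))" by (simp add: Q coeff_sum)
    also have "\<dots> = (\<Sum>u\<in>T. if u = s then a s else 0)"
    proof (rule sum.cong)
      fix u assume u: "u \<in> T"
      show "a u * coeff (P u) (E s) = (if u = s then a s else 0)"
      proof (cases "u = s \<or> a u = 0")
        case True
        then show ?thesis using P[OF s] by auto
      next
        case False
        then have "E u < E s" using high[OF u] inj u s by (auto simp: inj_on_def order_le_less)
        then have "coeff (P u) (E s) = 0" using P[OF u] by (intro coeff_eq_0) simp
        then show ?thesis using False by simp
      qed
    qed simp
    also have "\<dots> = a s" using T s by simp
    finally show ?thesis .
  qed
  have le: "E u \<le> degree Q" if u: "u \<in> T" "a u \<noteq> 0" for u
  proof -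
    let ?T = "{s\<in>T. a s \<noteq> 0}"
    have "finite (E ` ?T)" "E ` ?T \<noteq> {}" using T u by auto
    from Max_in[OF this] obtain s where s: "s \<in> ?T" "E s = Max (E ` ?T)" by auto
    have high: "E v \<le> E s" if "v \<in> T" "a v \<noteq> 0" for v
      unfolding s(2) using T that by (intro Max_ge) auto
    have "coeff Q (E s) = a s" using coeff[of s] s(1) high by simp
    then have "E s \<le> degree Q" using s(1) by (intro le_degree) simp
    then show ?thesis using high[OF u] by simp
  qed
  show "a t \<noteq> 0 \<Longrightarrow> E t \<le> degree Q" using le t by simp
  show "a t = lead_coeff Q" if "E t = degree Q" using coeff[OF t] le that by simp
qed

lemma monomial_relation_poly:
  assumes d: "1 \<le> d" and T: "finite T" "T \<subseteq> multichains (index_tuples d n)"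
  obtains B where "d < B" "inj_on (monomial_weight d n B) T"
    "\<And>t. t \<in> T \<Longrightarrow> degree (monomial_poly d n B t) = monomial_weight d n B t \<and>
      lead_coeff (monomial_poly d n B t) = 1"
proof -
  \<comment> \<open>Large enough for the diagonal term of each minor to lead, and to prevent carries
    for every monomial in \<open>T\<close>.\<close>
  define B where "B = Suc (d + (\<Sum>t\<in>T. d * length t))"
  have "d * length t < B" if "t \<in> T" for t
    using member_le_sum[OF that, of "\<lambda>t. d * length t"] T(1) by (simp add: B_def)
  then have "inj_on (monomial_weight d n B) T"
    using T monomial_weight_inj[OF d] by (intro inj_onI) blast
  moreover have dB: "d < B" by (simp add: B_def)
  moreover have "set t \<subseteq> index_tuples d n" if "t \<in> T" for t
    using T(2) that by (auto simp: multichains_def)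
  ultimately show ?thesis using that monomial_poly_leading[OF _ dB] by blast
qed

lemma monomial_fun_independent:
  assumes d: "1 \<le> d" and T: "finite T" "T \<subseteq> multichains (index_tuples d n)"
    and zero: "\<And>w. (\<Sum>t\<in>T. a t * monomial_fun d t w) = 0" and t: "t \<in> T"
  shows "a t = 0"
proof -
  obtain B where B: "d < B" "inj_on (monomial_weight d n B) T"
    "\<And>t. t \<in> T \<Longrightarrow> degree (monomial_poly d n B t) = monomial_weight d n B t \<and>
      lead_coeff (monomial_poly d n B t) = 1"
    using monomial_relation_poly[OF d T] by metis
  have "poly (\<Sum>t\<in>T. smult (a t) (monomial_poly d n B t)) z = 0" for z
    using zero by (simp add: poly_sum poly_monomial_poly)
  then have Q: "0 = (\<Sum>t\<in>T. smult (a t) (monomial_poly d n B t))" using poly_all_0_iff_0 by metis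
  \<comment> \<open>For the zero polynomial the first part forces a nonzero \<open>a t\<close> to
    have weight zero, which is \<open>degree 0\<close>; the second part then equates
    \<open>a t\<close> with the leading coefficient of zero.\<close>
  note triangular_combination[OF T(1) B(2,3) Q t]
  then show ?thesis by auto
qed

text \<open>At each position join and meet carry the same two entries as \<open>l1\<close> and
  \<open>l2\<close>, so both products have the same leading exponent, and both are monic.\<close>

lemma monomial_fun_leading_coefficient:
  assumes d: "1 \<le> d" and T: "finite T" "T \<subseteq> multichains (index_tuples d n)"
    and l: "l1 \<in> index_tuples d n" "l2 \<in> index_tuples d n"
    and eq: "\<And>w. monomial_fun d [l1, l2] w = (\<Sum>t\<in>T. a t * monomial_fun d t w)"
    and t: "[sup l1 l2, inf l1 l2] \<in> T"
  shows "a [sup l1 l2, inf l1 l2] = 1"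
proof -
  obtain B where B: "d < B" "inj_on (monomial_weight d n B) T"
    "\<And>t. t \<in> T \<Longrightarrow> degree (monomial_poly d n B t) = monomial_weight d n B t \<and>
      lead_coeff (monomial_poly d n B t) = 1"
    using monomial_relation_poly[OF d T] by metis
  have "poly (monomial_poly d n B [l1, l2]) z = poly (\<Sum>t\<in>T. smult (a t) (monomial_poly d n B t)) z" for z
    using eq by (simp add: poly_sum poly_monomial_poly)
  then have Q: "monomial_poly d n B [l1, l2] = (\<Sum>t\<in>T. smult (a t) (monomial_poly d n B t))"
    by (intro poly_ext)
  have "set [l1, l2] \<subseteq> index_tuples d n" using l by simp
  then have lead: "degree (monomial_poly d n B [l1, l2]) = monomial_weight d n B [l1, l2]"
    "lead_coeff (monomial_poly d n B [l1, l2]) = 1"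
    using monomial_poly_leading[OF _ B(1)] by blast+
  have "B ^ (k * n + sup l1 l2 k) + B ^ (k * n + inf l1 l2 k) = B ^ (k * n + l1 k) + B ^ (k * n + l2 k)" for k
    by (simp add: sup_nat_def inf_nat_def max_def min_def)
  then have "monomial_weight d n B [sup l1 l2, inf l1 l2] = monomial_weight d n B [l1, l2]"
    by (simp add: monomial_weight_def tuple_weight_def del: sup_apply inf_apply flip: sum.distrib)
  then show ?thesis using triangular_combination(2)[OF T(1) B(2,3) Q t] lead by simp
qed

section \<open>The cone over the Grassmann variety\<close>

text \<open>A scalar is absorbed into the first row, so a multiple of a wedge product is again
  one.\<close>

lemma wedge_scale:
  assumes d: "1 \<le> d"
  shows "cscale c (wedge d n w) = wedge d n (\<lambda>k v. if k = 1 then c * w k v else w k v)"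
proof
  fix i
  show "cscale c (wedge d n w) i = wedge d n (\<lambda>k v. if k = 1 then c * w k v else w k v) i"
  proof (cases "i \<in> index_tuples d n")
    case True
    then show ?thesis
      using ldet_scale_row[of "{1..d}" 1 c "\<lambda>k j. w k (i j)"] d
      by (simp add: wedge_eq_minor minor_def cscale_def)
  qed (simp add: wedge_def cscale_def)
qed

text \<open>Take \<open>b\<close> to be a basis of \<open>W\<close>: passing to other vectors of
  \<open>W\<close> multiplies all minors by the same determinant of coordinates.\<close>

lemma wedge_in_subspace:
  assumes W: "cfun.subspace W" "cfun.dim W = d" and d: "1 \<le> d"
  obtains b where "\<And>w. (\<And>k. k \<in> {1..d} \<Longrightarrow> w k \<in> W) \<Longrightarrow> \<exists>c. wedge d n w = cscale c (wedge d n b)"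
proof -
  obtain B where B: "B \<subseteq> W" "cfun.independent B" "W \<subseteq> cfun.span B" "card B = d"
    using cfun.basis_exists[of W] W(2) by metis
  have finB: "finite B" using B(4) d card.infinite by fastforce
  obtain b where b: "bij_betw b {1..d} B" using ex_bij_betw_nat_finite_1[OF finB] B(4) by auto
  have "\<exists>c. wedge d n w = cscale c (wedge d n b)" if w: "\<And>k. k \<in> {1..d} \<Longrightarrow> w k \<in> W" for w
  proof -
    have "\<exists>x. w k = (\<Sum>j\<in>{1..d}. cscale (x j) (b j))" if "k \<in> {1..d}" for k
    proof -
      have "w k \<in> cfun.span B" using w[OF that] B(3) by blast
      then obtain u where "w k = (\<Sum>v\<in>B. cscale (u v) v)" by (auto simp: cfun.span_finite[OF finB])
      also have "\<dots> = (\<Sum>j\<in>{1..d}. cscale (u (b j)) (b j))" by (rule sum.reindex_bij_betw[OF b, symmetric])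
      finally show ?thesis by (intro exI[of _ "\<lambda>j. u (b j)"]) simp
    qed
    then obtain X where X: "\<And>k. k \<in> {1..d} \<Longrightarrow> w k = (\<Sum>j\<in>{1..d}. cscale (X k j) (b j))" by metis
    have entry: "w k v = (\<Sum>j\<in>{1..d}. X k j * b j v)" if "k \<in> {1..d}" for k v
      using X[OF that] sum_fun_apply[of "\<lambda>j. cscale (X k j) (b j)" "{1..d}" v] by (simp add: cscale_def)
    obtain c where c: "\<And>N. ldet {1..d} (\<lambda>k l. \<Sum>j\<in>{1..d}. X k j * N j l) = c * ldet {1..d} N"
      using ldet_row_combination[of "{1..d}" X] by blast
    have "minor d w i = c * minor d b i" for i
    proof -
      have "minor d w i = ldet {1..d} (\<lambda>k l. \<Sum>j\<in>{1..d}. X k j * b j (i l))"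
        unfolding minor_def using entry by (intro ldet_cong) auto
      then show ?thesis using c[of "\<lambda>k l. b k (i l)"] by (simp add: minor_def)
    qed
    then have "wedge d n w i = c * wedge d n b i" for i
      by (cases "i \<in> index_tuples d n") (simp_all add: wedge_eq_minor, simp add: wedge_def)
    then show ?thesis by (auto simp: cscale_def fun_eq_iff)
  qed
  then show ?thesis using that by blast
qed

lemma grassmannian_cone_wedge:
  assumes d: "1 \<le> d" and l: "l \<in> grassmannian d n" and x: "x \<in> l"
  obtains w where "x = wedge d n w"
proof -
  obtain W where W: "cfun.subspace W" "cfun.dim W = d" and l_eq: "l = pluecker_embedding d n W"
    using l by (auto simp: grassmannian_def)
  obtain b where b: "\<And>w. (\<And>k. k \<in> {1..d} \<Longrightarrow> w k \<in> W) \<Longrightarrow> \<exists>c. wedge d n w = cscale c (wedge d n b)"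
    using wedge_in_subspace[OF W d] by metis
  have "{wedge d n w | w. \<forall>k\<in>{1..d}. w k \<in> W} \<subseteq> cfun.span {wedge d n b}"
    using b by (force simp: cfun.span_singleton)
  then have "l \<subseteq> cfun.span {wedge d n b}"
    unfolding l_eq pluecker_embedding_def by (rule cfun.span_minimal) (rule cfun.subspace_span)
  then obtain c where "x = cscale c (wedge d n b)" using x by (auto simp: cfun.span_singleton)
  then show ?thesis using that wedge_scale[OF d] by metis
qed

section \<open>Every wedge product lies on a line of the Grassmannian\<close>

definition unit_vector :: "nat \<Rightarrow> nat \<Rightarrow> complex" where
  "unit_vector v = (\<lambda>u. if u = v then 1 else 0)"

lemma unit_vector_combination:
  assumes "finite A"
  shows "(\<Sum>v\<in>A. cscale (c v) (unit_vector v)) = (\<lambda>u. if u \<in> A then c u else 0)"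
proof
  fix u
  have "(\<Sum>v\<in>A. cscale (c v) (unit_vector v)) u = (\<Sum>v\<in>A. if v = u then c u else 0)"
    unfolding sum_fun_apply by (intro sum.cong) (auto simp: cscale_def unit_vector_def)
  then show "(\<Sum>v\<in>A. cscale (c v) (unit_vector v)) u = (if u \<in> A then c u else 0)"
    using assms by simp
qed

lemma inj_unit_vector: "inj unit_vector"
  by (rule injI) (metis unit_vector_def zero_neq_one)

lemma independent_unit_vectors:
  assumes A: "finite A"
  shows "cfun.independent (unit_vector ` A)"
proof (rule cfun.independent_if_scalars_zero)
  fix f x assume sum: "(\<Sum>x\<in>unit_vector ` A. cscale (f x) x) = 0" and x: "x \<in> unit_vector ` A"
  then obtain v where v: "v \<in> A" "x = unit_vector v" by blast
  have "(\<Sum>v\<in>A. cscale (f (unit_vector v)) (unit_vector v)) = 0"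
    using sum inj_unit_vector by (simp add: sum.reindex inj_on_subset)
  then have "(\<lambda>u. if u \<in> A then f (unit_vector u) else 0) = (\<lambda>u. 0)"
    by (simp add: unit_vector_combination[OF A] zero_fun_def)
  then show "f x = 0" using v fun_cong[of _ _ v] by fastforce
qed (use A in simp)

lemma subspace_coord_space: "cfun.subspace (coord_space V)"
  by (auto simp: cfun.subspace_def coord_space_def cscale_def)

text \<open>The rows may be dependent and their wedge product zero. They still lie in some subspace
  of dimension exactly \<open>d\<close>, obtained by enlarging an independent subset of the rows,
  and there is room for it because \<open>d <= n\<close>.\<close>

lemma wedge_in_grassmannian_cone:
  assumes d: "d \<le> n"
  obtains l where "l \<in> grassmannian d n" "wedge d n w \<in> l"
proof -
  let ?U = "unit_vector ` {1..n}"
  \<comment> \<open>A wedge product sees only columns in \<open>{1..n}\<close>; truncating moves the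
    rows into \<open>coord_space\<close>.\<close>
  define w' where "w' = (\<lambda>k v. if v \<in> {1..n} then w k v else 0)"
  have w'_coord: "w' ` {1..d} \<subseteq> coord_space {1..n}" by (auto simp: w'_def coord_space_def)
  have "wedge d n w i = wedge d n w' i" for i
  proof (cases "i \<in> index_tuples d n")
    case True
    have "minor d w i = minor d w' i"
      unfolding minor_def using index_tuples_range[OF True] by (intro ldet_cong) (auto simp: w'_def)
    then show ?thesis using True by (simp add: wedge_eq_minor)
  qed (simp add: wedge_def)
  then have w_eq: "wedge d n w = wedge d n w'" by blast
  obtain B0 where B0: "B0 \<subseteq> w' ` {1..d}" "cfun.independent B0" "w' ` {1..d} \<subseteq> cfun.span B0"
    using cfun.maximal_independent_subset by blast
  have "card B0 \<le> card (w' ` {1..d})" using B0(1) by (intro card_mono) auto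
  also have "\<dots> \<le> d" using card_image_le[of "{1..d}" w'] by simp
  finally have card_B0: "card B0 \<le> d" .
  have "B0 \<subseteq> coord_space {1..n}" using B0(1) w'_coord by blast
  then obtain B where B: "B0 \<subseteq> B" "B \<subseteq> coord_space {1..n}" "cfun.independent B"
      "coord_space {1..n} \<subseteq> cfun.span B"
    using cfun.maximal_independent_subset_extend[OF _ B0(2)] by blast
  have U_span: "coord_space {1..n} \<subseteq> cfun.span ?U"
  proof
    fix x assume x: "x \<in> coord_space {1..n}"
    have "(\<Sum>v\<in>{1..n}. cscale (x v) (unit_vector v)) = x"
      unfolding unit_vector_combination[OF finite_atLeastAtMost]
      using x by (auto simp: coord_space_def fun_eq_iff)
    moreover have "(\<Sum>v\<in>{1..n}. cscale (x v) (unit_vector v)) \<in> cfun.span ?U"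
      by (intro cfun.span_sum cfun.span_scale cfun.span_base) auto
    ultimately show "x \<in> cfun.span ?U" by simp
  qed
  have U_coord: "?U \<subseteq> coord_space {1..n}" by (auto simp: unit_vector_def coord_space_def)
  have finB: "finite B"
    using cfun.independent_span_bound[OF _ B(3), of ?U] B(2) U_span by auto
  have "card ?U \<le> card B"
    using cfun.independent_span_bound[OF finB independent_unit_vectors, of "{1..n}"] U_coord B(4) by auto
  then have "d \<le> card B" using d inj_unit_vector by (simp add: card_image inj_on_subset)
  then obtain C where C: "B0 \<subseteq> C" "C \<subseteq> B" "card C = d"
    using exists_subset_between[OF card_B0 _ B(1) finB] by blast
  let ?W = "cfun.span C"
  have "cfun.independent C" using B(3) C(2) by (rule cfun.independent_mono)
  then have "cfun.dim ?W = card C" by (rule cfun.dim_span_eq_card_independent)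
  then have "cfun.dim ?W = d" by (simp only: C(3))
  moreover have "?W \<subseteq> coord_space {1..n}"
    using C(2) B(2) by (intro cfun.span_minimal subspace_coord_space) auto
  ultimately have "pluecker_embedding d n ?W \<in> grassmannian d n"
    unfolding grassmannian_def using cfun.subspace_span by blast
  moreover have "\<forall>k\<in>{1..d}. w' k \<in> ?W" using B0(3) cfun.span_mono[OF C(1)] by blast
  then have "wedge d n w \<in> pluecker_embedding d n ?W"
    unfolding pluecker_embedding_def w_eq by (intro cfun.span_base) blast
  ultimately show ?thesis using that by blast
qed

section \<open>Polynomials on the cone\<close>

definition eval_monom :: "('v \<Rightarrow> complex) \<Rightarrow> ('v \<Rightarrow>\<^sub>0 nat) \<Rightarrow> complex" where
  "eval_monom x m = (\<Prod>v\<in>Poly_Mapping.keys m. x v ^ Poly_Mapping.lookup m v)"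

lemma eval_monom_superset:
  assumes "finite S" "Poly_Mapping.keys m \<subseteq> S"
  shows "eval_monom x m = (\<Prod>v\<in>S. x v ^ Poly_Mapping.lookup m v)"
  unfolding eval_monom_def using assms by (intro prod.mono_neutral_left) (auto simp: in_keys_iff)

lemma eval_monom_add: "eval_monom x (m + m') = eval_monom x m * eval_monom x m'"
proof -
  let ?S = "Poly_Mapping.keys m \<union> Poly_Mapping.keys m'"
  have "eval_monom x (m + m') = (\<Prod>v\<in>?S. x v ^ Poly_Mapping.lookup (m + m') v)"
    by (intro eval_monom_superset Poly_Mapping.keys_add) simp
  also have "\<dots> = (\<Prod>v\<in>?S. x v ^ Poly_Mapping.lookup m v) * (\<Prod>v\<in>?S. x v ^ Poly_Mapping.lookup m' v)"
    by (simp add: lookup_add power_add prod.distrib)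
  also have "\<dots> = eval_monom x m * eval_monom x m'"
    by (simp add: eval_monom_superset[of ?S])
  finally show ?thesis .
qed

lemma mp_eval_alt: "mp_eval x f = (\<Sum>m\<in>Poly_Mapping.keys f. Poly_Mapping.lookup f m * eval_monom x m)"
  by (simp add: mp_eval_def eval_monom_def)

lemma mp_eval_add: "mp_eval x (f + g) = mp_eval x f + mp_eval x g"
  unfolding mp_eval_alt by (rule setsum_keys_plus_distrib) (auto simp: distrib_right)

lemma mp_eval_zero: "mp_eval x 0 = 0"
  by (simp add: mp_eval_alt)

lemma mp_eval_uminus: "mp_eval x (- f) = - mp_eval x f"
  using mp_eval_add[of x f "- f"] by (simp add: mp_eval_zero eq_neg_iff_add_eq_0 add.commute)

lemma mp_eval_diff: "mp_eval x (f - g) = mp_eval x f - mp_eval x g"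
  using mp_eval_add[of x f "- g"] by (simp add: mp_eval_uminus)

lemma mp_eval_sum: "mp_eval x (\<Sum>i\<in>A. f i) = (\<Sum>i\<in>A. mp_eval x (f i))"
  by (induction A rule: infinite_finite_induct) (simp_all add: mp_eval_zero mp_eval_add)

lemma mp_eval_single: "mp_eval x (Poly_Mapping.single m c) = c * eval_monom x m"
  by (simp add: mp_eval_alt)

lemma poly_mapping_sum_single:
  fixes f :: "'v \<Rightarrow>\<^sub>0 'b::comm_monoid_add"
  shows "f = (\<Sum>m\<in>Poly_Mapping.keys f. Poly_Mapping.single m (Poly_Mapping.lookup f m))"
proof (rule poly_mapping_eqI)
  fix k
  have "Poly_Mapping.lookup (\<Sum>m\<in>Poly_Mapping.keys f. Poly_Mapping.single m (Poly_Mapping.lookup f m)) k =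
      (\<Sum>m\<in>Poly_Mapping.keys f. if m = k then Poly_Mapping.lookup f k else 0)"
    unfolding lookup_sum by (intro sum.cong) (auto simp: lookup_single when_def)
  then show "Poly_Mapping.lookup f k =
      Poly_Mapping.lookup (\<Sum>m\<in>Poly_Mapping.keys f. Poly_Mapping.single m (Poly_Mapping.lookup f m)) k"
    by (simp add: in_keys_iff)
qed

lemma mp_eval_mult: "mp_eval x (f * g) = mp_eval x f * mp_eval x g"
proof -
  let ?s = "\<lambda>f m. Poly_Mapping.single m (Poly_Mapping.lookup f m)"
  have "f * g = (\<Sum>m\<in>Poly_Mapping.keys f. ?s f m) * (\<Sum>m\<in>Poly_Mapping.keys g. ?s g m)"
    by (rule arg_cong2[where f = "(*)"]) (rule poly_mapping_sum_single)+
  then have "mp_eval x (f * g) =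
      (\<Sum>m\<in>Poly_Mapping.keys f. \<Sum>m'\<in>Poly_Mapping.keys g. mp_eval x (?s f m * ?s g m'))"
    by (simp only: sum_product mp_eval_sum)
  also have "\<dots> = (\<Sum>m\<in>Poly_Mapping.keys f. \<Sum>m'\<in>Poly_Mapping.keys g.
      (Poly_Mapping.lookup f m * eval_monom x m) * (Poly_Mapping.lookup g m' * eval_monom x m'))"
    by (simp only: mult_single mp_eval_single eval_monom_add) (simp only: ac_simps)
  finally show ?thesis by (simp only: mp_eval_alt sum_product)
qed

lemma mp_eval_const: "mp_eval x (mp_const c) = c"
  by (simp add: mp_const_def mp_eval_single eval_monom_def)

lemma mp_eval_var: "mp_eval x (mp_var v) = x v"
  by (simp add: mp_var_def mp_eval_single eval_monom_def)

section \<open>The homogeneous coordinate ring\<close>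

text \<open>Coefficients are indexed by \<open>S\<close> rather than by vectors, matching
  \<open>basis_family\<close>. As \<open>b\<close> may repeat vectors, one preimage is chosen for
  each vector used.\<close>

lemma (in vector_space) span_image_family:
  assumes "x \<in> span (b ` S)"
  obtains a where "finite {t. a t \<noteq> 0}" "{t. a t \<noteq> 0} \<subseteq> S" "x = (\<Sum>t | a t \<noteq> 0. scale (a t) (b t))"
proof -
  obtain T r where T: "finite T" "T \<subseteq> b ` S" "x = (\<Sum>v\<in>T. scale (r v) v)"
    using assms unfolding span_explicit by blast
  obtain U where U: "U \<subseteq> S" "inj_on b U" "T = b ` U" using T(2) unfolding subset_image_inj by blast
  have finU: "finite U" using T(1) U by (simp add: finite_image_iff)
  define a where "a = (\<lambda>t. if t \<in> U then r (b t) else 0)"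
  have "x = (\<Sum>t\<in>U. scale (a t) (b t))" by (simp add: T(3) U(3) sum.reindex[OF U(2)] a_def)
  also have "\<dots> = (\<Sum>t | a t \<noteq> 0. scale (a t) (b t))"
    using finU by (intro sum.mono_neutral_right) (auto simp: a_def split: if_splits)
  finally have "x = (\<Sum>t | a t \<noteq> 0. scale (a t) (b t))" .
  moreover have "{t. a t \<noteq> 0} \<subseteq> U" by (auto simp: a_def split: if_splits)
  ultimately show ?thesis
    using that[of a] finite_subset[OF _ finU] U(1) subset_trans by blast
qed

lemma poly_ring_simps:
  "mult (poly_ring V) = (*)" "add (poly_ring V) = (+)" "one (poly_ring V) = 1" "zero (poly_ring V) = 0"
  by (simp_all add: poly_ring_def)

lemma poly_ring_add: "f \<in> carrier (poly_ring V) \<Longrightarrow> g \<in> carrier (poly_ring V) \<Longrightarrow> f + g \<in> carrier (poly_ring V)"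
  using abelian_monoid.a_closed[of "poly_ring V" f g] cring_poly_ring[of V]
  by (simp add: poly_ring_simps cring_def ring_def abelian_group_def)

lemma poly_ring_mult: "f \<in> carrier (poly_ring V) \<Longrightarrow> g \<in> carrier (poly_ring V) \<Longrightarrow> f * g \<in> carrier (poly_ring V)"
  using monoid.m_closed[of "poly_ring V" f g] cring_poly_ring[of V]
  by (simp add: poly_ring_simps cring_def ring_def)

lemma poly_ring_uminus: "f \<in> carrier (poly_ring V) \<Longrightarrow> - f \<in> carrier (poly_ring V)"
  by (simp add: poly_ring_def)

lemma poly_ring_zero: "0 \<in> carrier (poly_ring V)"
  by (simp add: poly_ring_def)

lemma poly_ring_one: "1 \<in> carrier (poly_ring V)"
  by (simp add: poly_ring_def)

lemma poly_ring_diff: "f \<in> carrier (poly_ring V) \<Longrightarrow> g \<in> carrier (poly_ring V) \<Longrightarrow> f - g \<in> carrier (poly_ring V)"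
  using poly_ring_add[OF _ poly_ring_uminus, of f V g] by simp

lemma poly_ring_const: "mp_const c \<in> carrier (poly_ring V)"
  by (simp add: poly_ring_def mp_const_def)

lemma poly_ring_var: "v \<in> V \<Longrightarrow> mp_var v \<in> carrier (poly_ring V)"
  by (simp add: poly_ring_def mp_var_def)

lemma poly_ring_sum: "(\<And>i. i \<in> A \<Longrightarrow> f i \<in> carrier (poly_ring V)) \<Longrightarrow> (\<Sum>i\<in>A. f i) \<in> carrier (poly_ring V)"
  by (induction A rule: infinite_finite_induct) (auto simp: poly_ring_zero poly_ring_add)

lemma poly_ring_a_inv:
  assumes "g \<in> carrier (poly_ring V)"
  shows "\<ominus>\<^bsub>poly_ring V\<^esub> g = - g"
proof -
  interpret cring "poly_ring V" by (rule cring_poly_ring)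
  show ?thesis using assms by (intro minus_equality) (simp_all add: poly_ring_simps poly_ring_uminus)
qed

lemma poly_ring_minus: "g \<in> carrier (poly_ring V) \<Longrightarrow> f \<ominus>\<^bsub>poly_ring V\<^esub> g = f - g"
  by (simp add: a_minus_def poly_ring_a_inv poly_ring_simps)

lemma ideal_vanishing_ideal: "ideal (vanishing_ideal V X) (poly_ring V)"
  unfolding vanishing_ideal_def
  by (intro ring.genideal_ideal cring.axioms(1) cring_poly_ring) auto

lemma vanishing_ideal_add:
  "f \<in> vanishing_ideal V X \<Longrightarrow> g \<in> vanishing_ideal V X \<Longrightarrow> f + g \<in> vanishing_ideal V X"
  using additive_subgroup.a_closed[OF ideal.axioms(1)[OF ideal_vanishing_ideal], of f V X g]
  by (simp add: poly_ring_simps)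

lemma vanishing_ideal_zero: "0 \<in> vanishing_ideal V X"
  using additive_subgroup.zero_closed[OF ideal.axioms(1)[OF ideal_vanishing_ideal], of V X]
  by (simp add: poly_ring_simps)

lemma vanishing_ideal_mult:
  "f \<in> vanishing_ideal V X \<Longrightarrow> g \<in> carrier (poly_ring V) \<Longrightarrow> g * f \<in> vanishing_ideal V X"
  using ideal.I_l_closed[OF ideal_vanishing_ideal, of f V X g] by (simp add: poly_ring_simps)

lemma hom_coord_ring_carrier:
  "carrier (hom_coord_ring V X) = hom_class V X ` carrier (poly_ring V)"
  by (auto simp: hom_coord_ring_def hom_class_def FactRing_def A_RCOSETS_def')

lemma hom_coord_ring_zero: "\<zero>\<^bsub>hom_coord_ring V X\<^esub> = hom_class V X 0"
  using ring.a_rcos_zero[OF _ ideal_vanishing_ideal vanishing_ideal_zero, of V X] cring_poly_ring[of V]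
  by (simp add: hom_coord_ring_def hom_class_def FactRing_def cring_def)

lemma hom_coord_ring_one: "\<one>\<^bsub>hom_coord_ring V X\<^esub> = hom_class V X 1"
  by (simp add: hom_coord_ring_def hom_class_def FactRing_def poly_ring_simps)

lemma hom_coord_ring_mult:
  assumes "f \<in> carrier (poly_ring V)" "g \<in> carrier (poly_ring V)"
  shows "hom_class V X f \<otimes>\<^bsub>hom_coord_ring V X\<^esub> hom_class V X g = hom_class V X (f * g)"
  using ring_hom_mult[OF ideal.rcos_ring_hom[OF ideal_vanishing_ideal] assms, of X]
  by (simp add: hom_coord_ring_def hom_class_def poly_ring_simps Let_def)

lemma hom_coord_ring_add:
  assumes "f \<in> carrier (poly_ring V)" "g \<in> carrier (poly_ring V)"
  shows "hom_class V X f \<oplus>\<^bsub>hom_coord_ring V X\<^esub> hom_class V X g = hom_class V X (f + g)"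
  using ring_hom_add[OF ideal.rcos_ring_hom[OF ideal_vanishing_ideal] assms, of X]
  by (simp add: hom_coord_ring_def hom_class_def poly_ring_simps Let_def)

lemma hom_coord_ring_smult:
  assumes "f \<in> carrier (poly_ring V)"
  shows "c \<odot>\<^bsub>hom_coord_ring V X\<^esub> hom_class V X f = hom_class V X (mp_const c * f)"
  using hom_coord_ring_mult[OF poly_ring_const assms, of X c]
  by (simp add: hom_coord_ring_def Let_def)

lemma hom_class_eq_iff:
  assumes "f \<in> carrier (poly_ring V)" "g \<in> carrier (poly_ring V)"
  shows "hom_class V X f = hom_class V X g \<longleftrightarrow> f - g \<in> vanishing_ideal V X"
  using ring.quotient_eq_iff_same_a_r_cos[OF cring.axioms(1)[OF cring_poly_ring] ideal_vanishing_ideal assms]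
  by (simp add: hom_class_def poly_ring_minus[OF assms(2)])

lemma abelian_monoid_hom_coord_ring: "abelian_monoid (hom_coord_ring V X)"
  by (rule abelian_monoidI)
    (auto simp: hom_coord_ring_carrier hom_coord_ring_zero hom_coord_ring_add poly_ring_add
      poly_ring_zero ac_simps)

lemma hom_coord_ring_finsum:
  assumes "finite A" "\<And>i. i \<in> A \<Longrightarrow> f i \<in> carrier (poly_ring V)"
  shows "(\<Oplus>\<^bsub>hom_coord_ring V X\<^esub>i\<in>A. hom_class V X (f i)) = hom_class V X (\<Sum>i\<in>A. f i)"
  using assms
proof (induction A rule: finite_induct)
  case empty
  interpret abelian_monoid "hom_coord_ring V X" by (rule abelian_monoid_hom_coord_ring)
  show ?case by (simp add: hom_coord_ring_zero)
next
  case (insert x A)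
  interpret abelian_monoid "hom_coord_ring V X" by (rule abelian_monoid_hom_coord_ring)
  have "(\<Oplus>\<^bsub>hom_coord_ring V X\<^esub>i\<in>insert x A. hom_class V X (f i)) =
      hom_class V X (f x) \<oplus>\<^bsub>hom_coord_ring V X\<^esub> (\<Oplus>\<^bsub>hom_coord_ring V X\<^esub>i\<in>A. hom_class V X (f i))"
    using insert by (intro finsum_insert) (auto simp: hom_coord_ring_carrier)
  then show ?case using insert by (simp add: hom_coord_ring_add poly_ring_sum)
qed

section \<open>Monomials written as lists of variables\<close>

definition mp_monomial :: "'v list \<Rightarrow> 'v mpoly" where
  "mp_monomial ks = (\<Prod>v\<leftarrow>ks. mp_var v)"

lemma poly_ring_monomial: "set ks \<subseteq> V \<Longrightarrow> mp_monomial ks \<in> carrier (poly_ring V)"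
proof (induction ks)
  case (Cons k ks)
  then show ?case
    using poly_ring_mult[OF poly_ring_var, of k V "mp_monomial ks"] by (simp add: mp_monomial_def)
qed (simp add: mp_monomial_def poly_ring_one)

lemma monomial_of_hom_class:
  assumes "set ks \<subseteq> V"
  shows "monomial_of (hom_coord_ring V X) (\<lambda>i. hom_class V X (mp_var i)) ks = hom_class V X (mp_monomial ks)"
  using assms
proof (induction ks)
  case Nil
  then show ?case by (simp add: monomial_of_def mp_monomial_def hom_coord_ring_one)
next
  case (Cons k ks)
  then show ?case
    using hom_coord_ring_mult[OF poly_ring_var poly_ring_monomial, of k V ks X]
    by (simp add: monomial_of_def mp_monomial_def)
qed

lemma mp_monomial_single:
  "mp_monomial ks = Poly_Mapping.single (\<Sum>v\<leftarrow>ks. Poly_Mapping.single v 1) 1"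
  by (induction ks) (simp_all add: mp_monomial_def mp_var_def mult_single)

text \<open>Bridges exponent functions, in which polynomials are given, and lists of variables, on
  which straightening operates.\<close>

lemma exponent_as_list:
  fixes m :: "'v \<Rightarrow>\<^sub>0 nat"
  shows "\<exists>ks. set ks \<subseteq> Poly_Mapping.keys m \<and> (\<Sum>v\<leftarrow>ks. Poly_Mapping.single v 1) = m"
proof -
  have rep: "(\<Sum>v\<leftarrow>replicate c x. Poly_Mapping.single v 1) = Poly_Mapping.single x c" for c and x :: 'v
    by (induction c) (simp_all flip: single_add)
  have "\<exists>ks. set ks \<subseteq> A \<and> (\<Sum>v\<in>A. Poly_Mapping.single v (c v)) = (\<Sum>v\<leftarrow>ks. Poly_Mapping.single v 1)"
    if "finite A" for A and c :: "'v \<Rightarrow> nat"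
    using that
  proof (induction A rule: finite_induct)
    case (insert x A)
    then obtain ks where ks: "set ks \<subseteq> A"
      "(\<Sum>v\<in>A. Poly_Mapping.single v (c v)) = (\<Sum>v\<leftarrow>ks. Poly_Mapping.single v 1)" by blast
    have "(\<Sum>v\<leftarrow>replicate (c x) x @ ks. Poly_Mapping.single v 1) = (\<Sum>v\<in>insert x A. Poly_Mapping.single v (c v))"
      unfolding map_append sum_list_append rep ks(2)[symmetric] using insert.hyps by simp
    moreover have "set (replicate (c x) x @ ks) \<subseteq> insert x A" using ks(1) by auto
    ultimately show ?case by metis
  qed simp
  from this[OF finite_keys, of m "Poly_Mapping.lookup m"]
  show ?thesis unfolding poly_mapping_sum_single[of m, symmetric] by (simp only: eq_commute)
qed

lemma poly_ring_monomial_sum: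
  fixes f :: "'v mpoly"
  assumes f: "f \<in> carrier (poly_ring V)"
  shows "\<exists>(S :: ('v \<Rightarrow>\<^sub>0 nat) set) c ks. finite S \<and> (\<forall>m\<in>S. set (ks m) \<subseteq> V) \<and>
    f = (\<Sum>m\<in>S. mp_const (c m) * mp_monomial (ks m))"
proof -
  from choice[OF allI[OF exponent_as_list]]
  obtain ks :: "('v \<Rightarrow>\<^sub>0 nat) \<Rightarrow> 'v list" where ks_all: "\<forall>m. set (ks m) \<subseteq> Poly_Mapping.keys m \<and>
      (\<Sum>v\<leftarrow>ks m. Poly_Mapping.single v 1) = m" ..
  then have ks: "set (ks m) \<subseteq> Poly_Mapping.keys m" "(\<Sum>v\<leftarrow>ks m. Poly_Mapping.single v 1) = m" for m
    by simp_all
  have "Poly_Mapping.single m c = mp_const c * mp_monomial (ks m)" for m c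
    unfolding mp_monomial_single ks(2) mp_const_def mult_single by simp
  then have sum_eq: "(\<Sum>m\<in>Poly_Mapping.keys f. Poly_Mapping.single m (Poly_Mapping.lookup f m)) =
      (\<Sum>m\<in>Poly_Mapping.keys f. mp_const (Poly_Mapping.lookup f m) * mp_monomial (ks m))"
    by (intro sum.cong refl)
  show ?thesis
  proof (intro exI conjI ballI)
    show "f = (\<Sum>m\<in>Poly_Mapping.keys f. mp_const (Poly_Mapping.lookup f m) * mp_monomial (ks m))"
      by (rule trans[OF poly_mapping_sum_single sum_eq])
    fix m assume "m \<in> Poly_Mapping.keys f"
    then have "Poly_Mapping.keys m \<subseteq> V" using f by (simp add: poly_ring_def)
    then show "set (ks m) \<subseteq> V" using ks(1)[of m] by blast
  qed simp
qed

lemma mp_homogeneous_add: "mp_homogeneous r f \<Longrightarrow> mp_homogeneous r g \<Longrightarrow> mp_homogeneous r (f + g)"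
  using Poly_Mapping.keys_add[of f g] by (auto simp: mp_homogeneous_def)

lemma mp_homogeneous_const_mult: "mp_homogeneous r f \<Longrightarrow> mp_homogeneous r (mp_const c * f)"
  using keys_mult[of "mp_const c" f] by (fastforce simp: mp_homogeneous_def mp_const_def split: if_splits)

lemma mp_homogeneous_diff: "mp_homogeneous r f \<Longrightarrow> mp_homogeneous r g \<Longrightarrow> mp_homogeneous r (f - g)"
  using keys_diff[of f g] by (auto simp: mp_homogeneous_def)

lemma mp_homogeneous_sum: "(\<And>i. i \<in> A \<Longrightarrow> mp_homogeneous r (f i)) \<Longrightarrow> mp_homogeneous r (\<Sum>i\<in>A. f i)"
  by (induction A rule: infinite_finite_induct) (auto simp: mp_homogeneous_add, auto simp: mp_homogeneous_def)

lemma mp_homogeneous_monomial: "mp_homogeneous (length ks) (mp_monomial ks)"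
proof -
  have "(\<Sum>v\<in>Poly_Mapping.keys m. Poly_Mapping.lookup m v) = length ks"
    if "m = (\<Sum>v\<leftarrow>ks. Poly_Mapping.single v 1)" for m :: "'a \<Rightarrow>\<^sub>0 nat"
    using that
  proof (induction ks arbitrary: m)
    case (Cons k ks)
    then show ?case
      using setsum_keys_plus_distrib[of "\<lambda>_ x. x" "Poly_Mapping.single k (1 :: nat)" "\<Sum>v\<leftarrow>ks. Poly_Mapping.single v 1"]
      by simp
  qed simp
  then show ?thesis by (simp add: mp_homogeneous_def mp_monomial_single)
qed

section \<open>Standard monomials in the coordinate ring of the Grassmann variety\<close>

definition mp_combination :: "('v list \<Rightarrow> complex) \<Rightarrow> 'v mpoly" where
  "mp_combination a = (\<Sum>t | a t \<noteq> 0. mp_const (a t) * mp_monomial t)"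

lemma mp_combination_superset:
  assumes "finite S" "{t. a t \<noteq> 0} \<subseteq> S"
  shows "mp_combination a = (\<Sum>t\<in>S. mp_const (a t) * mp_monomial t)"
  unfolding mp_combination_def using assms
  by (intro sum.mono_neutral_left) (auto simp: mp_const_def)

lemma poly_ring_combination:
  assumes "{t. a t \<noteq> 0} \<subseteq> multichains V"
  shows "mp_combination a \<in> carrier (poly_ring V)"
  unfolding mp_combination_def
proof (intro poly_ring_sum poly_ring_mult poly_ring_const poly_ring_monomial)
  fix t assume "t \<in> {t. a t \<noteq> 0}"
  then show "set t \<subseteq> V" using assms by (auto simp: multichains_def)
qed

abbreviation grassmann_ideal :: "nat \<Rightarrow> nat \<Rightarrow> (nat \<Rightarrow> nat) mpoly set" where
  "grassmann_ideal d n \<equiv> vanishing_ideal (index_tuples d n) (grassmannian d n)"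

text \<open>A homogeneous polynomial of this kind is itself one of the generators, since every point
  of the cone is a wedge product.\<close>

lemma mem_grassmann_ideal:
  assumes d: "1 \<le> d" and f: "f \<in> carrier (poly_ring (index_tuples d n))" "mp_homogeneous r f"
    and zero: "\<And>w. mp_eval (wedge d n w) f = 0"
  shows "f \<in> grassmann_ideal d n"
proof -
  have "\<forall>l\<in>grassmannian d n. \<forall>x\<in>l. mp_eval x f = 0"
    using grassmannian_cone_wedge[OF d] zero by metis
  then have "f \<in> {f \<in> carrier (poly_ring (index_tuples d n)). (\<exists>k. mp_homogeneous k f) \<and>
      (\<forall>l\<in>grassmannian d n. \<forall>x\<in>l. mp_eval x f = 0)}"
    using f by blast
  then show ?thesis
    unfolding vanishing_ideal_def
    by (rule subsetD[OF ring.genideal_self[OF cring.axioms(1)[OF cring_poly_ring]], rotated]) blast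
qed

text \<open>Vanishing at a fixed wedge product defines an ideal; it contains the generators because
  that point lies on the cone.\<close>

lemma eval_grassmann_ideal:
  assumes d: "d \<le> n" and f: "f \<in> grassmann_ideal d n"
  shows "mp_eval (wedge d n w) f = 0"
proof -
  let ?P = "poly_ring (index_tuples d n)"
  let ?Z = "{f \<in> carrier ?P. mp_eval (wedge d n w) f = 0}"
  obtain l where l: "l \<in> grassmannian d n" "wedge d n w \<in> l"
    by (rule wedge_in_grassmannian_cone[OF d])
  have ring: "ring ?P" by (rule cring.axioms(1)[OF cring_poly_ring])
  have "ideal ?Z ?P"
  proof (rule idealI[OF ring])
    show "subgroup ?Z (add_monoid ?P)"
    proof (rule subgroup.intro)
      fix g assume g: "g \<in> ?Z"
      then have carr: "g \<in> carrier ?P" by simp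
      have inv: "inv\<^bsub>add_monoid ?P\<^esub> g = - g"
        by (rule poly_ring_a_inv[OF carr, unfolded a_inv_def])
      show "inv\<^bsub>add_monoid ?P\<^esub> g \<in> ?Z"
        unfolding inv using g by (simp add: poly_ring_uminus mp_eval_uminus)
    next
      fix g h assume "g \<in> ?Z" "h \<in> ?Z"
      then show "g \<otimes>\<^bsub>add_monoid ?P\<^esub> h \<in> ?Z"
        by (simp add: poly_ring_simps poly_ring_add mp_eval_add)
    next
      show "\<one>\<^bsub>add_monoid ?P\<^esub> \<in> ?Z" by (simp add: poly_ring_simps poly_ring_zero mp_eval_zero)
    qed auto
  next
    fix g h assume gh: "g \<in> ?Z" "h \<in> carrier ?P"
    then have "g * h \<in> ?Z" "h * g \<in> ?Z" by (simp_all add: poly_ring_mult mp_eval_mult)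
    then show "h \<otimes>\<^bsub>?P\<^esub> g \<in> ?Z" "g \<otimes>\<^bsub>?P\<^esub> h \<in> ?Z" by (simp_all only: poly_ring_simps)
  qed
  moreover have "{f \<in> carrier ?P. (\<exists>k. mp_homogeneous k f) \<and>
      (\<forall>l\<in>grassmannian d n. \<forall>x\<in>l. mp_eval x f = 0)} \<subseteq> ?Z"
    using l by blast
  ultimately have "grassmann_ideal d n \<subseteq> ?Z"
    unfolding vanishing_ideal_def by (rule ring.genideal_minimal[OF ring])
  then show ?thesis using f by blast
qed

lemma eval_monomial:
  "set ks \<subseteq> index_tuples d n \<Longrightarrow> mp_eval (wedge d n w) (mp_monomial ks) = monomial_fun d ks w"
proof (induction ks)
  case Nil
  then show ?case using mp_eval_const[of "wedge d n w" 1] by (simp add: mp_monomial_def monomial_fun_def mp_const_def)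
next
  case (Cons k ks)
  then show ?case
    by (simp add: mp_monomial_def monomial_fun_def mp_eval_mult mp_eval_var wedge_eq_minor)
qed

lemma eval_combination:
  assumes "{t. a t \<noteq> 0} \<subseteq> multichains (index_tuples d n)"
  shows "mp_eval (wedge d n w) (mp_combination a) = (\<Sum>t | a t \<noteq> 0. a t * monomial_fun d t w)"
  unfolding mp_combination_def mp_eval_sum
proof (rule sum.cong)
  fix t assume "t \<in> {t. a t \<noteq> 0}"
  then have "set t \<subseteq> index_tuples d n" using assms by (auto simp: multichains_def)
  then show "mp_eval (wedge d n w) (mp_const (a t) * mp_monomial t) = a t * monomial_fun d t w"
    by (simp add: mp_eval_mult mp_eval_const eval_monomial)
qed simp

text \<open>Straightening preserves the length of lists, so the difference is homogeneous, and its
  vanishing at wedge products places it in the ideal.\<close>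

lemma straighten_monomial:
  assumes d: "1 \<le> d" and ks: "set ks \<subseteq> index_tuples d n"
  shows "\<exists>a. finite {t. a t \<noteq> 0} \<and> {t. a t \<noteq> 0} \<subseteq> multichains (index_tuples d n) \<and>
    mp_monomial ks - mp_combination a \<in> grassmann_ideal d n"
proof -
  let ?L = "index_tuples d n"
  obtain a where a: "finite {t. a t \<noteq> 0}" "{t. a t \<noteq> 0} \<subseteq> {t \<in> multichains ?L. length t = length ks}"
    "monomial_fun d ks = (\<Sum>t | a t \<noteq> 0. cscale (a t) (monomial_fun d t))"
    by (rule cfun.span_image_family[OF monomial_fun_in_span[OF ks]])
  have sub: "{t. a t \<noteq> 0} \<subseteq> multichains ?L" using a(2) by blast
  have "mp_eval (wedge d n w) (mp_monomial ks - mp_combination a) = 0" for w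
    using fun_cong[OF a(3), of w] ks
    by (simp add: mp_eval_diff eval_monomial eval_combination[OF sub] sum_fun_apply cscale_def)
  moreover have "mp_homogeneous (length ks) (mp_monomial ks - mp_combination a)"
    unfolding mp_combination_def
  proof (intro mp_homogeneous_diff mp_homogeneous_sum mp_homogeneous_const_mult mp_homogeneous_monomial)
    fix t assume "t \<in> {t. a t \<noteq> 0}"
    then have "length t = length ks" using a(2) by auto
    then show "mp_homogeneous (length ks) (mp_monomial t)" using mp_homogeneous_monomial[of t] by simp
  qed
  ultimately have "mp_monomial ks - mp_combination a \<in> grassmann_ideal d n"
    using d ks by (intro mem_grassmann_ideal poly_ring_diff poly_ring_monomial poly_ring_combination[OF sub])
  then show ?thesis using a(1) sub by blast
qed

text \<open>Treated one monomial at a time, because the membership criterion is for homogeneous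
  polynomials.\<close>

lemma straighten_polynomial:
  assumes d: "1 \<le> d" and f: "f \<in> carrier (poly_ring (index_tuples d n))"
  shows "\<exists>a. finite {t. a t \<noteq> 0} \<and> {t. a t \<noteq> 0} \<subseteq> multichains (index_tuples d n) \<and>
    f - mp_combination a \<in> grassmann_ideal d n"
proof -
  let ?L = "index_tuples d n" and ?I = "grassmann_ideal d n"
  let ?std = "\<lambda>f. \<exists>a. finite {t. a t \<noteq> 0} \<and> {t. a t \<noteq> 0} \<subseteq> multichains ?L \<and> f - mp_combination a \<in> ?I"
  obtain S :: "((nat \<Rightarrow> nat) \<Rightarrow>\<^sub>0 nat) set" and c ks where S_all: "finite S \<and> (\<forall>m\<in>S. set (ks m) \<subseteq> ?L) \<and>
      f = (\<Sum>m\<in>S. mp_const (c m) * mp_monomial (ks m))"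
    using poly_ring_monomial_sum[OF f] by (elim exE)
  then have S: "finite S" "\<And>m. m \<in> S \<Longrightarrow> set (ks m) \<subseteq> ?L" by blast+
  have f_eq: "f = (\<Sum>m\<in>S. mp_const (c m) * mp_monomial (ks m))" using S_all by (elim conjE)
  have "?std (\<Sum>m\<in>S. mp_const (c m) * mp_monomial (ks m))"
    using S
  proof (induction S rule: finite_induct)
    case empty
    show ?case by (intro exI[of _ "\<lambda>t. 0"]) (simp add: mp_combination_def vanishing_ideal_zero)
  next
    case (insert m S)
    obtain a where a: "finite {t. a t \<noteq> 0}" "{t. a t \<noteq> 0} \<subseteq> multichains ?L"
      "mp_monomial (ks m) - mp_combination a \<in> ?I"
      using straighten_monomial[OF d, of "ks m"] insert.prems by blast
    obtain b where b: "finite {t. b t \<noteq> 0}" "{t. b t \<noteq> 0} \<subseteq> multichains ?L"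
      "(\<Sum>m\<in>S. mp_const (c m) * mp_monomial (ks m)) - mp_combination b \<in> ?I"
      using insert.IH insert.prems by blast
    define e where "e = (\<lambda>t. c m * a t + b t)"
    let ?T = "{t. a t \<noteq> 0} \<union> {t. b t \<noteq> 0}"
    have fin: "finite ?T" using a(1) b(1) by simp
    have sub: "{t. e t \<noteq> 0} \<subseteq> ?T" by (auto simp: e_def)
    have coeff: "mp_const (e t) * q = mp_const (c m) * (mp_const (a t) * q) + mp_const (b t) * q" for t and q
      by (simp add: e_def mp_const_def single_add mult_single distrib_right flip: mult.assoc)
    have "mp_combination e = mp_const (c m) * mp_combination a + mp_combination b"
      using mp_combination_superset[OF fin sub] mp_combination_superset[OF fin, of a]
        mp_combination_superset[OF fin, of b]
      by (simp add: coeff sum.distrib sum_distrib_left)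
    moreover have "mp_const (c m) * (mp_monomial (ks m) - mp_combination a) +
        ((\<Sum>m\<in>S. mp_const (c m) * mp_monomial (ks m)) - mp_combination b) \<in> ?I"
      by (intro vanishing_ideal_add vanishing_ideal_mult a(3) b(3) poly_ring_const)
    ultimately have "(\<Sum>m\<in>insert m S. mp_const (c m) * mp_monomial (ks m)) - mp_combination e \<in> ?I"
      using insert.hyps by (simp add: algebra_simps)
    moreover have "finite {t. e t \<noteq> 0}" using fin sub by (rule finite_subset[rotated])
    moreover have "{t. e t \<noteq> 0} \<subseteq> multichains ?L" using sub a(2) b(2) by blast
    ultimately show ?case by blast
  qed
  then show ?thesis unfolding f_eq .
qed

text \<open>Evaluation at all wedge products turns a congruence modulo the ideal into a linear
  relation between monomial functions.\<close>

lemma combination_unique: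
  assumes d: "1 \<le> d" "d \<le> n"
    and a: "finite {t. a t \<noteq> 0}" "{t. a t \<noteq> 0} \<subseteq> multichains (index_tuples d n)"
    and b: "finite {t. b t \<noteq> 0}" "{t. b t \<noteq> 0} \<subseteq> multichains (index_tuples d n)"
    and eq: "mp_combination a - mp_combination b \<in> grassmann_ideal d n"
  shows "a = b"
proof
  fix t
  let ?T = "{t. a t \<noteq> 0} \<union> {t. b t \<noteq> 0}"
  have fin: "finite ?T" using a(1) b(1) by simp
  have "(\<Sum>t\<in>?T. (a t - b t) * monomial_fun d t w) = 0" for w
  proof -
    have "(\<Sum>t | a t \<noteq> 0. a t * monomial_fun d t w) = (\<Sum>t\<in>?T. a t * monomial_fun d t w)"
      using fin by (intro sum.mono_neutral_left) auto
    moreover have "(\<Sum>t | b t \<noteq> 0. b t * monomial_fun d t w) = (\<Sum>t\<in>?T. b t * monomial_fun d t w)"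
      using fin by (intro sum.mono_neutral_left) auto
    ultimately show ?thesis
      using eval_grassmann_ideal[OF d(2) eq, of w]
      by (simp add: mp_eval_diff eval_combination[OF a(2)] eval_combination[OF b(2)] left_diff_distrib
          sum_subtractf)
  qed
  from monomial_fun_independent[OF d(1) fin _ this, of n t] a(2) b(2)
  show "a t = b t" by (cases "t \<in> ?T") auto
qed

section \<open>Straightening in degree two\<close>

definition ordered_pairs :: "'l::order set \<Rightarrow> ('l \<times> 'l) set" where
  "ordered_pairs L = {(k1, k2). k1 \<in> L \<and> k2 \<in> L \<and> k1 \<ge> k2}"

lemma finite_ordered_pairs: "finite L \<Longrightarrow> finite (ordered_pairs L)"
  by (rule finite_subset[of _ "L \<times> L"]) (auto simp: ordered_pairs_def)

text \<open>Converts the span statement into explicit coefficients, with its side conditions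
  recorded as conditions on the support.\<close>

lemma pair_monomial_expansion:
  assumes l: "l1 \<in> index_tuples d n" "l2 \<in> index_tuples d n"
  shows "\<exists>c. (\<forall>w. monomial_fun d [l1, l2] w =
      (\<Sum>k\<in>ordered_pairs (index_tuples d n). c k * monomial_fun d [fst k, snd k] w)) \<and>
    (\<forall>k. c k \<noteq> 0 \<longrightarrow> l1 \<le> fst k \<and> pair_content d k = pair_content d (l1, l2))"
proof -
  let ?L = "index_tuples d n"
  let ?K = "{k \<in> ordered_pairs ?L. l1 \<le> fst k \<and> pair_content d k = pair_content d (l1, l2)}"
  let ?b = "\<lambda>k. monomial_fun d [fst k, snd k]"
  have sub: "{\<lambda>w. minor d w k1 * minor d w k2 | k1 k2. k1 \<in> ?L \<and> k2 \<in> ?L \<and> k2 \<le> k1 \<and> l1 \<le> k1 \<and>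
      pair_content d (k1, k2) = pair_content d (l1, l2)} \<subseteq> ?b ` ?K"
  proof
    fix f assume "f \<in> {\<lambda>w. minor d w k1 * minor d w k2 | k1 k2. k1 \<in> ?L \<and> k2 \<in> ?L \<and> k2 \<le> k1 \<and>
      l1 \<le> k1 \<and> pair_content d (k1, k2) = pair_content d (l1, l2)}"
    then obtain k1 k2 where "(k1, k2) \<in> ?K" "f = (\<lambda>w. minor d w k1 * minor d w k2)"
      by (auto simp: ordered_pairs_def)
    then show "f \<in> ?b ` ?K"
      by (intro image_eqI[of _ _ "(k1, k2)"]) (auto simp: monomial_fun_def fun_eq_iff)
  qed
  have "monomial_fun d [l1, l2] = (\<lambda>w. minor d w l1 * minor d w l2)"
    by (simp add: monomial_fun_def fun_eq_iff)
  then have "monomial_fun d [l1, l2] \<in> cfun.span (?b ` ?K)"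
    using subsetD[OF cfun.span_mono[OF sub] pair_in_span[OF l]] by (simp only:)
  then obtain c where c: "finite {k. c k \<noteq> 0}" "{k. c k \<noteq> 0} \<subseteq> ?K"
    "monomial_fun d [l1, l2] = (\<Sum>k | c k \<noteq> 0. cscale (c k) (?b k))"
    by (rule cfun.span_image_family)
  have "monomial_fun d [l1, l2] w = (\<Sum>k\<in>ordered_pairs ?L. c k * ?b k w)" for w
  proof -
    have "monomial_fun d [l1, l2] w = (\<Sum>k | c k \<noteq> 0. c k * ?b k w)"
      unfolding c(3) sum_fun_apply by (simp add: cscale_def)
    also have "\<dots> = (\<Sum>k\<in>ordered_pairs ?L. c k * ?b k w)"
      using c(2) by (intro sum.mono_neutral_left finite_ordered_pairs finite_index_tuples) auto
    finally show ?thesis .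
  qed
  moreover have "l1 \<le> fst k \<and> pair_content d k = pair_content d (l1, l2)" if "c k \<noteq> 0" for k
    using c(2) that by auto
  ultimately show ?thesis by (intro exI[of _ c] conjI[OF allI allI[OF impI]])
qed

text \<open>Straightening with either factor first gives the same coefficients, so the larger index of a
  pair that occurs dominates both \<open>l1\<close> and \<open>l2\<close>.\<close>

lemma pair_straightening:
  assumes d: "1 \<le> d" and l: "l1 \<in> index_tuples d n" "l2 \<in> index_tuples d n"
  shows "\<exists>c. (\<forall>w. monomial_fun d [l1, l2] w =
      (\<Sum>k\<in>ordered_pairs (index_tuples d n). c k * monomial_fun d [fst k, snd k] w)) \<and>
    c (sup l1 l2, inf l1 l2) = 1 \<and>
    (\<forall>k\<in>ordered_pairs (index_tuples d n). c k \<noteq> 0 \<longrightarrow>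
      sup l1 l2 \<le> fst k \<and> pair_content d k = pair_content d (sup l1 l2, inf l1 l2))"
proof -
  let ?L = "index_tuples d n"
  let ?emb = "\<lambda>k. [fst k, snd k]"
  let ?T = "?emb ` ordered_pairs ?L"
  obtain c where c_all: "(\<forall>w. monomial_fun d [l1, l2] w =
      (\<Sum>k\<in>ordered_pairs ?L. c k * monomial_fun d (?emb k) w)) \<and>
    (\<forall>k. c k \<noteq> 0 \<longrightarrow> l1 \<le> fst k \<and> pair_content d k = pair_content d (l1, l2))"
    using pair_monomial_expansion[OF l] by (rule exE)
  note c = conjunct1[OF c_all, rule_format] conjunct2[OF c_all, rule_format]
  obtain c' where c'_all: "(\<forall>w. monomial_fun d [l2, l1] w =
      (\<Sum>k\<in>ordered_pairs ?L. c' k * monomial_fun d (?emb k) w)) \<and>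
    (\<forall>k. c' k \<noteq> 0 \<longrightarrow> l2 \<le> fst k \<and> pair_content d k = pair_content d (l2, l1))"
    using pair_monomial_expansion[OF l(2,1)] by (rule exE)
  note c' = conjunct1[OF c'_all, rule_format] conjunct2[OF c'_all, rule_format]
  have finT: "finite ?T" by (intro finite_imageI finite_ordered_pairs finite_index_tuples)
  have T: "?T \<subseteq> multichains ?L" by (auto simp: multichains_def ordered_pairs_def)
  have inj: "inj_on ?emb (ordered_pairs ?L)" by (auto simp: inj_on_def)
  have reindex: "(\<Sum>k\<in>ordered_pairs ?L. c k * monomial_fun d (?emb k) w) =
      (\<Sum>t\<in>?T. c (t ! 0, t ! 1) * monomial_fun d t w)" for c :: "_ \<Rightarrow> complex" and w
    by (subst sum.reindex[OF inj]) simp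
  have "(\<Sum>t\<in>?T. (c (t ! 0, t ! 1) - c' (t ! 0, t ! 1)) * monomial_fun d t w) = 0" for w
  proof -
    have "monomial_fun d [l1, l2] w = monomial_fun d [l2, l1] w" by (simp add: monomial_fun_def)
    then show ?thesis
      by (simp only: c(1) c'(1) reindex left_diff_distrib sum_subtractf) simp
  qed
  note indep = monomial_fun_independent[OF d finT T this]
  have same: "c k = c' k" if "k \<in> ordered_pairs ?L" for k
    using indep[OF imageI[OF that]] by simp
  have "[sup l1 l2, inf l1 l2] \<in> ?T"
    using sup_in_index_tuples[OF l] inf_in_index_tuples[OF l]
    by (intro image_eqI[of _ _ "(sup l1 l2, inf l1 l2)"]) (auto simp: ordered_pairs_def le_infI1)
  from monomial_fun_leading_coefficient[OF d finT T l _ this, of "\<lambda>t. c (t ! 0, t ! 1)"] c(1)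
  have one: "c (sup l1 l2, inf l1 l2) = 1" by (simp only: reindex) simp
  have dominates: "sup l1 l2 \<le> fst k \<and> pair_content d k = pair_content d (sup l1 l2, inf l1 l2)"
    if "k \<in> ordered_pairs ?L" "c k \<noteq> 0" for k
    using c(2)[OF that(2)] c'(2)[of k] same[OF that(1)] that(2) pair_content_sup_inf[of d l1 l2] by simp
  show ?thesis by (intro exI[of _ c] conjI[OF allI[OF c(1)] conjI[OF one ballI[OF impI[OF dominates]]]])
qed

section \<open>Transfer to the quotient ring\<close>

lemma hom_coord_ring_finsum_monomials:
  assumes "finite A" "\<And>t. t \<in> A \<Longrightarrow> set (ks t) \<subseteq> V"
  shows "(\<Oplus>\<^bsub>hom_coord_ring V X\<^esub>t\<in>A. a t \<odot>\<^bsub>hom_coord_ring V X\<^esub>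
      monomial_of (hom_coord_ring V X) (\<lambda>i. hom_class V X (mp_var i)) (ks t)) =
    hom_class V X (\<Sum>t\<in>A. mp_const (a t) * mp_monomial (ks t))"
proof -
  interpret abelian_monoid "hom_coord_ring V X" by (rule abelian_monoid_hom_coord_ring)
  have carr: "mp_const (a t) * mp_monomial (ks t) \<in> carrier (poly_ring V)" if "t \<in> A" for t
    using assms(2)[OF that] by (intro poly_ring_mult poly_ring_const poly_ring_monomial)
  have "(\<Oplus>\<^bsub>hom_coord_ring V X\<^esub>t\<in>A. a t \<odot>\<^bsub>hom_coord_ring V X\<^esub>
      monomial_of (hom_coord_ring V X) (\<lambda>i. hom_class V X (mp_var i)) (ks t)) =
    (\<Oplus>\<^bsub>hom_coord_ring V X\<^esub>t\<in>A. hom_class V X (mp_const (a t) * mp_monomial (ks t)))"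
  proof (rule finsum_cong')
    show "(\<lambda>t. hom_class V X (mp_const (a t) * mp_monomial (ks t))) \<in> A \<rightarrow> carrier (hom_coord_ring V X)"
      using carr by (auto simp: hom_coord_ring_carrier)
    fix t assume "t \<in> A"
    then show "a t \<odot>\<^bsub>hom_coord_ring V X\<^esub>
        monomial_of (hom_coord_ring V X) (\<lambda>i. hom_class V X (mp_var i)) (ks t) =
        hom_class V X (mp_const (a t) * mp_monomial (ks t))"
      using assms(2) by (simp add: monomial_of_hom_class hom_coord_ring_smult poly_ring_monomial)
  qed simp
  then show ?thesis using hom_coord_ring_finsum[OF assms(1) carr] by (simp only:)
qed

lemma hom_coord_ring_finsum_combination:
  assumes "finite {t. a t \<noteq> 0}" "{t. a t \<noteq> 0} \<subseteq> multichains V"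
  shows "(\<Oplus>\<^bsub>hom_coord_ring V X\<^esub>t\<in>{t. a t \<noteq> 0}. a t \<odot>\<^bsub>hom_coord_ring V X\<^esub>
      monomial_of (hom_coord_ring V X) (\<lambda>i. hom_class V X (mp_var i)) t) = hom_class V X (mp_combination a)"
  unfolding mp_combination_def using assms
  by (intro hom_coord_ring_finsum_monomials) (auto simp: multichains_def)

lemma standard_monomials_basis:
  assumes d: "1 \<le> d" "d \<le> n"
  shows "basis_family (hom_coord_ring (index_tuples d n) (grassmannian d n)) (multichains (index_tuples d n))
    (monomial_of (hom_coord_ring (index_tuples d n) (grassmannian d n))
      (\<lambda>i. hom_class (index_tuples d n) (grassmannian d n) (mp_var i)))"
    (is "basis_family ?R ?M (monomial_of ?R ?\<psi>)")
  unfolding basis_family_def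
proof (intro conjI ballI)
  let ?L = "index_tuples d n" and ?X = "grassmannian d n"
  show "monomial_of ?R ?\<psi> ` ?M \<subseteq> carrier ?R"
    by (auto simp: multichains_def monomial_of_hom_class hom_coord_ring_carrier poly_ring_monomial)
  fix F assume "F \<in> carrier ?R"
  then obtain f where f: "f \<in> carrier (poly_ring ?L)" "F = hom_class ?L ?X f"
    by (auto simp: hom_coord_ring_carrier)
  obtain a where a: "finite {t. a t \<noteq> 0}" "{t. a t \<noteq> 0} \<subseteq> ?M" "f - mp_combination a \<in> grassmann_ideal d n"
    using straighten_polynomial[OF d(1) f(1)] by blast
  have F_a: "F = hom_class ?L ?X (mp_combination a)"
    unfolding f(2) hom_class_eq_iff[OF f(1) poly_ring_combination[OF a(2)]] by (rule a(3))
  show "\<exists>!a. finite {j. a j \<noteq> 0} \<and> {j. a j \<noteq> 0} \<subseteq> ?M \<and>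
      F = (\<Oplus>\<^bsub>?R\<^esub>j\<in>{j. a j \<noteq> 0}. a j \<odot>\<^bsub>?R\<^esub> monomial_of ?R ?\<psi> j)"
  proof (rule ex1I[of _ a])
    show "finite {j. a j \<noteq> 0} \<and> {j. a j \<noteq> 0} \<subseteq> ?M \<and>
      F = (\<Oplus>\<^bsub>?R\<^esub>j\<in>{j. a j \<noteq> 0}. a j \<odot>\<^bsub>?R\<^esub> monomial_of ?R ?\<psi> j)"
      using a(1,2) F_a hom_coord_ring_finsum_combination[OF a(1,2)] by (simp only: simp_thms)
    fix b assume b: "finite {j. b j \<noteq> 0} \<and> {j. b j \<noteq> 0} \<subseteq> ?M \<and>
      F = (\<Oplus>\<^bsub>?R\<^esub>j\<in>{j. b j \<noteq> 0}. b j \<odot>\<^bsub>?R\<^esub> monomial_of ?R ?\<psi> j)"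
    then have b12: "finite {j. b j \<noteq> 0}" "{j. b j \<noteq> 0} \<subseteq> ?M" by blast+
    have "F = hom_class ?L ?X (mp_combination b)"
      using b hom_coord_ring_finsum_combination[OF b12] by (simp only: simp_thms)
    then have "hom_class ?L ?X (mp_combination b) = hom_class ?L ?X (mp_combination a)"
      using F_a by (simp only:)
    then have "mp_combination b - mp_combination a \<in> grassmann_ideal d n"
      unfolding hom_class_eq_iff[OF poly_ring_combination[OF b12(2)] poly_ring_combination[OF a(2)]] .
    then show "b = a" by (rule combination_unique[OF d b12 a(1,2)])
  qed
qed

text \<open>A Pluecker coordinate is a standard monomial of length one, so uniqueness of standard
  expansions separates them.\<close>

lemma inj_on_pluecker_coord:
  assumes d: "1 \<le> d" "d \<le> n"
  shows "inj_on (pluecker_coord d n) (index_tuples d n)"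
proof (rule inj_onI)
  fix x y assume x: "x \<in> index_tuples d n" and y: "y \<in> index_tuples d n"
    and eq: "pluecker_coord d n x = pluecker_coord d n y"
  let ?e = "\<lambda>x t. if t = [x] then 1 else 0 :: complex"
  have supp: "finite {t. ?e x t \<noteq> 0}" for x :: "nat \<Rightarrow> nat" by simp
  have chain: "{t. ?e x t \<noteq> 0} \<subseteq> multichains (index_tuples d n)" if "x \<in> index_tuples d n" for x
    using that by (auto simp: multichains_def)
  have comb: "mp_combination (?e x) = mp_var x" for x :: "nat \<Rightarrow> nat"
    by (simp add: mp_combination_def mp_monomial_def mp_const_def)
  have "mp_combination (?e x) - mp_combination (?e y) \<in> grassmann_ideal d n"
    using eq hom_class_eq_iff[OF poly_ring_var[OF x] poly_ring_var[OF y]]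
    unfolding comb pluecker_coord_def by blast
  then have "?e x = ?e y" by (rule combination_unique[OF d supp chain[OF x] supp chain[OF y]])
  from fun_cong[OF this, of "[x]"] show "x = y" by (simp split: if_splits)
qed

text \<open>Both sides are homogeneous of degree two, so their equality as functions of
  \<open>w\<close> lifts to the quotient.\<close>

lemma pluecker_product_straightening:
  assumes d: "1 \<le> d" "d \<le> n" and l: "l1 \<in> index_tuples d n" "l2 \<in> index_tuples d n"
  shows "\<exists>a. pluecker_coord d n l1 \<otimes>\<^bsub>grassmann_ring d n\<^esub> pluecker_coord d n l2 =
      (\<Oplus>\<^bsub>grassmann_ring d n\<^esub>k\<in>{(k1, k2). k1 \<in> index_tuples d n \<and> k2 \<in> index_tuples d n \<and> k1 \<ge> k2}.
        a k \<odot>\<^bsub>grassmann_ring d n\<^esub> monomial_of (grassmann_ring d n) (pluecker_coord d n) [fst k, snd k]) \<and>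
    a (sup l1 l2, inf l1 l2) = 1 \<and>
    (\<forall>k1 k2. k1 \<in> index_tuples d n \<longrightarrow> k2 \<in> index_tuples d n \<longrightarrow> k2 \<le> k1 \<longrightarrow> a (k1, k2) \<noteq> 0 \<longrightarrow>
      sup l1 l2 \<le> k1 \<and> pair_content d (k1, k2) = pair_content d (sup l1 l2, inf l1 l2))"
proof -
  let ?L = "index_tuples d n" and ?X = "grassmannian d n"
  obtain c where c_all: "(\<forall>w. monomial_fun d [l1, l2] w =
      (\<Sum>k\<in>ordered_pairs ?L. c k * monomial_fun d [fst k, snd k] w)) \<and>
    c (sup l1 l2, inf l1 l2) = 1 \<and>
    (\<forall>k\<in>ordered_pairs ?L. c k \<noteq> 0 \<longrightarrow>
      sup l1 l2 \<le> fst k \<and> pair_content d k = pair_content d (sup l1 l2, inf l1 l2))"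
    using pair_straightening[OF d(1) l] by (rule exE)
  note c = conjunct1[OF c_all, rule_format] conjunct1[OF conjunct2[OF c_all]]
    conjunct2[OF conjunct2[OF c_all], rule_format]
  let ?g = "\<Sum>k\<in>ordered_pairs ?L. mp_const (c k) * mp_monomial [fst k, snd k]"
  have sub: "set [fst k, snd k] \<subseteq> ?L" if "k \<in> ordered_pairs ?L" for k
    using that by (auto simp: ordered_pairs_def)
  have carr1: "mp_monomial [l1, l2] \<in> carrier (poly_ring ?L)" using l by (intro poly_ring_monomial) simp
  have carr2: "?g \<in> carrier (poly_ring ?L)"
    using sub by (intro poly_ring_sum poly_ring_mult poly_ring_const poly_ring_monomial)
  have "mp_monomial [l1, l2] - ?g \<in> grassmann_ideal d n"
  proof (rule mem_grassmann_ideal[OF d(1) poly_ring_diff[OF carr1 carr2], of 2])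
    have hom: "mp_homogeneous 2 (mp_monomial [x, y])" for x y :: "nat \<Rightarrow> nat"
      using mp_homogeneous_monomial[of "[x, y]"] by (simp add: numeral_2_eq_2)
    then show "mp_homogeneous 2 (mp_monomial [l1, l2] - ?g)"
      by (intro mp_homogeneous_diff mp_homogeneous_sum mp_homogeneous_const_mult)
    fix w
    have "mp_eval (wedge d n w) ?g = (\<Sum>k\<in>ordered_pairs ?L. c k * monomial_fun d [fst k, snd k] w)"
      unfolding mp_eval_sum mp_eval_mult mp_eval_const
      using eval_monomial[OF sub] by (intro sum.cong) auto
    then show "mp_eval (wedge d n w) (mp_monomial [l1, l2] - ?g) = 0"
      using eval_monomial[of "[l1, l2]" d n w] l c(1)[of w] by (simp add: mp_eval_diff)
  qed
  then have eq: "hom_class ?L ?X (mp_monomial [l1, l2]) = hom_class ?L ?X ?g"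
    using hom_class_eq_iff[OF carr1 carr2] by blast
  have \<psi>: "pluecker_coord d n = (\<lambda>i. hom_class ?L ?X (mp_var i))"
    by (simp add: pluecker_coord_def fun_eq_iff)
  have "pluecker_coord d n l1 \<otimes>\<^bsub>grassmann_ring d n\<^esub> pluecker_coord d n l2 = hom_class ?L ?X (mp_monomial [l1, l2])"
    unfolding \<psi> grassmann_ring_def
    by (simp add: hom_coord_ring_mult poly_ring_var l mp_monomial_def)
  also have "\<dots> = (\<Oplus>\<^bsub>grassmann_ring d n\<^esub>k\<in>ordered_pairs ?L.
      c k \<odot>\<^bsub>grassmann_ring d n\<^esub> monomial_of (grassmann_ring d n) (pluecker_coord d n) [fst k, snd k])"
    unfolding eq \<psi> grassmann_ring_def
    using sub by (intro hom_coord_ring_finsum_monomials[symmetric] finite_ordered_pairs finite_index_tuples)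
  finally have prod: "pluecker_coord d n l1 \<otimes>\<^bsub>grassmann_ring d n\<^esub> pluecker_coord d n l2 =
    (\<Oplus>\<^bsub>grassmann_ring d n\<^esub>k\<in>ordered_pairs ?L.
      c k \<odot>\<^bsub>grassmann_ring d n\<^esub> monomial_of (grassmann_ring d n) (pluecker_coord d n) [fst k, snd k])" .
  have dominates: "sup l1 l2 \<le> k1 \<and> pair_content d (k1, k2) = pair_content d (sup l1 l2, inf l1 l2)"
    if "k1 \<in> ?L" "k2 \<in> ?L" "k2 \<le> k1" "c (k1, k2) \<noteq> 0" for k1 k2
    using c(3)[of "(k1, k2)"] that by (simp add: ordered_pairs_def)
  show ?thesis
    by (rule exI[of _ c], rule conjI[OF prod[unfolded ordered_pairs_def]], rule conjI[OF c(2)])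
      (intro allI impI dominates)
qed

theorem proposition7p4:
  fixes n d :: nat
  assumes "n \<ge> 1" and "1 \<le> d" and "d \<le> n"
  shows "governed (grassmann_ring d n) (grassmann_grade d n) (index_tuples d n)
           (pluecker_coord d n)"
  unfolding governed_def
proof (intro conjI ballI impI)
  let ?L = "index_tuples d n"
  have \<psi>: "pluecker_coord d n = (\<lambda>i. hom_class ?L (grassmannian d n) (mp_var i))"
    by (simp add: pluecker_coord_def fun_eq_iff)
  show "finite_dist_lattice ?L" using assms(3) by (rule finite_dist_lattice_index_tuples)
  show "inj_on (pluecker_coord d n) ?L" using assms(2,3) by (rule inj_on_pluecker_coord)
  have homogeneous: "mp_homogeneous 1 (mp_var i)" for i :: "nat \<Rightarrow> nat"
    using mp_homogeneous_monomial[of "[i]"] by (simp add: mp_monomial_def)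
  show "pluecker_coord d n ` ?L \<subseteq> grassmann_grade d n 1"
  proof (rule image_subsetI)
    fix i assume "i \<in> ?L"
    then have "mp_var i \<in> {f \<in> carrier (poly_ring ?L). mp_homogeneous 1 f}"
      using homogeneous[of i] poly_ring_var[of i ?L] by simp
    then show "pluecker_coord d n i \<in> grassmann_grade d n 1"
      unfolding \<psi> grassmann_grade_def hom_coord_grade_def by (rule imageI)
  qed
  show "basis_family (grassmann_ring d n) (multichains ?L)
      (monomial_of (grassmann_ring d n) (pluecker_coord d n))"
    unfolding \<psi> grassmann_ring_def using assms(2,3) by (rule standard_monomials_basis)
  fix l1 l2 assume l: "l1 \<in> ?L" "l2 \<in> ?L"
  obtain a where a_all: "pluecker_coord d n l1 \<otimes>\<^bsub>grassmann_ring d n\<^esub> pluecker_coord d n l2 =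
      (\<Oplus>\<^bsub>grassmann_ring d n\<^esub>k\<in>{(k1, k2). k1 \<in> ?L \<and> k2 \<in> ?L \<and> k1 \<ge> k2}.
        a k \<odot>\<^bsub>grassmann_ring d n\<^esub> monomial_of (grassmann_ring d n) (pluecker_coord d n) [fst k, snd k]) \<and>
    a (sup l1 l2, inf l1 l2) = 1 \<and>
    (\<forall>k1 k2. k1 \<in> ?L \<longrightarrow> k2 \<in> ?L \<longrightarrow> k2 \<le> k1 \<longrightarrow> a (k1, k2) \<noteq> 0 \<longrightarrow>
      sup l1 l2 \<le> k1 \<and> pair_content d (k1, k2) = pair_content d (sup l1 l2, inf l1 l2))"
    using pluecker_product_straightening[OF assms(2,3) l] by (rule exE)
  note a = conjunct1[OF a_all] conjunct1[OF conjunct2[OF a_all]]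
    conjunct2[OF conjunct2[OF a_all], rule_format]
  \<comment> \<open>Join and meet take the roles of \<open>J\<close> and \<open>M\<close>; dominance
    and content are the two recorded facts about the support of \<open>a\<close>.\<close>
  have "straightening_cond ?L k1 k2 m1 m2"
    if k: "k1 \<in> ?L" "k2 \<in> ?L" "k2 \<le> k1" "a (k1, k2) \<noteq> 0"
      and m: "m1 \<in> maxSpec ?L (sup l1 l2)" "m2 \<in> maxSpec ?L (inf l1 l2)" "m2 \<le> m1" for k1 k2 m1 m2
    using straightening_cond_of_content[OF assms(2,3) sup_in_index_tuples[OF l] inf_in_index_tuples[OF l]
        k(1,2) conjunct1[OF a(3)[OF k]] conjunct2[OF a(3)[OF k]] m] .
  then have cond: "\<forall>k1\<in>?L. \<forall>k2\<in>?L. k1 \<ge> k2 \<and> a (k1, k2) \<noteq> 0 \<and>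
      (k1, k2) \<noteq> (sup l1 l2, inf l1 l2) \<longrightarrow>
      (\<forall>m1\<in>maxSpec ?L (sup l1 l2). \<forall>m2\<in>maxSpec ?L (inf l1 l2). m1 \<ge> m2 \<longrightarrow>
        straightening_cond ?L k1 k2 m1 m2)"
    by blast
  show "\<exists>a. pluecker_coord d n l1 \<otimes>\<^bsub>grassmann_ring d n\<^esub> pluecker_coord d n l2 =
      (\<Oplus>\<^bsub>grassmann_ring d n\<^esub>k\<in>{(k1, k2). k1 \<in> ?L \<and> k2 \<in> ?L \<and> k1 \<ge> k2}.
        a k \<odot>\<^bsub>grassmann_ring d n\<^esub> monomial_of (grassmann_ring d n) (pluecker_coord d n) [fst k, snd k]) \<and>
      a (sup l1 l2, inf l1 l2) = 1 \<and>
      (\<forall>k1\<in>?L. \<forall>k2\<in>?L. k1 \<ge> k2 \<and> a (k1, k2) \<noteq> 0 \<and> (k1, k2) \<noteq> (sup l1 l2, inf l1 l2) \<longrightarrow>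
        (\<forall>m1\<in>maxSpec ?L (sup l1 l2). \<forall>m2\<in>maxSpec ?L (inf l1 l2). m1 \<ge> m2 \<longrightarrow>
          straightening_cond ?L k1 k2 m1 m2))"
    by (rule exI[of _ a], rule conjI[OF a(1) conjI[OF a(2) cond]])
qed

end
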